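(* Let $\mathfrak{f}_t=(f_0(\cdot,t),f_1(\cdot,t))$, $t\ge 0$, with $f_0=f$ and $f_1=\partial f/\partial t$ (even in $x$, $\rho(\mathfrak{f}_0)<\infty$), evolve according to the nonlinear wave equation $$\frac{\partial^2 f}{\partial t^2}=\frac{\partial^2 f}{\partial x^2}-\operatorname{sign}\left(\frac{\partial f}{\partial t}(0,t)\right)\delta(x),\qquad x\in\mathcal{T}=\mathbb{R}/2\pi\mathbb{Z},$$ and put $\rho(t)=\rho(\mathfrak{f}_t)$, where $\rho(f_0,f_1)=2\pi\sup_{x\in\mathcal{T}}\left|\frac{\partial f_0}{\partial x}(x)+f_1(x)\right|$. For $T>0$ put $M=\min\{\rho(0),\rho(T)\}$. Then, as $M\to+\infty$ and $T\to+\infty$, $$\frac{\rho(0)-\rho(T)}{T}=1+O\left(\frac1T+\frac1M\right).$$ Moreover, for any other admissible control, i.e. for $\mathfrak{f}_t$ evolving according to $\frac{\partial^2 f}{\partial t^2}=\frac{\partial^2 f}{\partial x^2}+u(t)\delta(x)$ with any measurable $u$ satisfying $|u(t)|\le 1$, with $\rho(t)=\rho(\mathfrak{f}_t)$ and $M=\min\{\rho(0),\rho(T)\}$ defined in the same way, one has, as $M\to+\infty$ and $T\to+\infty$, $$\frac{\rho(0)-\rho(T)}{T}\le 1+O\left(\frac1T+\frac1M\right).$$ The constants implied by $O(\cdot)$ are absolute: they do not depend on the initial state or on the control.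
   Context: The controlled system is the closed string $\partial^2 f/\partial t^2=\partial^2 f/\partial x^2+u\delta$, $|u|\le 1$, where $x$ runs over the torus $\mathcal{T}=\mathbb{R}/2\pi\mathbb{Z}$ and $\delta$ is the Dirac delta at $x=0$. The state is the pair $\mathfrak{f}=(f_0,f_1)=(f,\partial f/\partial t)$ of even distributions on $\mathcal{T}$. Equations hold in the sense of distributions; $\sup$ is the essential supremum, and $\rho(\mathfrak{f})=+\infty$ if $\partial f_0/\partial x+f_1$ is not an essentially bounded function. Setting $g=\partial f_0/\partial x+f_1$, the controlled equation is equivalent (up to an additive constant in $f_0$, on which $\rho$ does not depend) to $\left(\frac{\partial}{\partial t}-\frac{\partial}{\partial x}\right)g(x,t)=\delta(x)u(t)$, since $\partial f_0/\partial x$ and $f_1$ are the odd and even parts of $g$ in $x$. The nonlinear wave equation corresponds to the feedback (dry friction) control $u(t)=-v(t)$ with $v(t)\in\operatorname{sign}(g(0,t))$ for a.e. $t$, where $\operatorname{sign}$ is multivalued: $\operatorname{sign}(y)=\{1\}$ for $y>0$, $\{-1\}$ for $y<0$, and $\operatorname{sign}(0)=[-1,1]$. Here $g(0,t)=\frac{\partial f}{\partial t}(0,t)$ is the half-sum $\frac12(g(0+,t)+g(0-,t))$ of the one-sided traces of $g$ at $x=0$; these exist as bounded measurable functions of $t$ because, on $(0,2\pi)\times(0,\infty)$, $g$ is a function of $x+t$. *)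

theory Defs
  imports "HOL-Analysis.Analysis" "HOL-Probability.Essential_Supremum"
begin

subsection \<open>Smooth functions\<close>

definition partial :: "'a::euclidean_space \<Rightarrow> ('a \<Rightarrow> real) \<Rightarrow> 'a \<Rightarrow> real" where
  "partial b f x = deriv (\<lambda>h. f (x + h *\<^sub>R b)) 0"

text \<open>Being coinductive, this says that all iterated partial derivatives, of every order, exist
  and are continuous.\<close>

coinductive smooth :: "('a::euclidean_space \<Rightarrow> real) \<Rightarrow> bool" where
  "continuous_on UNIV f \<Longrightarrow>
   (\<forall>b\<in>Basis. \<forall>x. (\<lambda>h. f (x + h *\<^sub>R b)) differentiable (at 0)) \<Longrightarrow>
   (\<forall>b\<in>Basis. smooth (partial b f)) \<Longrightarrow>
   smooth f"

subsection \<open>Distributions on the circle\<close>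

text \<open>Functions on the circle of length \<open>2\<pi>\<close> are \<open>2\<pi>\<close>-periodic functions on the line.\<close>

definition torus_test :: "(real \<Rightarrow> real) set" where
  "torus_test = {\<phi>. smooth \<phi> \<and> (\<forall>x. \<phi> (x + 2 * pi) = \<phi> x)}"

text \<open>A distribution is a total function on \<open>real \<Rightarrow> real\<close>, of which only the values
  on \<open>torus_test\<close> matter. The last conjunct is continuity for the usual
  Frechet topology; the suprema are finite on \<open>torus_test\<close>.\<close>

definition distribution :: "((real \<Rightarrow> real) \<Rightarrow> real) \<Rightarrow> bool" where
  "distribution L \<longleftrightarrow>
     (\<forall>\<phi>\<in>torus_test. \<forall>\<psi>\<in>torus_test. L (\<lambda>x. \<phi> x + \<psi> x) = L \<phi> + L \<psi>) \<and>
     (\<forall>\<phi>\<in>torus_test. \<forall>c. L (\<lambda>x. c * \<phi> x) = c * L \<phi>) \<and>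
     (\<exists>C N. \<forall>\<phi>\<in>torus_test. \<bar>L \<phi>\<bar> \<le> C * (\<Sum>k\<le>N. SUP x. \<bar>(deriv ^^ k) \<phi> x\<bar>))"

definition even_distribution :: "((real \<Rightarrow> real) \<Rightarrow> real) \<Rightarrow> bool" where
  "even_distribution L \<longleftrightarrow>
     distribution L \<and> (\<forall>\<phi>\<in>torus_test. L (\<lambda>x. \<phi> (- x)) = L \<phi>)"

definition distr_deriv :: "((real \<Rightarrow> real) \<Rightarrow> real) \<Rightarrow> (real \<Rightarrow> real) \<Rightarrow> real" where
  "distr_deriv L \<phi> = - L (deriv \<phi>)"

text \<open>\<open>is_Linfty L h\<close>: the distribution \<open>L\<close> is the essentially bounded function \<open>h\<close>.\<close>

definition is_Linfty :: "((real \<Rightarrow> real) \<Rightarrow> real) \<Rightarrow> (real \<Rightarrow> real) \<Rightarrow> bool" where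
  "is_Linfty L h \<longleftrightarrow>
     h \<in> borel_measurable lebesgue \<and> (\<forall>x. h (x + 2 * pi) = h x) \<and>
     (\<exists>B. AE x in lebesgue. \<bar>h x\<bar> \<le> B) \<and>
     (\<forall>\<phi>\<in>torus_test. L \<phi> = (LINT x:{0..2 * pi}|lebesgue. h x * \<phi> x))"

subsection \<open>The function \<open>\<rho>\<close>\<close>

definition state_g ::
  "((real \<Rightarrow> real) \<Rightarrow> real) \<Rightarrow> ((real \<Rightarrow> real) \<Rightarrow> real) \<Rightarrow> (real \<Rightarrow> real) \<Rightarrow> real" where
  "state_g f0 f1 \<phi> = distr_deriv f0 \<phi> + f1 \<phi>"

text \<open>A representative \<open>h\<close> is unique up to a null set, so the infimum is over at most one value;
  over the empty set it is \<open>\<infinity>\<close>.\<close>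

definition rho :: "((real \<Rightarrow> real) \<Rightarrow> real) \<Rightarrow> ((real \<Rightarrow> real) \<Rightarrow> real) \<Rightarrow> ereal" where
  "rho f0 f1 = (INF h\<in>{h. is_Linfty (state_g f0 f1) h}.
     ereal (2 * pi) * esssup (lebesgue_on {0..2 * pi}) (\<lambda>x. ereal \<bar>h x\<bar>))"

subsection \<open>The controlled string\<close>

text \<open>Space-time test functions \<open>\<psi>(x,t)\<close>, compactly supported in the circle times
  \<open>(0,\<infinity>)\<close>.\<close>

definition spacetime_test :: "(real \<times> real \<Rightarrow> real) set" where
  "spacetime_test = {\<psi>. smooth \<psi> \<and> (\<forall>x t. \<psi> (x + 2 * pi, t) = \<psi> (x, t)) \<and>
     (\<exists>a b. 0 < a \<and> a < b \<and> (\<forall>x t. t \<notin> {a..b} \<longrightarrow> \<psi> (x, t) = 0))}"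

abbreviation partial_x :: "(real \<times> real \<Rightarrow> real) \<Rightarrow> real \<times> real \<Rightarrow> real" where
  "partial_x \<equiv> partial (1, 0)"

abbreviation partial_t :: "(real \<times> real \<Rightarrow> real) \<Rightarrow> real \<times> real \<Rightarrow> real" where
  "partial_t \<equiv> partial (0, 1)"

text \<open>The pairing of a curve \<open>F\<close> of distributions on the circle, viewed as a space-time
  distribution, with a space-time test function.\<close>

definition st_pair ::
  "(real \<Rightarrow> (real \<Rightarrow> real) \<Rightarrow> real) \<Rightarrow> (real \<times> real \<Rightarrow> real) \<Rightarrow> real" where
  "st_pair F \<psi> = (LINT t:{0..}|lebesgue. F t (\<lambda>x. \<psi> (x, t)))"

text \<open>The state at time \<open>t\<close> is \<open>(f0 t, f1 t)\<close>. Weak continuity in \<open>t\<close> is what gives the state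
  at each single time a meaning and ties the initial state to the evolution; the last two
  conjuncts are \<open>\<partial>f0/\<partial>t = f1\<close> and \<open>\<partial>\<^sup>2f0/\<partial>t\<^sup>2 = \<partial>\<^sup>2f0/\<partial>x\<^sup>2 + u \<delta>\<close> in the sense of
  distributions.\<close>

definition string_evolution ::
  "(real \<Rightarrow> real) \<Rightarrow> (real \<Rightarrow> (real \<Rightarrow> real) \<Rightarrow> real) \<Rightarrow> (real \<Rightarrow> (real \<Rightarrow> real) \<Rightarrow> real) \<Rightarrow> bool"
where
  "string_evolution u f0 f1 \<longleftrightarrow>
     (\<forall>t\<ge>0. even_distribution (f0 t) \<and> even_distribution (f1 t)) \<and>
     (\<forall>\<phi>\<in>torus_test. continuous_on {0..} (\<lambda>t. f0 t \<phi>) \<and> continuous_on {0..} (\<lambda>t. f1 t \<phi>)) \<and>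
     (\<forall>\<psi>\<in>spacetime_test. - st_pair f0 (partial_t \<psi>) = st_pair f1 \<psi>) \<and>
     (\<forall>\<psi>\<in>spacetime_test.
        st_pair f0 (partial_t (partial_t \<psi>)) =
        st_pair f0 (partial_x (partial_x \<psi>)) + (LINT t:{0..}|lebesgue. u t * \<psi> (0, t)))"

definition admissible_control :: "(real \<Rightarrow> real) \<Rightarrow> bool" where
  "admissible_control u \<longleftrightarrow>
     u \<in> borel_measurable (lebesgue_on {0..}) \<and> (\<forall>t\<ge>0. \<bar>u t\<bar> \<le> 1)"

subsection \<open>Dry friction\<close>

definition Sign :: "real \<Rightarrow> real set" where
  "Sign y = (if y > 0 then {1} else if y < 0 then {- 1} else {- 1..1})"

text \<open>One-sided traces at \<open>x = 0\<close> of an essentially bounded function, in the Lebesgue sense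
  (they do not depend on the representative \<open>h\<close>).\<close>

definition right_trace :: "((real \<Rightarrow> real) \<Rightarrow> real) \<Rightarrow> real \<Rightarrow> bool" where
  "right_trace L p \<longleftrightarrow> (\<exists>h. is_Linfty L h \<and>
     ((\<lambda>\<epsilon>. (LINT x:{0..\<epsilon>}|lebesgue. \<bar>h x - p\<bar>) / \<epsilon>) \<longlongrightarrow> 0) (at_right 0))"

definition left_trace :: "((real \<Rightarrow> real) \<Rightarrow> real) \<Rightarrow> real \<Rightarrow> bool" where
  "left_trace L m \<longleftrightarrow> (\<exists>h. is_Linfty L h \<and>
     ((\<lambda>\<epsilon>. (LINT x:{- \<epsilon>..0}|lebesgue. \<bar>h x - m\<bar>) / \<epsilon>) \<longlongrightarrow> 0) (at_right 0))"

text \<open>The feedback \<open>u(t) = - v(t)\<close> with \<open>v(t) \<in> Sign (g(0,t))\<close> for almost every \<open>t\<close>. Along an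
  evolution with bounded \<open>g\<close>, on \<open>(0,2\<pi>)\<close> the function \<open>g\<close> depends on \<open>x + t\<close> only, so
  both traces exist for almost every \<open>t\<close> by Lebesgue's differentiation theorem.\<close>

definition dry_friction ::
  "(real \<Rightarrow> real) \<Rightarrow> (real \<Rightarrow> (real \<Rightarrow> real) \<Rightarrow> real) \<Rightarrow> (real \<Rightarrow> (real \<Rightarrow> real) \<Rightarrow> real) \<Rightarrow> bool"
where
  "dry_friction u f0 f1 \<longleftrightarrow>
     u \<in> borel_measurable (lebesgue_on {0..}) \<and>
     (AE t in lebesgue_on {0..}. \<exists>p m.
        right_trace (state_g (f0 t) (f1 t)) p \<and> left_trace (state_g (f0 t) (f1 t)) m \<and>
        - u t \<in> Sign ((p + m) / 2))"

end

theory Submission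
  imports Defs
begin

text \<open>
  \<open>g = \<partial>f0/\<partial>x + f1\<close> solves the transport equation \<open>\<partial>g/\<partial>t - \<partial>g/\<partial>x = u \<delta>\<close>: it is constant along the
  characteristics \<open>x + t = s\<close> and gains \<open>u\<close> at each passage through \<open>x = 0\<close>, once every \<open>2\<pi>\<close>.
  As \<open>\<bar>u\<bar> \<le> 1\<close>, the essential supremum of \<open>\<bar>g\<bar>\<close> loses at most 1 per passage. Under dry friction
  a value \<open>a\<close> of \<open>g\<close> with \<open>\<bar>a\<bar> > 1/2\<close> becomes \<open>a - sgn a\<close>, and the others become \<open>- a\<close>, so
  as long as the supremum stays above \<open>1/2\<close> it loses exactly 1 per passage. Every characteristic
  passes through \<open>0\<close> either \<open>\<lfloor>T/2\<pi>\<rfloor>\<close> or \<open>\<lceil>T/2\<pi>\<rceil>\<close> times before time \<open>T\<close>, hence \<open>\<rho>(0) - \<rho>(T)\<close> differs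
  from \<open>T\<close> by at most \<open>2\<pi>\<close>.

  The weak form of the equation is tested against \<open>p(x + t) \<eta>(t)\<close> with \<open>p\<close> a trigonometric
  polynomial. Then \<open>t \<mapsto> g_t(p(\<cdot> + t))\<close> is a finite combination of pairings with fixed test
  functions, which makes it continuous; pairings with translates of a general test function
  would need uniform bounds on the order of the distributions \<open>g_t\<close>.
\<close>

subsection \<open>Calculus of smooth functions\<close>

text \<open>The threshold 1/2 reflects that the friction law is implicit: the argument of
  \<open>Sign\<close> is the half-sum of the values before and after a passage, so the jump enters
  its own definition. For a small value \<open>a\<close> the only consistent jump is the one that
  makes the half-sum vanish.

  All data are given modulo null sets: the control, the state as a distribution, the traces through
  arbitrary representatives. Borel versions of the control and of the initial state are therefore
  fixed once, and a profile is built from them point by point. Its jump identity holds everywhere;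
  null sets enter only when the profile is compared with \<open>u\<close> and with the states.

  The weak equation sees positive times only, and weak continuity attaches the initial state.
  General test functions are reached by density separately at each fixed time, after the evolution
  of the trigonometric moments has been solved, because the order of the distributions may vary with
  time.\<close>

lemma smooth_continuous_on: "smooth f \<Longrightarrow> continuous_on A f"
  by (auto elim!: smooth.cases intro: continuous_on_subset)

lemma smooth_partial: "smooth f \<Longrightarrow> b \<in> Basis \<Longrightarrow> smooth (partial b f)"
  by (auto elim: smooth.cases)

lemma smooth_has_partial:
  assumes "smooth f" "b \<in> Basis"
  shows "((\<lambda>h. f (x + h *\<^sub>R b)) has_real_derivative partial b f x) (at 0)"
proof -
  have "(\<lambda>h. f (x + h *\<^sub>R b)) differentiable (at 0)"
    using assms by (auto elim: smooth.cases)
  then show ?thesis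
    unfolding partial_def by (simp add: DERIV_deriv_iff_real_differentiable)
qed

lemma partial_eqI:
  assumes "\<And>x. ((\<lambda>h. f (x + h *\<^sub>R b)) has_real_derivative f' x) (at 0)"
  shows "partial b f = f'"
  unfolding partial_def by (rule ext) (rule DERIV_imp_deriv[OF assms])

text \<open>Coinduction with explicit derivatives: an invariant family has to consist of continuous
  functions and contain a derivative of each member in each basis direction. This spares the closure
  proofs the computation of \<open>partial\<close>.\<close>

lemma smooth_coinduct_set:
  assumes "f \<in> X"
    and "\<And>g. g \<in> X \<Longrightarrow> continuous_on UNIV g"
    and "\<And>g b. g \<in> X \<Longrightarrow> b \<in> Basis \<Longrightarrow>
      \<exists>g'\<in>X. \<forall>x. ((\<lambda>h. g (x + h *\<^sub>R b)) has_real_derivative g' x) (at 0)"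
  shows "smooth f"
proof (rule smooth.coinduct[where X = "\<lambda>g. g \<in> X"])
  fix g assume g: "g \<in> X"
  have d: "partial b g \<in> X \<and> (\<forall>x. (\<lambda>h. g (x + h *\<^sub>R b)) differentiable (at 0))" 
    if "b \<in> Basis" for b
  proof -
    obtain g' where g': "g' \<in> X" "\<forall>x. ((\<lambda>h. g (x + h *\<^sub>R b)) has_real_derivative g' x) (at 0)"
      using assms(3)[OF g \<open>b \<in> Basis\<close>] by blast
    then have "partial b g = g'" by (intro partial_eqI) auto
    then show ?thesis using g' real_differentiable_def by blast
  qed
  then show "\<exists>f. g = f \<and> continuous_on UNIV f \<and>
      (\<forall>b\<in>Basis. \<forall>x. (\<lambda>h. f (x + h *\<^sub>R b)) differentiable (at 0)) \<and>
      (\<forall>b\<in>Basis. partial b f \<in> X \<or> smooth (partial b f))"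
    using assms(2)[OF g] by blast
qed (rule assms(1))

lemma smooth_const: "smooth (\<lambda>x::'a::euclidean_space. c)"
proof (rule smooth_coinduct_set[where X = "range (\<lambda>(c::real) (x::'a). c)"])
  fix g :: "'a \<Rightarrow> real" and b :: 'a
  assume g: "g \<in> range (\<lambda>c x. c)"
  show "\<exists>g'\<in>range (\<lambda>c x. c). \<forall>x. ((\<lambda>h. g (x + h *\<^sub>R b)) has_real_derivative g' x) (at 0)"
    by (rule bexI[of _ "\<lambda>_. 0"]) (use g in auto)
qed auto

text \<open>Products of two smooth functions are no invariant by themselves, since the derivative of
  a product is a sum of two products. The generated algebra is closed under differentiation.\<close>

inductive_set smooth_algebra :: "('a::euclidean_space \<Rightarrow> real) set" where
  "smooth f \<Longrightarrow> f \<in> smooth_algebra"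
| "f \<in> smooth_algebra \<Longrightarrow> g \<in> smooth_algebra \<Longrightarrow> (\<lambda>x. f x + g x) \<in> smooth_algebra"
| "f \<in> smooth_algebra \<Longrightarrow> g \<in> smooth_algebra \<Longrightarrow> (\<lambda>x. f x * g x) \<in> smooth_algebra"

lemma smooth_algebra_smooth:
  assumes "f \<in> smooth_algebra"
  shows "smooth f"
proof (rule smooth_coinduct_set[OF assms])
  fix g :: "'a \<Rightarrow> real"
  assume g: "g \<in> smooth_algebra"
  show "continuous_on UNIV g"
    using g by induction (simp_all add: smooth_continuous_on continuous_on_add continuous_on_mult)
next
  fix g :: "'a \<Rightarrow> real" and b :: 'a
  assume g: "g \<in> smooth_algebra" and b: "b \<in> Basis"
  show "\<exists>g'\<in>smooth_algebra. \<forall>x. ((\<lambda>h. g (x + h *\<^sub>R b)) has_real_derivative g' x) (at 0)"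
    using g
  proof induction
    case (1 f)
    then show ?case
      using smooth_has_partial[OF 1 b] smooth_partial[OF 1 b] smooth_algebra.intros(1) by blast
  next
    case (2 f g)
    then obtain f' g' where *: "f' \<in> smooth_algebra" "g' \<in> smooth_algebra"
      and d: "\<And>x. ((\<lambda>h. f (x + h *\<^sub>R b)) has_real_derivative f' x) (at 0)"
      "\<And>x. ((\<lambda>h. g (x + h *\<^sub>R b)) has_real_derivative g' x) (at 0)"
      by blast
    show ?case
      by (rule bexI[OF _ smooth_algebra.intros(2)[OF *]]) (intro allI DERIV_add d)
  next
    case (3 f g)
    then obtain f' g' where *: "f' \<in> smooth_algebra" "g' \<in> smooth_algebra"
      and d: "\<And>x. ((\<lambda>h. f (x + h *\<^sub>R b)) has_real_derivative f' x) (at 0)"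
      "\<And>x. ((\<lambda>h. g (x + h *\<^sub>R b)) has_real_derivative g' x) (at 0)"
      by blast
    show ?case
    proof (rule bexI)
      show "\<forall>x. ((\<lambda>h. f (x + h *\<^sub>R b) * g (x + h *\<^sub>R b)) has_real_derivative
          f' x * g x + g' x * f x) (at 0)"
        using DERIV_mult[OF d] by simp
      show "(\<lambda>x. f' x * g x + g' x * f x) \<in> smooth_algebra"
        using * 3 by (intro smooth_algebra.intros(2,3))
    qed
  qed
qed

lemma smooth_add: "smooth f \<Longrightarrow> smooth g \<Longrightarrow> smooth (\<lambda>x. f x + g x)"
  and smooth_mult: "smooth f \<Longrightarrow> smooth g \<Longrightarrow> smooth (\<lambda>x. f x * g x)"
  by (simp_all add: smooth_algebra_smooth smooth_algebra.intros)

lemma smooth_cmult: "smooth f \<Longrightarrow> smooth (\<lambda>x. c * f x)"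
  by (rule smooth_mult[OF smooth_const])

lemma smooth_diff: "smooth f \<Longrightarrow> smooth g \<Longrightarrow> smooth (\<lambda>x. f x - g x)"
  using smooth_add[OF _ smooth_cmult[of g "-1"], of f] by simp

lemma partial_add:
  assumes "smooth f" "smooth g" "b \<in> Basis"
  shows "partial b (\<lambda>x. f x + g x) = (\<lambda>x. partial b f x + partial b g x)"
  by (intro partial_eqI DERIV_add smooth_has_partial assms)

lemma partial_mult:
  assumes "smooth f" "smooth g" "b \<in> Basis"
  shows "partial b (\<lambda>x. f x * g x) = (\<lambda>x. partial b f x * g x + f x * partial b g x)"
proof (intro partial_eqI)
  fix x
  show "((\<lambda>h. f (x + h *\<^sub>R b) * g (x + h *\<^sub>R b)) has_real_derivative
      partial b f x * g x + f x * partial b g x) (at 0)"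
    using DERIV_mult[OF smooth_has_partial[OF assms(1,3)] smooth_has_partial[OF assms(2,3)], of x x]
    by (simp add: mult.commute)
qed

lemma partial_real: "partial (1::real) f = deriv f"
proof
  fix x
  have "deriv f x = deriv (\<lambda>h. f (h + x)) 0"
    unfolding deriv_def using DERIV_shift[of f _ 0 x] by simp
  then show "partial 1 f x = deriv f x"
    by (simp add: partial_def add.commute)
qed

lemma smooth_deriv: "smooth f \<Longrightarrow> smooth (deriv f)" for f :: "real \<Rightarrow> real"
  using smooth_partial[of f 1] by (simp add: partial_real)

lemma smooth_DERIV:
  fixes f :: "real \<Rightarrow> real"
  assumes "smooth f"
  shows "(f has_real_derivative deriv f x) (at x)"
  using smooth_has_partial[OF assms, of 1 x] DERIV_shift[of f _ 0 x]
  by (simp add: partial_real add.commute)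

lemma deriv_translate:
  fixes f :: "real \<Rightarrow> real"
  assumes "smooth f"
  shows "deriv (\<lambda>x. f (x + t)) = (\<lambda>x. deriv f (x + t))"
proof (intro ext DERIV_imp_deriv)
  fix x show "((\<lambda>x. f (x + t)) has_real_derivative deriv f (x + t)) (at x)"
    using smooth_DERIV[OF assms, of "x + t"] DERIV_shift[of f _ x t] by simp
qed

text \<open>For functions known through their derivative, such as the step function below; the
  antiderivative is the only new member of the invariant family.\<close>

lemma smooth_realI:
  fixes f :: "real \<Rightarrow> real"
  assumes d: "\<And>x. (f has_real_derivative f' x) (at x)" and f': "smooth f'"
  shows "smooth f"
proof (rule smooth_coinduct_set[where X = "insert f (Collect smooth)"])
  fix g :: "real \<Rightarrow> real"
  assume "g \<in> insert f (Collect smooth)"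
  then show "continuous_on UNIV g"
    using d by (auto intro: smooth_continuous_on DERIV_continuous_on has_field_derivative_at_within)
next
  fix g :: "real \<Rightarrow> real" and b :: real
  assume g: "g \<in> insert f (Collect smooth)" and b: "b \<in> Basis"
  then consider "g = f" | "smooth g" by auto
  then show "\<exists>g'\<in>insert f (Collect smooth).
      \<forall>x. ((\<lambda>h. g (x + h *\<^sub>R b)) has_real_derivative g' x) (at 0)"
  proof cases
    case 1
    then show ?thesis
      using d f' b DERIV_shift[of f _ 0] by (intro bexI[of _ f']) (auto simp: add.commute)
  next
    case 2
    then show ?thesis
      using smooth_has_partial[OF 2 b] smooth_partial[OF 2 b] by blast
  qed
qed simp

lemma has_partial_affine:
  fixes f :: "real \<Rightarrow> real"
  assumes "smooth f"
  shows "((\<lambda>h. f (c + (x + h *\<^sub>R b) \<bullet> v)) has_real_derivative (b \<bullet> v) * deriv f (c + x \<bullet> v)) (at 0)"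
proof -
  have "((\<lambda>h. f (c + (x \<bullet> v + h * (b \<bullet> v)))) has_real_derivative 
     deriv f (c + (x \<bullet> v + 0 * (b \<bullet> v))) * (b \<bullet> v)) (at 0)"
    by (rule DERIV_chain2[OF smooth_DERIV[OF assms]]) (auto intro!: derivative_eq_intros)
  then show ?thesis by (simp add: inner_add_left mult.commute)
qed

lemma smooth_affine:
  fixes f :: "real \<Rightarrow> real" and v :: "'a::euclidean_space"
  assumes "smooth f"
  shows "smooth (\<lambda>x. f (c + x \<bullet> v))"
proof -
  \<comment> \<open>The factor \<open>k\<close> belongs to the family because each derivative in
    direction \<open>b\<close> brings out \<open>b \<bullet> v\<close>.\<close>
  let ?X = "(\<lambda>(k, f) x. k * f (c + x \<bullet> v)) ` (UNIV \<times> Collect smooth)"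
  have X: "(\<lambda>x. k * g (c + x \<bullet> v)) \<in> ?X" if "smooth g" for k g
    using that by (intro image_eqI[of _ _ "(k, g)"]) auto
  show ?thesis
  proof (rule smooth_coinduct_set[where X = ?X])
    show "(\<lambda>x. f (c + x \<bullet> v)) \<in> ?X"
      using X[OF assms, of 1] by simp
  next
    fix g assume "g \<in> ?X"
    then obtain k f where g: "g = (\<lambda>x. k * f (c + x \<bullet> v))" and f: "smooth f" by auto
    have "continuous_on UNIV (\<lambda>x. f (c + x \<bullet> v))"
      by (rule continuous_on_compose2[OF smooth_continuous_on[OF f, of UNIV]])
        (simp_all add: continuous_on_add continuous_on_inner continuous_on_const continuous_on_id)
    then show "continuous_on UNIV g"
      unfolding g by (rule continuous_on_mult_left)
  next
    fix g and b :: 'a assume "g \<in> ?X"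
    then obtain k f where g: "g = (\<lambda>x. k * f (c + x \<bullet> v))" and f: "smooth f" by auto
    show "\<exists>g'\<in>?X. \<forall>x. ((\<lambda>h. g (x + h *\<^sub>R b)) has_real_derivative g' x) (at 0)"
    proof (rule bexI)
      show "\<forall>x. ((\<lambda>h. g (x + h *\<^sub>R b)) has_real_derivative
          (k * (b \<bullet> v)) * deriv f (c + x \<bullet> v)) (at 0)"
        unfolding g mult.assoc by (intro allI DERIV_cmult has_partial_affine f)
    qed (rule X[OF smooth_deriv[OF f]])
  qed
qed

lemma partial_affine:
  fixes f :: "real \<Rightarrow> real"
  assumes "smooth f"
  shows "partial b (\<lambda>x. f (c + x \<bullet> v)) = (\<lambda>x. (b \<bullet> v) * deriv f (c + x \<bullet> v))"
  by (intro partial_eqI has_partial_affine assms)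

subsection \<open>A smooth step\<close>

text \<open>The classical flat function exp(-1/x), with polynomials in 1/x as coefficients so that
  the family is closed under differentiation: in y = 1/x the operator d/dx is -y^2 d/dy, which turns
  \<open>p\<close> into \<open>monom 1 2 * (p - pderiv p)\<close>.\<close>

definition flat_exp :: "real poly \<Rightarrow> real \<Rightarrow> real" where
  "flat_exp p x = (if x > 0 then poly p (1 / x) * exp (- (1 / x)) else 0)"

lemma poly_times_exp_tendsto_0: "((\<lambda>y::real. poly p y * exp (- y)) \<longlongrightarrow> 0) at_top"
proof -
  have "((\<lambda>y::real. \<Sum>i\<le>degree p. coeff p i * (y ^ i / exp y)) \<longlongrightarrow> (\<Sum>i\<le>degree p. coeff p i * 0)) at_top"
    by (intro tendsto_intros tendsto_power_div_exp_0)
  then show ?thesis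
    by (simp add: poly_altdef sum_distrib_right exp_minus divide_inverse mult.assoc)
qed

lemma flat_exp_tendsto_0: "(flat_exp p \<longlongrightarrow> 0) (at 0)"
proof (rule filterlim_split_at)
  have "eventually (\<lambda>x::real. 0 = flat_exp p x) (at_left 0)"
    by (auto simp: flat_exp_def eventually_at intro: exI[of _ 1])
  then show "(flat_exp p \<longlongrightarrow> 0) (at_left 0)"
    by (rule Lim_transform_eventually[OF tendsto_const])
  have "((\<lambda>x. poly p (inverse x) * exp (- inverse x)) \<longlongrightarrow> 0) (at_right 0)"
    by (rule filterlim_compose[OF poly_times_exp_tendsto_0 filterlim_inverse_at_top_right])
  then show "(flat_exp p \<longlongrightarrow> 0) (at_right 0)"
    by (rule Lim_transform_eventually)
      (auto simp: flat_exp_def eventually_at divide_inverse intro: exI[of _ 1])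
qed

lemma flat_exp_has_derivative:
  "(flat_exp p has_real_derivative flat_exp (monom 1 2 * (p - pderiv p)) x) (at x)"
proof -
  consider "x > 0" | "x < 0" | "x = 0" by linarith
  then show ?thesis
  proof cases
    case 1
    have "((\<lambda>x. poly p (1 / x) * exp (- (1 / x))) has_real_derivative
        flat_exp (monom 1 2 * (p - pderiv p)) x) (at x)"
      using 1 unfolding flat_exp_def
      by (auto intro!: derivative_eq_intros DERIV_chain2[OF poly_DERIV] simp: poly_monom field_simps power2_eq_square)
    then show ?thesis
      by (rule has_field_derivative_transform_within_open[where S = "{0<..}"])
        (use 1 in \<open>auto simp: flat_exp_def\<close>)
  next
    case 2
    have "((\<lambda>x. 0) has_real_derivative flat_exp (monom 1 2 * (p - pderiv p)) x) (at x)"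
      using 2 by (simp add: flat_exp_def)
    then show ?thesis
      by (rule has_field_derivative_transform_within_open[where S = "{..<0}"])
        (use 2 in \<open>auto simp: flat_exp_def\<close>)
  next
    case 3
    \<comment> \<open>The difference quotient at 0 is again a member of the family, with one more
      factor 1/h in the polynomial, so \<open>flat_exp_tendsto_0\<close> gives its limit.\<close>
    have "flat_exp p h / h = flat_exp (monom 1 1 * p) h" for h
      by (auto simp: flat_exp_def poly_monom)
    then show ?thesis
      using 3 flat_exp_tendsto_0[of "monom 1 1 * p"] flat_exp_def[of _ 0] by (simp add: DERIV_def)
  qed
qed

lemma smooth_flat_exp: "smooth (flat_exp p)"
proof (rule smooth_coinduct_set[where X = "range flat_exp"])
  fix g assume "g \<in> range flat_exp"
  then show "continuous_on UNIV g"
    by (auto intro: DERIV_continuous_on has_field_derivative_at_within flat_exp_has_derivative)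
next
  fix g :: "real \<Rightarrow> real" and b :: real assume "g \<in> range flat_exp" "b \<in> Basis"
  then obtain p where "g = flat_exp p" "b = 1" by auto
  then show "\<exists>g'\<in>range flat_exp. \<forall>x. ((\<lambda>h. g (x + h *\<^sub>R b)) has_real_derivative g' x) (at 0)"
    using flat_exp_has_derivative[of p] DERIV_shift[of "flat_exp p" _ 0]
    by (intro bexI[of _ "flat_exp (monom 1 2 * (p - pderiv p))"]) (auto simp: add.commute)
qed auto

text \<open>Normalised antiderivative of a bump supported in [0, 1]. Differences of rescaled copies
  approximate indicators of time intervals, and the derivative is a one-sided mollifier; both are
  used to integrate the weak equation.\<close>

lemma smooth_step_exists:
  obtains \<Theta> :: "real \<Rightarrow> real"
  where "smooth \<Theta>" "\<And>x. x \<le> 0 \<Longrightarrow> \<Theta> x = 0" "\<And>x. x \<ge> 1 \<Longrightarrow> \<Theta> x = 1" 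
    "\<And>x. 0 \<le> \<Theta> x" "\<And>x. \<Theta> x \<le> 1" "\<And>x. x \<notin> {0..1} \<Longrightarrow> deriv \<Theta> x = 0"
proof -
  define \<theta> where "\<theta> x = flat_exp 1 x * flat_exp 1 (1 - x)" for x
  have "smooth (\<lambda>x. flat_exp 1 (1 + x \<bullet> (- 1 :: real)))"
    by (rule smooth_affine[OF smooth_flat_exp])
  then have sm: "smooth \<theta>"
    unfolding \<theta>_def by (intro smooth_mult smooth_flat_exp) (simp add: inner_real_def)
  have "\<exists>F. \<forall>x. (F has_vector_derivative \<theta> x) (at x)"
    using einterval_antiderivative[of "-\<infinity>" \<infinity> \<theta>] smooth_continuous_on[OF sm, of UNIV]
    by (auto simp: continuous_on_eq_continuous_at)
  then obtain F where F: "\<And>x. (F has_real_derivative \<theta> x) (at x)"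
    by (auto simp: has_real_derivative_iff_has_vector_derivative)
  have "\<theta> x \<ge> 0" for x by (auto simp: \<theta>_def flat_exp_def)
  then have mono: "F x \<le> F y" if "x \<le> y" for x y
    by (intro DERIV_nonneg_imp_nondecreasing[OF that]) (use F in blast)
  have F0: "F x = F 0" if "x \<le> 0" for x
  proof (cases "x < 0")
    case True
    obtain z where "z < 0" "F 0 - F x = (0 - x) * \<theta> z"
      using MVT2[OF True F] by auto
    then show ?thesis by (simp add: \<theta>_def flat_exp_def)
  qed (use that in auto)
  have F1: "F x = F 1" if "x \<ge> 1" for x
  proof (cases "x > 1")
    case True
    obtain z where "z > 1" "F x - F 1 = (x - 1) * \<theta> z"
      using MVT2[OF True F] by auto
    then show ?thesis by (simp add: \<theta>_def flat_exp_def)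
  qed (use that in auto)
  obtain z where z: "0 < z" "z < 1" "F 1 - F 0 = (1 - 0) * \<theta> z"
    using MVT2[of 0 1, OF _ F] by auto
  then have "\<theta> z > 0" by (simp add: \<theta>_def flat_exp_def)
  then have pos: "F 1 - F 0 > 0" using z(3) by simp
  define \<Theta> where "\<Theta> x = (1 / (F 1 - F 0)) * (F x - F 0)" for x
  have D: "(\<Theta> has_real_derivative (1 / (F 1 - F 0)) * \<theta> x) (at x)" for x
    unfolding \<Theta>_def using pos by (auto intro!: derivative_eq_intros F)
  show ?thesis
  proof
    show "smooth \<Theta>" by (rule smooth_realI[OF D smooth_cmult[OF sm]])
    show "deriv \<Theta> x = 0" if "x \<notin> {0..1}" for x
      using DERIV_imp_deriv[OF D, of x] that by (auto simp: \<theta>_def flat_exp_def)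
    show "0 \<le> \<Theta> x" for x
      using pos mono[of 0 x] F0[of x] by (cases "x \<ge> 0") (auto simp: \<Theta>_def)
    show "\<Theta> x \<le> 1" for x
      using pos mono[of x 1] F1[of x] by (cases "x \<le> 1") (auto simp: \<Theta>_def)
    show "\<Theta> x = 0" if "x \<le> 0" for x
      using F0[OF that] by (simp add: \<Theta>_def)
    show "\<Theta> x = 1" if "x \<ge> 1" for x
      using F1[OF that] pos by (simp add: \<Theta>_def)
  qed
qed

subsection \<open>Trigonometric polynomials are dense among the test functions\<close>

inductive trig_poly :: "(real \<Rightarrow> real) \<Rightarrow> bool" where
  trig_poly_cos: "trig_poly (\<lambda>x. cos (of_int n * x))"
| trig_poly_sin: "trig_poly (\<lambda>x. sin (of_int n * x))"
| trig_poly_cmult: "trig_poly p \<Longrightarrow> trig_poly (\<lambda>x. c * p x)"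
| trig_poly_add: "trig_poly p \<Longrightarrow> trig_poly q \<Longrightarrow> trig_poly (\<lambda>x. p x + q x)"

lemma trig_poly_const: "trig_poly (\<lambda>x. c)"
  using trig_poly_cmult[OF trig_poly_cos[of 0], of c] by simp

lemma trig_poly_diff: "trig_poly p \<Longrightarrow> trig_poly q \<Longrightarrow> trig_poly (\<lambda>x. p x - q x)"
  using trig_poly_add[OF _ trig_poly_cmult[of q "-1"], of p] by simp

lemma trig_poly_has_derivative:
  assumes "trig_poly p"
  shows "\<exists>p'. trig_poly p' \<and> (\<forall>x. (p has_real_derivative p' x) (at x))"
  using assms
proof induction
  case (trig_poly_cos n)
  show ?case
    by (intro exI[of _ "\<lambda>x. - of_int n * sin (of_int n * x)"] conjI allI
        trig_poly.trig_poly_cmult trig_poly.trig_poly_sin)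
      (auto intro!: derivative_eq_intros)
next
  case (trig_poly_sin n)
  show ?case
    by (intro exI[of _ "\<lambda>x. of_int n * cos (of_int n * x)"] conjI allI
        trig_poly.trig_poly_cmult trig_poly.trig_poly_cos)
      (auto intro!: derivative_eq_intros)
next
  case (trig_poly_cmult p c)
  then show ?case by (blast intro: trig_poly.trig_poly_cmult DERIV_cmult)
next
  case (trig_poly_add p q)
  then show ?case by (blast intro: trig_poly.trig_poly_add DERIV_add)
qed

lemma trig_poly_deriv: "trig_poly p \<Longrightarrow> trig_poly (deriv p)"
proof -
  assume "trig_poly p"
  then obtain p' where p': "trig_poly p'" "\<And>x. (p has_real_derivative p' x) (at x)"
    using trig_poly_has_derivative by blast
  then have "deriv p = p'" by (auto intro: DERIV_imp_deriv)
  then show ?thesis using p' by simp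
qed

lemma trig_poly_smooth: "trig_poly p \<Longrightarrow> smooth p"
proof (rule smooth_coinduct_set[where X = "Collect trig_poly"])
  fix g assume "g \<in> Collect trig_poly"
  then obtain g' where "\<And>x. (g has_real_derivative g' x) (at x)"
    using trig_poly_has_derivative by blast
  then show "continuous_on UNIV g"
    by (rule DERIV_continuous_on[OF has_field_derivative_at_within])
next
  fix g :: "real \<Rightarrow> real" and b :: real assume "g \<in> Collect trig_poly" "b \<in> Basis"
  then obtain g' where "trig_poly g'" "\<And>x. (g has_real_derivative g' x) (at x)" "b = 1"
    using trig_poly_has_derivative by auto
  then show "\<exists>g'\<in>Collect trig_poly. \<forall>x. ((\<lambda>h. g (x + h *\<^sub>R b)) has_real_derivative g' x) (at 0)"
    using DERIV_shift[of g _ 0] by (intro bexI[of _ g']) (auto simp: add.commute)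
qed auto

lemma trig_poly_periodic: "trig_poly p \<Longrightarrow> p (x + 2 * pi) = p x"
proof (induction rule: trig_poly.induct)
  case (trig_poly_cos n)
  show ?case
    using cos.plus_of_int[of "of_int n * x" n] by (simp add: algebra_simps)
next
  case (trig_poly_sin n)
  show ?case
    using sin.plus_of_int[of "of_int n * x" n] by (simp add: algebra_simps)
qed simp_all

lemma trig_poly_torus_test: "trig_poly p \<Longrightarrow> p \<in> torus_test"
  by (simp add: torus_test_def trig_poly_smooth trig_poly_periodic)

lemma trig_poly_translate: "trig_poly p \<Longrightarrow> trig_poly (\<lambda>x. p (x + t))"
proof (induction rule: trig_poly.induct)
  case (trig_poly_cos n)
  have "trig_poly (\<lambda>x. cos (of_int n * t) * cos (of_int n * x) - sin (of_int n * t) * sin (of_int n * x))"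
    by (intro trig_poly_diff trig_poly.intros)
  then show ?case by (simp add: distrib_left cos_add mult.commute)
next
  case (trig_poly_sin n)
  have "trig_poly (\<lambda>x. cos (of_int n * t) * sin (of_int n * x) + sin (of_int n * t) * cos (of_int n * x))"
    by (intro trig_poly.intros)
  then show ?case by (simp add: distrib_left sin_add mult.commute)
qed (auto intro: trig_poly.intros)

text \<open>Product-to-sum formulas. Closure under products is what the polynomials of the
  Stone-Weierstrass theorem require.\<close>

lemma trig_poly_mult_cos_sin:
  assumes "trig_poly q"
  shows "trig_poly (\<lambda>x. cos (of_int n * x) * q x) \<and> trig_poly (\<lambda>x. sin (of_int n * x) * q x)"
  using assms
proof induction
  case (trig_poly_cos m)
  have "trig_poly (\<lambda>x. (1/2) * (cos (of_int (n - m) * x) + cos (of_int (n + m) * x)))"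
    "trig_poly (\<lambda>x. (1/2) * (sin (of_int (n + m) * x) + sin (of_int (n - m) * x)))"
    by (intro trig_poly.intros)+
  then show ?case by (simp add: cos_times_cos sin_times_cos distrib_right left_diff_distrib)
next
  case (trig_poly_sin m)
  have "trig_poly (\<lambda>x. (1/2) * (sin (of_int (n + m) * x) - sin (of_int (n - m) * x)))"
    "trig_poly (\<lambda>x. (1/2) * (cos (of_int (n - m) * x) - cos (of_int (n + m) * x)))"
    by (intro trig_poly.intros trig_poly_diff)+
  then show ?case by (simp add: cos_times_sin sin_times_sin distrib_right left_diff_distrib)
next
  case (trig_poly_cmult p c)
  then show ?case
    using trig_poly.trig_poly_cmult[of "\<lambda>x. cos (of_int n * x) * p x" c]
      trig_poly.trig_poly_cmult[of "\<lambda>x. sin (of_int n * x) * p x" c]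
    by (simp add: mult.left_commute)
next
  case (trig_poly_add p q)
  then show ?case
    by (simp add: distrib_left trig_poly.trig_poly_add)
qed

lemma trig_poly_mult:
  assumes "trig_poly p" "trig_poly q"
  shows "trig_poly (\<lambda>x. p x * q x)"
  using assms(1)
proof induction
  case (trig_poly_cmult p c)
  then show ?case
    using trig_poly.trig_poly_cmult by (simp add: mult.assoc)
next
  case (trig_poly_add p q)
  then show ?case
    using trig_poly.trig_poly_add by (simp add: distrib_right)
qed (use trig_poly_mult_cos_sin[OF assms(2)] in auto)

text \<open>Only the mean value \<open>c\<close> obstructs a periodic antiderivative, so it is
  subtracted before integrating.\<close>

lemma trig_poly_antiderivative:
  assumes "trig_poly p"
  shows "\<exists>c q. trig_poly q \<and> (\<forall>x. (q has_real_derivative p x - c) (at x))"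
  using assms
proof induction
  case (trig_poly_cos n)
  show ?case
  proof (cases "n = 0")
    case True
    show ?thesis
      by (intro exI[of _ 1] exI[of _ "\<lambda>x. 0"]) (auto simp: True trig_poly_const)
  next
    case False
    show ?thesis
      by (intro exI[of _ 0] exI[of _ "\<lambda>x. (1 / of_int n) * sin (of_int n * x)"] conjI allI 
          trig_poly.intros) (use False in \<open>auto intro!: derivative_eq_intros\<close>)
  qed
next
  case (trig_poly_sin n)
  show ?case
  proof (cases "n = 0")
    case True
    show ?thesis
      by (intro exI[of _ 0] exI[of _ "\<lambda>x. 0"]) (auto simp: True trig_poly_const)
  next
    case False
    show ?thesis
      by (intro exI[of _ 0] exI[of _ "\<lambda>x. (- 1 / of_int n) * cos (of_int n * x)"] conjI allI 
          trig_poly.intros) (use False in \<open>auto intro!: derivative_eq_intros\<close>)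
  qed
next
  case (trig_poly_cmult p k)
  then obtain c q where "trig_poly q" and q: "\<And>x. (q has_real_derivative p x - c) (at x)" by blast
  then show ?case
    using DERIV_cmult[OF q, of k]
    by (intro exI[of _ "k * c"] exI[of _ "\<lambda>x. k * q x"])
      (auto simp: trig_poly.trig_poly_cmult right_diff_distrib)
next
  case (trig_poly_add p1 p2)
  then obtain c1 q1 c2 q2 where q: "trig_poly q1" "trig_poly q2"
    and d: "\<And>x. (q1 has_real_derivative p1 x - c1) (at x)" "\<And>x. (q2 has_real_derivative p2 x - c2) (at x)"
    by blast
  show ?case
    using DERIV_add[OF d]
    by (intro exI[of _ "c1 + c2"] exI[of _ "\<lambda>x. q1 x + q2 x"])
      (auto simp: q trig_poly.trig_poly_add algebra_simps)
qed

section \<open>Passage to the unit circle and Stone-Weierstrass approximation\<close>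

lemma real_polynomial_cis_trig_poly:
  assumes "real_polynomial_function (g :: complex \<Rightarrow> real)"
  shows "trig_poly (\<lambda>x. g (cis x))"
  using assms
proof induction
  case (linear f)
  interpret bounded_linear f by fact
  have "f (cis x) = f 1 * cos (of_int 1 * x) + f \<i> * sin (of_int 1 * x)" for x
  proof -
    have "cis x = cos x *\<^sub>R 1 + sin x *\<^sub>R \<i>"
      by (simp add: complex_eq_iff)
    then show ?thesis by (simp add: add scaleR mult.commute)
  qed
  moreover have "trig_poly (\<lambda>x. f 1 * cos (of_int 1 * x) + f \<i> * sin (of_int 1 * x))"
    by (intro trig_poly.intros)
  ultimately show ?case by presburger
qed (auto intro: trig_poly_const trig_poly_add trig_poly_mult)

lemma periodic_add_int:
  assumes "\<And>x. f (x + 2 * pi) = f x"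
  shows "f (x + of_int k * (2 * pi)) = f x"
proof (induction k rule: int_induct[where k = 0])
  case (step1 i)
  then show ?case using assms[of "x + of_int i * (2 * pi)"] by (simp add: algebra_simps)
next
  case (step2 i)
  then show ?case using assms[of "x + of_int (i - 1) * (2 * pi)"] by (simp add: algebra_simps)
qed simp

definition frac_pi :: "real \<Rightarrow> real" where
  "frac_pi x = x - of_int \<lfloor>x / (2 * pi)\<rfloor> * (2 * pi)"

lemma frac_pi_bounds: "0 \<le> frac_pi x" "frac_pi x < 2 * pi"
proof -
  have *: "frac_pi x = (x / (2 * pi) - of_int \<lfloor>x / (2 * pi)\<rfloor>) * (2 * pi)"
    by (simp add: frac_pi_def left_diff_distrib)
  have "0 \<le> x / (2 * pi) - of_int \<lfloor>x / (2 * pi)\<rfloor>"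
    "x / (2 * pi) - of_int \<lfloor>x / (2 * pi)\<rfloor> < 1"
    by linarith+
  then show "0 \<le> frac_pi x" "frac_pi x < 2 * pi"
    unfolding * by (simp_all only: zero_le_mult_iff mult_less_cancel_right1) simp_all
qed

lemma frac_pi_periodic: "frac_pi (x + 2 * pi) = frac_pi x"
proof -
  have "(x + 2 * pi) / (2 * pi) = x / (2 * pi) + 1" by (simp add: field_simps)
  then show ?thesis by (simp add: frac_pi_def algebra_simps)
qed

lemma frac_pi_eq: "0 \<le> x \<Longrightarrow> x < 2 * pi \<Longrightarrow> frac_pi x = x"
  by (simp add: frac_pi_def floor_eq_iff field_simps)

lemma periodic_frac_pi:
  assumes "\<And>x. f (x + 2 * pi) = f x"
  shows "f (frac_pi x) = f x"
  using periodic_add_int[of f x "- \<lfloor>x / (2 * pi)\<rfloor>", OF assms] by (simp add: frac_pi_def)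

text \<open>\<open>Arg\<close> jumps at the negative axis, so continuity is not a matter of
  composition. The graph of \<open>F\<close> is the image of [0, 2 pi] under x -> (cis x, f x),
  hence compact; a closed graph with values in a compact set gives continuity.\<close>

lemma continuous_periodic_through_circle:
  fixes f :: "real \<Rightarrow> real"
  assumes cont: "continuous_on UNIV f" and per: "\<And>x. f (x + 2 * pi) = f x"
  obtains F where "continuous_on (sphere 0 1) F" "\<And>x. F (cis x) = f x"
proof
  define F where "F z = f (Arg z)" for z
  show F: "F (cis x) = f x" for x
  proof -
    have "cis (Arg (cis x)) = cis x"
      by (simp add: cis_Arg)
    then obtain n :: int where "Arg (cis x) = x + of_int n * (2 * pi)"
      by (metis complex_eq_iff cis.simps sin_cos_eq_iff mult.commute mult.assoc)
    then show ?thesis using periodic_add_int[of f x n, OF per] by (simp add: F_def)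
  qed
  show "continuous_on (sphere 0 1) F"
  proof (rule continuous_from_closed_graph)
    have cf: "continuous_on A f" for A
      using cont continuous_on_subset by blast
    show "compact (f ` {0..2 * pi})"
      by (rule compact_continuous_image[OF cf compact_Icc])
    have circ: "sphere 0 1 = cis ` {0..2 * pi}"
    proof (intro set_eqI iffI)
      fix z :: complex assume "z \<in> sphere 0 1"
      then have z: "z = cis (Arg z)" by (subst cis_Arg) (auto simp: sgn_eq)
      have "cis (frac_pi (Arg z)) = cis (Arg z)"
        by (rule periodic_frac_pi) (simp add: complex_eq_iff)
      then show "z \<in> cis ` {0..2 * pi}"
        using frac_pi_bounds[of "Arg z"] z by (intro image_eqI[of _ _ "frac_pi (Arg z)"]) auto
    qed auto
    show "F \<in> sphere 0 1 \<rightarrow> f ` {0..2 * pi}"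
      unfolding circ using F by auto
    have "(\<lambda>z. (z, F z)) ` sphere 0 1 = (\<lambda>x. (cis x, f x)) ` {0..2 * pi}"
      unfolding circ image_image F ..
    moreover have "compact ((\<lambda>x. (cis x, f x)) ` {0..2 * pi})"
      by (intro compact_continuous_image continuous_on_Pair cf compact_Icc continuous_intros)
    ultimately show "closed ((\<lambda>z. (z, F z)) ` sphere 0 1)"
      by (simp add: compact_imp_closed)
  qed
qed

lemma trig_poly_uniformly_dense:
  fixes f :: "real \<Rightarrow> real"
  assumes "continuous_on UNIV f" "\<And>x. f (x + 2 * pi) = f x" "\<epsilon> > 0"
  obtains p where "trig_poly p" "\<And>x. \<bar>f x - p x\<bar> \<le> \<epsilon>"
proof -
  obtain F where F: "continuous_on (sphere 0 1) F" "\<And>x. F (cis x) = f x"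
    using continuous_periodic_through_circle[OF assms(1,2)] by metis
  obtain g where g: "real_polynomial_function g" "\<And>z. z \<in> sphere 0 1 \<Longrightarrow> \<bar>F z - g z\<bar> < \<epsilon>"
    using Stone_Weierstrass_real_polynomial_function[OF compact_sphere F(1) \<open>\<epsilon> > 0\<close>] by metis
  have "\<bar>f x - g (cis x)\<bar> \<le> \<epsilon>" for x
    using g(2)[of "cis x"] by (simp add: F(2))
  with real_polynomial_cis_trig_poly[OF g(1)] that show thesis by blast
qed

lemma torus_test_deriv:
  assumes "\<phi> \<in> torus_test"
  shows "deriv \<phi> \<in> torus_test"
proof -
  have sm: "smooth \<phi>" and per: "\<And>x. \<phi> (x + 2 * pi) = \<phi> x"
    using assms by (auto simp: torus_test_def)
  have "(\<phi> has_real_derivative deriv \<phi> (x + 2 * pi)) (at x)" for x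
    using smooth_DERIV[OF sm, of "x + 2 * pi"] per DERIV_shift[of \<phi> _ x "2 * pi"] by simp
  then have "deriv \<phi> (x + 2 * pi) = deriv \<phi> x" for x
    by (metis DERIV_imp_deriv)
  then show ?thesis using smooth_deriv[OF sm] by (simp add: torus_test_def)
qed

lemma torus_test_diff: "\<phi> \<in> torus_test \<Longrightarrow> \<psi> \<in> torus_test \<Longrightarrow> (\<lambda>x. \<phi> x - \<psi> x) \<in> torus_test"
  by (simp add: torus_test_def smooth_diff)

lemma deriv_funpow_Suc_eq:
  assumes "\<And>x. (f has_real_derivative f' x) (at x)"
  shows "(deriv ^^ Suc k) f = (deriv ^^ k) f'"
proof -
  have "deriv f = f'" by (rule ext) (rule DERIV_imp_deriv[OF assms])
  then show ?thesis by (simp add: funpow_Suc_right del: funpow.simps)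
qed

text \<open>Induction on the number of derivatives: approximate the derivative of \<phi>, subtract
  the mean of the approximation, integrate, and match the values at 0.\<close>

lemma trig_poly_dense:
  assumes "\<phi> \<in> torus_test" "\<epsilon> > 0"
  shows "\<exists>p. trig_poly p \<and> (\<forall>k\<le>N. \<forall>x. \<bar>(deriv ^^ k) (\<lambda>x. \<phi> x - p x) x\<bar> \<le> \<epsilon>)"
  using assms
proof (induction N arbitrary: \<phi> \<epsilon>)
  case 0
  then have "continuous_on UNIV \<phi>" "\<And>x. \<phi> (x + 2 * pi) = \<phi> x"
    by (auto simp: torus_test_def intro: smooth_continuous_on)
  then obtain p where "trig_poly p" "\<And>x. \<bar>\<phi> x - p x\<bar> \<le> \<epsilon>"
    using trig_poly_uniformly_dense \<open>\<epsilon> > 0\<close> by blast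
  then show ?case by auto
next
  case (Suc N)
  \<comment> \<open>Removing the mean doubles the error of the derivative to 2 \<delta>, and
    integration over at most one period multiplies it by 2 pi, whence the requirement 4 pi \<delta>
    \<le> \<epsilon>.\<close>
  define \<delta> where "\<delta> = \<epsilon> / (1 + 4 * pi)"
  have \<delta>: "\<delta> > 0" "\<delta> * (4 * pi) \<le> \<epsilon>" "\<delta> \<le> \<epsilon>" "2 * \<delta> \<le> \<epsilon>"
    using \<open>\<epsilon> > 0\<close> pi_gt_zero pi_ge_two by (auto simp: \<delta>_def field_simps)
  have sm: "smooth \<phi>" and per: "\<And>x. \<phi> (x + 2 * pi) = \<phi> x"
    using Suc.prems by (auto simp: torus_test_def)
  obtain p where p: "trig_poly p" "\<And>k x. k \<le> N \<Longrightarrow> \<bar>(deriv ^^ k) (\<lambda>x. deriv \<phi> x - p x) x\<bar> \<le> \<delta>"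
    using Suc.IH[OF torus_test_deriv[OF Suc.prems(1)] \<delta>(1)] by blast
  obtain c q where q: "trig_poly q" and dq: "\<And>x. (q has_real_derivative p x - c) (at x)"
    using trig_poly_antiderivative[OF p(1)] by blast
  define r where "r x = q x + (\<phi> 0 - q 0)" for x
  have r: "trig_poly r" unfolding r_def by (intro trig_poly_add q trig_poly_const)
  have d: "((\<lambda>x. \<phi> x - r x) has_real_derivative deriv \<phi> x - (p x - c)) (at x)" for x
    unfolding r_def using smooth_DERIV[OF sm, of x] dq[of x] by (auto intro!: derivative_eq_intros)
  have b0: "\<bar>deriv \<phi> x - p x\<bar> \<le> \<delta>" for x using p(2)[of 0 x] by simp
  have c: "\<bar>c\<bar> \<le> \<delta>"
    \<comment> \<open>the mean value of \<open>\<phi>'\<close> over a period vanishes\<close>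
  proof -
    obtain z where "\<phi> (2 * pi) - r (2 * pi) - (\<phi> 0 - r 0) = (2 * pi - 0) * (deriv \<phi> z - (p z - c))"
      using MVT2[of 0 "2 * pi", OF _ d] by auto
    moreover have "\<phi> (2 * pi) = \<phi> 0" "r (2 * pi) = r 0"
      using per[of 0] trig_poly_periodic[OF r, of 0] by auto
    ultimately show ?thesis using b0[of z] by auto
  qed
  have b1: "\<bar>deriv \<phi> x - (p x - c)\<bar> \<le> 2 * \<delta>" for x
    using b0[of x] c by linarith
  have b2: "\<bar>\<phi> x - r x\<bar> \<le> \<epsilon>" for x
  proof -
    let ?y = "frac_pi x"
    have "norm ((\<phi> ?y - r ?y) - (\<phi> 0 - r 0)) \<le> (2 * \<delta>) * norm (?y - 0)"
      by (rule field_differentiable_bound[of UNIV, OF _ has_field_derivative_at_within[OF d]])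
        (use b1 in auto)
    also have "\<dots> \<le> (2 * \<delta>) * (2 * pi)"
      using frac_pi_bounds[of x] \<delta>(1) by (intro mult_left_mono) auto
    finally have "\<bar>\<phi> ?y - r ?y\<bar> \<le> \<epsilon>" using \<delta>(2) by (simp add: r_def)
    moreover have "\<phi> ?y - r ?y = \<phi> x - r x"
      by (simp add: periodic_frac_pi[of \<phi>] per periodic_frac_pi[of r] trig_poly_periodic[OF r])
    ultimately show ?thesis by simp
  qed
  have "\<bar>(deriv ^^ k) (\<lambda>x. \<phi> x - r x) x\<bar> \<le> \<epsilon>" if k: "k \<le> Suc N" for k x
  proof -
    consider "k = 0" | "k = 1" | j where "k = Suc (Suc j)"
      by (metis One_nat_def not0_implies_Suc)
    then show ?thesis
    proof cases
      case 1
      then show ?thesis using b2 by simp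
    next
      case 2
      then show ?thesis using DERIV_imp_deriv[OF d, of x] b1[of x] \<delta>(4) by simp
    next
      case 3
      \<comment> \<open>From the second derivative on the constant \<open>c\<close> has disappeared,
        so the bound of the induction hypothesis applies unchanged.\<close>
      obtain p' where p': "\<And>x. (p has_real_derivative p' x) (at x)"
        using trig_poly_has_derivative[OF p(1)] by blast
      have "((\<lambda>x. deriv \<phi> x - (p x - c)) has_real_derivative deriv (deriv \<phi>) x - p' x) (at x)"
        "((\<lambda>x. deriv \<phi> x - p x) has_real_derivative deriv (deriv \<phi>) x - p' x) (at x)" for x
        by (auto intro!: derivative_eq_intros p' smooth_DERIV smooth_deriv sm)
      from this[THEN deriv_funpow_Suc_eq] have
        "(deriv ^^ Suc j) (\<lambda>x. deriv \<phi> x - (p x - c)) = (deriv ^^ Suc j) (\<lambda>x. deriv \<phi> x - p x)"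
        by metis
      then have "(deriv ^^ k) (\<lambda>x. \<phi> x - r x) x = (deriv ^^ Suc j) (\<lambda>x. deriv \<phi> x - p x) x"
        unfolding 3 deriv_funpow_Suc_eq[OF d] by simp
      then show ?thesis using p(2)[of "Suc j" x] \<delta>(3) k 3 by simp
    qed
  qed
  with r show ?case by blast
qed

subsection \<open>Bounded Borel functions on intervals\<close>

lemma bounded_borel_set_integrable:
  fixes f :: "real \<Rightarrow> real"
  assumes [measurable]: "f \<in> borel_measurable borel" and B: "\<And>x. x \<in> {a..b} \<Longrightarrow> \<bar>f x\<bar> \<le> B"
  shows "set_integrable lborel {a..b} f"
proof (rule set_integrable_bound)
  show "set_integrable lborel {a..b} (\<lambda>x. B)"
    by (rule borel_integrable_atLeastAtMost') simp
  show "AE x\<in>{a..b} in lborel. norm (f x) \<le> norm B"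
  proof (intro AE_I2 impI)
    fix x assume "x \<in> {a..b}"
    then show "norm (f x) \<le> norm B" using B[of x] by simp
  qed
qed (auto simp: set_borel_measurable_def)

lemma set_integral_combine:
  fixes f :: "real \<Rightarrow> real"
  assumes "set_integrable lborel {a..c} f" "a \<le> b" "b \<le> c"
  shows "(LINT x:{a..c}|lborel. f x) = (LINT x:{a..b}|lborel. f x) + (LINT x:{b..c}|lborel. f x)"
proof -
  have "{a..c} = {a..b} \<union> {b..c}" using assms by auto
  moreover have "AE x in lborel. \<not> (x \<in> {a..b} \<and> x \<in> {b..c})"
    using AE_lborel_singleton[of b] by eventually_elim auto
  moreover have "set_integrable lborel {a..b} f" "set_integrable lborel {b..c} f"
    using assms(2,3) by (auto intro: set_integrable_subset[OF assms(1)])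
  ultimately show ?thesis by (simp add: set_integral_Un_AE)
qed

lemma set_integral_translate:
  fixes f :: "real \<Rightarrow> real"
  shows "(LINT x:{a..b}|lborel. f (x + c)) = (LINT x:{a + c..b + c}|lborel. f x)"
proof -
  have "(\<integral>x. indicator {a + c..b + c} x *\<^sub>R f x \<partial>lborel) =
      \<bar>1\<bar> *\<^sub>R (\<integral>x. indicator {a + c..b + c} (c + 1 * x) *\<^sub>R f (c + 1 * x) \<partial>lborel)"
    by (rule lborel_integral_real_affine) simp
  also have "\<dots> = (\<integral>x. indicator {a..b} x *\<^sub>R f (x + c) \<partial>lborel)"
    by (simp, intro Bochner_Integration.integral_cong) (auto simp: indicator_def add.commute)
  finally show ?thesis by (simp add: set_lebesgue_integral_def)
qed

lemma set_integral_abs_le: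
  fixes f :: "real \<Rightarrow> real"
  assumes "f \<in> borel_measurable borel" and B: "\<And>x. x \<in> {a..b} \<Longrightarrow> \<bar>f x\<bar> \<le> B" and "a \<le> b"
  shows "\<bar>LINT x:{a..b}|lborel. f x\<bar> \<le> B * (b - a)"
proof -
  have "\<bar>LINT x:{a..b}|lborel. f x\<bar> \<le> (LINT x:{a..b}|lborel. \<bar>f x\<bar>)"
    unfolding set_lebesgue_integral_def
    by (rule order.trans[OF integral_abs_bound]) (simp add: abs_mult)
  also have "\<dots> \<le> (LINT x:{a..b}|lborel. B)"
    by (intro set_integral_mono set_integrable_abs bounded_borel_set_integrable[OF assms(1,2)]
        borel_integrable_atLeastAtMost' continuous_on_const) (simp_all add: B)
  also have "\<dots> = B * (b - a)"
    using \<open>a \<le> b\<close> by (simp add: set_integral_const)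
  finally show ?thesis .
qed

text \<open>Shifting by \<open>B\<close> makes the density nonnegative. The measures with densities
  B + f and B on [a, b] agree on half-lines, hence coincide, and densities with respect to a
  sigma-finite measure are unique almost everywhere.\<close>

lemma AE_zero_of_interval_integrals:
  fixes f :: "real \<Rightarrow> real"
  assumes f[measurable]: "f \<in> borel_measurable borel" and B: "\<And>x. \<bar>f x\<bar> \<le> B"
    and zero: "\<And>x. a \<le> x \<Longrightarrow> x \<le> b \<Longrightarrow> (LINT t:{a..x}|lborel. f t) = 0"
  shows "AE x in lborel. x \<in> {a..b} \<longrightarrow> f x = 0"
proof -
  have B0: "0 \<le> B" using order.trans[OF abs_ge_zero B] .
  have pos: "0 \<le> B + f x" for x using B[of x] by linarith
  define M where "M = density lborel (\<lambda>x. ennreal (indicator {a..b} x * (B + f x)))"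
  define N where "N = density lborel (\<lambda>x. ennreal (indicator {a..b} x * B))"
  have Bint: "set_integrable lborel {c..d} (\<lambda>x. B)" for c d :: real
    by (rule borel_integrable_atLeastAtMost') simp
  have fint: "set_integrable lborel {c..d} f" for c d
    by (rule bounded_borel_set_integrable[OF f B])
  have emb: "emeasure (density lborel (\<lambda>x. ennreal (indicator {a..b} x * g x))) {c<..} =
      ennreal (LINT x:{max a c..b}|lborel. g x)"
    if [measurable]: "g \<in> borel_measurable borel" and g: "\<And>x. 0 \<le> g x" "set_integrable lborel {max a c..b} g"
    for g :: "real \<Rightarrow> real" and c
  proof -
    have "emeasure (density lborel (\<lambda>x. ennreal (indicator {a..b} x * g x))) {c<..} =
      (\<integral>\<^sup>+x. ennreal (indicator {a..b} x * g x) * indicator {c<..} x \<partial>lborel)"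
      by (rule emeasure_density) auto
    also have "\<dots> = (\<integral>\<^sup>+x. ennreal (indicator {max a c..b} x *\<^sub>R g x) \<partial>lborel)"
      by (intro nn_integral_cong_AE, use AE_lborel_singleton[of c] in eventually_elim)
        (auto simp: indicator_def)
    also have "\<dots> = ennreal (LINT x:{max a c..b}|lborel. g x)"
      unfolding set_lebesgue_integral_def using g
      by (intro nn_integral_eq_integral) (auto simp: set_integrable_def)
    finally show ?thesis .
  qed
  have eM: "emeasure M {c<..} = ennreal (LINT x:{max a c..b}|lborel. B + f x)" for c
    unfolding M_def by (intro emb pos set_integral_add(1) Bint fint) auto
  have eN: "emeasure N {c<..} = ennreal (LINT x:{max a c..b}|lborel. B)" for c
    unfolding N_def by (intro emb Bint B0) auto
  have z: "(LINT x:{max a c..b}|lborel. f x) = 0" for c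
  proof (cases "max a c \<le> b")
    case True
    then have "(LINT x:{a..b}|lborel. f x) =
        (LINT x:{a..max a c}|lborel. f x) + (LINT x:{max a c..b}|lborel. f x)"
      by (intro set_integral_combine fint) auto
    then show ?thesis using zero[of b] zero[of "max a c"] True by simp
  qed (simp add: set_lebesgue_integral_def)
  have "M = N"
  proof (rule measure_eqI_lessThan)
    show "emeasure M {x<..} < \<infinity>" for x by (simp add: eM)
    show "emeasure M {x<..} = emeasure N {x<..}" for x
      unfolding eM eN set_integral_add(2)[OF Bint fint] z by simp
  qed (auto simp: M_def N_def)
  then have "AE x in lborel. ennreal (indicator {a..b} x * (B + f x)) = ennreal (indicator {a..b} x * B)"
    unfolding M_def N_def by (subst (asm) sigma_finite_measure.density_unique_iff[OF sigma_finite_lborel]) auto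
  then show ?thesis
  proof eventually_elim
    case (elim x)
    then show ?case
      using B0 pos[of x] by (auto simp: indicator_def)
  qed
qed

lemma AE_lebesgue_translate:
  fixes P :: "real \<Rightarrow> bool"
  assumes "AE x in lebesgue. P x"
  shows "AE x in lebesgue. P (x + c)"
proof -
  obtain N where N: "N \<in> null_sets lebesgue" "{x. \<not> P x} \<subseteq> N"
    using assms by (auto simp: eventually_ae_filter)
  then have "negligible ((+) (- c) ` N)"
    by (intro negligible_translation) (simp add: negligible_iff_null_sets)
  then have "(+) (- c) ` N \<in> null_sets lebesgue"
    by (simp add: negligible_iff_null_sets)
  moreover have "{x \<in> space lebesgue. \<not> P (x + c)} \<subseteq> (+) (- c) ` N"
  proof
    fix x assume "x \<in> {x \<in> space lebesgue. \<not> P (x + c)}"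
    then have "x + c \<in> N" using N by auto
    then show "x \<in> (+) (- c) ` N" by (intro image_eqI[of _ _ "x + c"]) auto
  qed
  ultimately show ?thesis by (rule AE_I')
qed

lemma AE_lborel_iff: "(AE x in lborel. P x) \<longleftrightarrow> (AE x in lebesgue. P x)" for P :: "real \<Rightarrow> bool"
  by (simp add: AE_completion_iff)

lemma set_integral_lebesgue_lborel:
  fixes f :: "real \<Rightarrow> real"
  assumes [measurable]: "f \<in> borel_measurable borel" "A \<in> sets borel"
  shows "(LINT x:A|lebesgue. f x) = (LINT x:A|lborel. f x)"
  unfolding set_lebesgue_integral_def by (rule integral_completion) simp

text \<open>The statement replaces Lebesgue's differentiation theorem: the averages converge by assumption,
  and integrating them over \<open>{a..x}\<close> identifies the limit.\<close>

lemma average_limit_AE: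
  fixes f q :: "real \<Rightarrow> real" and c :: real
  assumes f[measurable]: "f \<in> borel_measurable borel" and B: "\<And>x. \<bar>f x\<bar> \<le> B"
    and lim: "AE t in lborel. t \<in> {a..b} \<longrightarrow>
      (\<lambda>n. real (Suc n) * (LINT s:{t + c / real (Suc n)..t + (c + 1) / real (Suc n)}|lborel. f s))
        \<longlonglongrightarrow> q t"
  shows "AE t in lborel. t \<in> {a..b} \<longrightarrow> q t = f t"
proof -
  have B0: "0 \<le> B" using order.trans[OF abs_ge_zero B] .
  have fint: "set_integrable lborel {c..d} f" for c d
    by (rule bounded_borel_set_integrable[OF f B])
  \<comment> \<open>The windows start at t + c/(n + 1) with t \<ge> a, hence never before a -
    \<bar>c\<bar>; to the right of \<open>lo\<close> their integrals are differences of
    \<Phi>.\<close>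
  define lo where "lo = a - \<bar>c\<bar>"
  define \<Phi> where "\<Phi> y = (LINT s:{lo..y}|lborel. f s)" for y
  have \<Phi>_diff: "(LINT s:{u..v}|lborel. f s) = \<Phi> v - \<Phi> u" if "lo \<le> u" "u \<le> v" for u v
    unfolding \<Phi>_def using set_integral_combine[OF fint that] by simp
  have lip: "\<bar>\<Phi> v - \<Phi> u\<bar> \<le> B * (v - u)" if "u \<le> v" for u v
  proof (cases "lo \<le> u")
    case True
    then show ?thesis
      using set_integral_abs_le[OF f B \<open>u \<le> v\<close>] \<Phi>_diff[OF True \<open>u \<le> v\<close>] by simp
  next
    case False
    then have u: "\<Phi> u = 0" by (simp add: \<Phi>_def set_lebesgue_integral_def)
    show ?thesis
    proof (cases "lo \<le> v")
      case True
      have "\<bar>\<Phi> v\<bar> \<le> B * (v - lo)"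
        unfolding \<Phi>_def by (rule set_integral_abs_le[OF f B True])
      also have "\<dots> \<le> B * (v - u)" using False B0 by (intro mult_left_mono) auto
      finally show ?thesis using u by simp
    next
      case False
      then show ?thesis using u B0 that by (simp add: \<Phi>_def set_lebesgue_integral_def)
    qed
  qed
  have "B-lipschitz_on UNIV \<Phi>"
  proof (rule lipschitz_onI)
    fix x y :: real
    show "dist (\<Phi> x) (\<Phi> y) \<le> B * dist x y"
      using lip[of x y] lip[of y x] by (cases "x \<le> y") (auto simp: dist_real_def abs_minus_commute)
  qed (rule B0)
  then have cont: "continuous_on UNIV \<Phi>" by (rule lipschitz_on_continuous_on)
  then have [measurable]: "\<Phi> \<in> borel_measurable borel" by (rule borel_measurable_continuous_onI)
  \<comment> \<open>A second antiderivative: integrating the averages over t produces difference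
    quotients of \<Psi>, which converge because \<Phi> is continuous. Thus \<Phi> itself is never
    differentiated.\<close>
  have "\<exists>F. \<forall>x. (F has_vector_derivative \<Phi> x) (at x)"
    using einterval_antiderivative[of "-\<infinity>" \<infinity> \<Phi>] cont by (auto simp: continuous_on_eq_continuous_at)
  then obtain \<Psi> where \<Psi>: "\<And>x. (\<Psi> has_real_derivative \<Phi> x) (at x)"
    by (auto simp: has_real_derivative_iff_has_vector_derivative)
  define F where "F n t = real (Suc n) * (\<Phi> (t + (c + 1) / real (Suc n)) - \<Phi> (t + c / real (Suc n)))"
    for n t
  have [measurable]: "F n \<in> borel_measurable borel" for n
    unfolding F_def by measurable
  have Fbound: "\<bar>F n t\<bar> \<le> B" for n t
  proof -
    have "\<bar>F n t\<bar> = real (Suc n) * \<bar>\<Phi> (t + (c + 1) / real (Suc n)) - \<Phi> (t + c / real (Suc n))\<bar>"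
      by (simp add: F_def abs_mult)
    also have "\<dots> \<le> real (Suc n) * (B * (t + (c + 1) / real (Suc n) - (t + c / real (Suc n))))"
      by (intro mult_left_mono lip) (auto simp: divide_right_mono)
    also have "\<dots> = B" by (simp add: add_divide_distrib)
    finally show ?thesis .
  qed
  have Flim: "AE t in lborel. t \<in> {a..b} \<longrightarrow> (\<lambda>n. F n t) \<longlonglongrightarrow> q t"
    using lim
  proof eventually_elim
    case (elim t)
    show ?case
    proof
      assume t: "t \<in> {a..b}"
      have "- \<bar>c\<bar> \<le> c / real (Suc n)" for n
      proof -
        have "\<bar>c / real (Suc n)\<bar> \<le> \<bar>c\<bar> / 1"
          unfolding abs_divide by (intro divide_left_mono) auto
        then show ?thesis by linarith
      qed
      then have "F n t = real (Suc n) * (LINT s:{t + c / real (Suc n)..t + (c + 1) / real (Suc n)}|lborel. f s)" for n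
        unfolding F_def using t
        by (subst \<Phi>_diff) (auto simp: lo_def divide_right_mono intro: add_mono[of a t "- \<bar>c\<bar>", simplified])
      then show "(\<lambda>n. F n t) \<longlonglongrightarrow> q t" using elim t by simp
    qed
  qed
  \<comment> \<open>\<open>q\<close> comes without measurability; \<open>q'\<close> is a bounded
    Borel function that equals it almost everywhere on the interval.\<close>
  define q' where "q' t = max (- B) (min B (lim (\<lambda>n. F n t)))" for t
  have [measurable]: "q' \<in> borel_measurable borel"
    unfolding q'_def by measurable
  have q'bound: "\<bar>q' t\<bar> \<le> B" for t
    using B0 by (auto simp: q'_def)
  have q': "AE t in lborel. t \<in> {a..b} \<longrightarrow> (\<lambda>n. F n t) \<longlonglongrightarrow> q' t \<and> q' t = q t"
    using Flim
  proof eventually_elim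
    case (elim t)
    show ?case
    proof
      assume "t \<in> {a..b}"
      then have q: "(\<lambda>n. F n t) \<longlonglongrightarrow> q t" using elim by simp
      then have "\<bar>q t\<bar> \<le> B"
        by (rule LIMSEQ_le_const2[OF tendsto_rabs]) (use Fbound in auto)
      with q show "(\<lambda>n. F n t) \<longlonglongrightarrow> q' t \<and> q' t = q t"
        by (auto simp: q'_def limI)
    qed
  qed
  have diff_quot: "(\<lambda>n. real (Suc n) * (\<Psi> (x + (c + 1) / real (Suc n)) - \<Psi> (x + c / real (Suc n)))) \<longlonglongrightarrow> \<Phi> x" for x
  proof -
    have "\<exists>z. x + c / real (Suc n) < z \<and> z < x + (c + 1) / real (Suc n) \<and>
      \<Psi> (x + (c + 1) / real (Suc n)) - \<Psi> (x + c / real (Suc n)) =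
      (x + (c + 1) / real (Suc n) - (x + c / real (Suc n))) * \<Phi> z" for n
      by (rule MVT2[OF _ \<Psi>]) (simp add: divide_strict_right_mono)
    then obtain z where z: "\<And>n. x + c / real (Suc n) < z n" "\<And>n. z n < x + (c + 1) / real (Suc n)"
      "\<And>n. \<Psi> (x + (c + 1) / real (Suc n)) - \<Psi> (x + c / real (Suc n)) =
      (x + (c + 1) / real (Suc n) - (x + c / real (Suc n))) * \<Phi> (z n)"
      by metis
    have "real (Suc n) * (\<Psi> (x + (c + 1) / real (Suc n)) - \<Psi> (x + c / real (Suc n))) = \<Phi> (z n)" for n
      unfolding z(3) by (simp add: add_divide_distrib)
    moreover have "z \<longlonglongrightarrow> x"
    proof (rule tendsto_sandwich)
      have l: "(\<lambda>n. x + d / real (Suc n)) \<longlonglongrightarrow> x" for d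
        using tendsto_add[OF tendsto_const LIMSEQ_Suc[OF lim_const_over_n[of d]], of x] by simp
      show "(\<lambda>n. x + c / real (Suc n)) \<longlonglongrightarrow> x" "(\<lambda>n. x + (c + 1) / real (Suc n)) \<longlonglongrightarrow> x"
        by (rule l)+
    qed (use z in \<open>auto intro!: always_eventually less_imp_le\<close>)
    then have "(\<lambda>n. \<Phi> (z n)) \<longlonglongrightarrow> \<Phi> x"
      using cont by (auto simp: continuous_on_eq_continuous_at intro: isCont_tendsto_compose)
    ultimately show ?thesis by simp
  qed
  \<comment> \<open>The integrals of \<open>F n\<close> have two limits, one by dominated
    convergence and one through \<Psi>. Comparing them gives \<open>q'\<close> and \<open>f\<close>
    equal integrals over every [a, x].\<close>
  have "(LINT t:{a..x}|lborel. q' t - f t) = 0" if x: "a \<le> x" "x \<le> b" for x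
  proof -
    have "(\<lambda>n. LINT t:{a..x}|lborel. F n t) \<longlonglongrightarrow> (LINT t:{a..x}|lborel. q' t)"
      unfolding set_lebesgue_integral_def
    proof (rule integral_dominated_convergence[where w = "\<lambda>t. indicator {a..x} t * B"])
      show "integrable lborel (\<lambda>t. indicator {a..x} t * B)"
        using borel_integrable_atLeastAtMost'[of a x "\<lambda>_. B"] by (simp add: set_integrable_def)
      show "AE t in lborel. (\<lambda>n. indicator {a..x} t *\<^sub>R F n t) \<longlonglongrightarrow> indicator {a..x} t *\<^sub>R q' t"
        using q' by eventually_elim (use x in \<open>auto simp: indicator_def\<close>)
    qed (use Fbound in \<open>auto simp: indicator_def\<close>)
    moreover have "(LINT t:{a..x}|lborel. F n t) =
      real (Suc n) * (\<Psi> (x + (c + 1) / real (Suc n)) - \<Psi> (x + c / real (Suc n))) -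
      real (Suc n) * (\<Psi> (a + (c + 1) / real (Suc n)) - \<Psi> (a + c / real (Suc n)))" for n
    proof -
      have "(LINT t:{a..x}|lborel. F n t) =
         real (Suc n) * (\<Psi> (x + (c + 1) / real (Suc n)) - \<Psi> (x + c / real (Suc n))) -
         real (Suc n) * (\<Psi> (a + (c + 1) / real (Suc n)) - \<Psi> (a + c / real (Suc n)))"
        unfolding set_lebesgue_integral_def
      proof (rule integral_FTC_Icc)
        fix t
        have "(\<Psi> has_real_derivative \<Phi> (t + d)) (at (t + d))" for d by (rule \<Psi>)
        then have d: "((\<lambda>t. \<Psi> (t + d)) has_real_derivative \<Phi> (t + d)) (at t)" for d
          by (simp add: DERIV_shift)
        show "((\<lambda>t. real (Suc n) * (\<Psi> (t + (c + 1) / real (Suc n)) - \<Psi> (t + c / real (Suc n))))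
            has_vector_derivative F n t) (at t within {a..x})"
          unfolding F_def has_real_derivative_iff_has_vector_derivative[symmetric]
          by (rule has_field_derivative_at_within) (intro DERIV_cmult DERIV_diff d)
      next
        show "continuous_on {a..x} (F n)"
          unfolding F_def
          by (intro continuous_intros continuous_on_compose2[OF cont]) auto
      qed (rule x)
      then show ?thesis .
    qed
    ultimately have "(\<lambda>n. real (Suc n) * (\<Psi> (x + (c + 1) / real (Suc n)) - \<Psi> (x + c / real (Suc n))) -
      real (Suc n) * (\<Psi> (a + (c + 1) / real (Suc n)) - \<Psi> (a + c / real (Suc n)))) \<longlonglongrightarrow> (LINT t:{a..x}|lborel. q' t)"
      by simp
    then have "(LINT t:{a..x}|lborel. q' t) = \<Phi> x - \<Phi> a"
      by (rule LIMSEQ_unique) (intro tendsto_diff diff_quot)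
    moreover have "(LINT t:{a..x}|lborel. f t) = \<Phi> x - \<Phi> a"
      by (rule \<Phi>_diff) (use x in \<open>auto simp: lo_def\<close>)
    moreover have "set_integrable lborel {a..x} q'"
      by (rule bounded_borel_set_integrable[OF _ q'bound]) simp
    ultimately show ?thesis using fint by simp
  qed
  then have "AE t in lborel. t \<in> {a..b} \<longrightarrow> q' t - f t = 0"
  proof (intro AE_zero_of_interval_integrals[where B = "2 * B"])
    show "\<bar>q' t - f t\<bar> \<le> 2 * B" for t using B[of t] q'bound[of t] by linarith
  qed auto
  with q' show ?thesis by eventually_elim auto
qed

text \<open>Clamping a Borel version to [-B, B] makes the bound hold at every point, so that later
  estimates carry no exceptional sets.\<close>

lemma bounded_borel_representative:
  fixes h :: "real \<Rightarrow> real"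
  assumes h: "h \<in> borel_measurable lebesgue" and B: "AE x in lebesgue. \<bar>h x\<bar> \<le> B" and "0 \<le> B"
  shows "\<exists>h'\<in>borel_measurable borel. (\<forall>x. \<bar>h' x\<bar> \<le> B) \<and> (AE x in lebesgue. h x = h' x)"
proof -
  obtain h0 where h0[measurable]: "h0 \<in> borel_measurable lborel" and eq: "AE x in lborel. h x = h0 x"
    using completion_ex_borel_measurable_real[OF h] by blast
  show ?thesis
  proof (intro bexI conjI allI)
    show "(\<lambda>x. max (- B) (min B (h0 x))) \<in> borel_measurable borel"
      using h0 by simp
    show "\<bar>max (- B) (min B (h0 x))\<bar> \<le> B" for x using \<open>0 \<le> B\<close> by auto
    show "AE x in lebesgue. h x = max (- B) (min B (h0 x))"
      using eq[unfolded AE_lborel_iff] B by eventually_elim auto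
  qed
qed

section \<open>Bounded functions are determined by their trigonometric moments\<close>

text \<open>Composition with \<open>cis\<close> makes the approximants periodic. They are multiples,
  cut at 1, of the distance to a closed arc \<open>C\<close>; since \<open>C\<close> contains
  \<open>cis 0\<close> as \<open>cis (2 * pi)\<close>, the limit is 0 at both ends of the
  period.\<close>

lemma arc_indicator_approx:
  assumes x: "0 \<le> x" "x \<le> 2 * pi"
  obtains f :: "nat \<Rightarrow> real \<Rightarrow> real" where
    "\<And>n. continuous_on UNIV (f n)" "\<And>n s. f n (s + 2 * pi) = f n s" "\<And>n s. \<bar>f n s\<bar> \<le> 1"
    "\<And>s. s \<in> {0..2 * pi} \<Longrightarrow> (\<lambda>n. f n s) \<longlonglongrightarrow> indicator {0<..<x} s"
proof
  define C where "C = cis ` {x..2 * pi}"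
  define f where "f n s = min 1 (real n * infdist (cis s) C)" for n s
  have "compact C" unfolding C_def
    by (intro compact_continuous_image continuous_intros compact_Icc)
  then have cl: "closed C" by (rule compact_imp_closed)
  have ne: "C \<noteq> {}" using x by (auto simp: C_def)
  show "continuous_on UNIV (f n)" for n
    unfolding f_def by (intro continuous_intros)
  have "cis (s + 2 * pi) = cis s" for s by (simp add: complex_eq_iff)
  then show "f n (s + 2 * pi) = f n s" for n s by (simp add: f_def)
  show "\<bar>f n s\<bar> \<le> 1" for n s
    using infdist_nonneg[of "cis s" C] by (auto simp: f_def)
  fix s assume s: "s \<in> {0..2 * pi}"
  show "(\<lambda>n. f n s) \<longlonglongrightarrow> indicator {0<..<x} s"
  proof (cases "s \<in> {0<..<x}")
    case True
    have "cis s \<notin> C"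
    proof
      assume "cis s \<in> C"
      then obtain y where y: "x \<le> y" "y \<le> 2 * pi" "cis s = cis y" by (auto simp: C_def)
      then obtain k :: int where k: "y = s + 2 * pi * k"
        using sin_cos_eq_iff[of y s] by (auto simp: complex_eq_iff)
      have "0 < s" "s < x" using True by auto
      then have "2 * pi * 0 < 2 * pi * real_of_int k" "2 * pi * real_of_int k < 2 * pi * 1"
        using k y by linarith+
      then have "0 < real_of_int k" "real_of_int k < 1" 
        by (simp_all only: mult_less_cancel_left_pos[of "2 * pi"] pi_gt_zero zero_less_mult_iff zero_less_numeral simp_thms)
      then show False by simp
    qed
    then have d: "0 < infdist (cis s) C" by (rule infdist_pos_not_in_closed[OF cl ne])
    obtain N :: nat where "1 / infdist (cis s) C < real N" using reals_Archimedean2 by blast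
    then have N: "1 \<le> real N * infdist (cis s) C" using d by (simp add: field_simps)
    have "f n s = 1" if "N \<le> n" for n
    proof -
      have "real N * infdist (cis s) C \<le> real n * infdist (cis s) C"
        using that d by (intro mult_right_mono) auto
      then show ?thesis using N by (simp add: f_def)
    qed
    then have "eventually (\<lambda>n. f n s = 1) sequentially"
      by (auto simp: eventually_sequentially)
    then show ?thesis using True by (auto simp: tendsto_eventually)
  next
    case False
    have "cis s \<in> C"
    proof (cases "s = 0")
      case True
      then show ?thesis unfolding C_def using x by (intro image_eqI[of _ _ "2 * pi"]) auto
    next
      case False
      then show ?thesis unfolding C_def using \<open>s \<notin> {0<..<x}\<close> s by auto
    qed
    then have "f n s = 0" for n by (simp add: f_def)
    then show ?thesis using False by simp
  qed
qed

text \<open>Vanishing passes from trigonometric polynomials to continuous periodic functions by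
  uniform density, and from these to indicators of arcs by dominated convergence.\<close>

lemma AE_zero_of_trig_moments:
  fixes d :: "real \<Rightarrow> real"
  assumes d[measurable]: "d \<in> borel_measurable borel" and B: "\<And>x. \<bar>d x\<bar> \<le> B"
    and zero: "\<And>p. trig_poly p \<Longrightarrow> (LINT x:{0..2 * pi}|lborel. d x * p x) = 0"
  shows "AE x in lborel. x \<in> {0..2 * pi} \<longrightarrow> d x = 0"
proof (rule AE_zero_of_interval_integrals[OF d B])
  fix x assume x: "0 \<le> x" "x \<le> 2 * pi"
  have B0: "0 \<le> B" using order.trans[OF abs_ge_zero B] .
  obtain f :: "nat \<Rightarrow> real \<Rightarrow> real" where f: "\<And>n. continuous_on UNIV (f n)"
    "\<And>n s. f n (s + 2 * pi) = f n s" "\<And>n s. \<bar>f n s\<bar> \<le> 1"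
    and lim: "\<And>s. s \<in> {0..2 * pi} \<Longrightarrow> (\<lambda>n. f n s) \<longlonglongrightarrow> indicator {0<..<x} s"
    using arc_indicator_approx[OF x] by metis
  have [measurable]: "f n \<in> borel_measurable borel" for n
    by (rule borel_measurable_continuous_onI[OF f(1)])
  have z: "(LINT s:{0..2 * pi}|lborel. d s * f n s) = 0" for n
  proof -
    have "\<bar>LINT s:{0..2 * pi}|lborel. d s * f n s\<bar> \<le> e" if "e > 0" for e
    proof -
      \<comment> \<open>The summand 1 keeps the denominator positive when \<open>B\<close> is
        0.\<close>
      define \<epsilon> where "\<epsilon> = e / (2 * pi * (B + 1))"
      have \<epsilon>: "\<epsilon> > 0" using \<open>e > 0\<close> B0 by (simp add: \<epsilon>_def)
      obtain p where p: "trig_poly p" "\<And>s. \<bar>f n s - p s\<bar> \<le> \<epsilon>"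
        using trig_poly_uniformly_dense[OF f(1,2) \<epsilon>] by metis
      have [measurable]: "p \<in> borel_measurable borel"
        by (rule borel_measurable_continuous_onI[OF smooth_continuous_on[OF trig_poly_smooth[OF p(1)]]])
      have b1: "\<bar>d s * (f n s - p s)\<bar> \<le> B * \<epsilon>" for s
        unfolding abs_mult using B p(2) B0 by (intro mult_mono) auto
      have "\<bar>p s\<bar> \<le> 1 + \<epsilon>" for s using p(2)[of s] f(3)[of n s] by linarith
      then have b2: "\<bar>d s * p s\<bar> \<le> B * (1 + \<epsilon>)" for s
        unfolding abs_mult using B B0 by (intro mult_mono) auto
      have "(LINT s:{0..2 * pi}|lborel. d s * f n s) =
          (LINT s:{0..2 * pi}|lborel. d s * (f n s - p s) + d s * p s)"
        by (simp add: algebra_simps)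
      also have "\<dots> = (LINT s:{0..2 * pi}|lborel. d s * (f n s - p s))"
        using zero[OF p(1)]
        by (subst set_integral_add(2)) 
          (auto intro!: bounded_borel_set_integrable[OF _ b1] bounded_borel_set_integrable[OF _ b2])
      also have "\<bar>\<dots>\<bar> \<le> B * \<epsilon> * (2 * pi - 0)"
        by (rule set_integral_abs_le[OF _ b1]) auto
      also have "\<dots> \<le> (B + 1) * \<epsilon> * (2 * pi)"
        using \<epsilon> by (simp add: mult_right_mono)
      also have "\<dots> = e"
        using B0 by (simp add: \<epsilon>_def)
      finally show ?thesis .
    qed
    then have "\<bar>LINT s:{0..2 * pi}|lborel. d s * f n s\<bar> \<le> 0"
      by (rule field_le_epsilon) simp
    then show ?thesis by simp
  qed
  have "(\<lambda>n. LINT s:{0..2 * pi}|lborel. d s * f n s) \<longlonglongrightarrow>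
      (LINT s:{0..2 * pi}|lborel. d s * indicator {0<..<x} s)"
    unfolding set_lebesgue_integral_def
  proof (rule integral_dominated_convergence[where w = "\<lambda>t. indicator {0..2 * pi} t * B"])
    show "integrable lborel (\<lambda>t. indicator {0..2 * pi} t * B)"
      using borel_integrable_atLeastAtMost'[of 0 "2 * pi" "\<lambda>_. B"] by (simp add: set_integrable_def)
    show "AE s in lborel. (\<lambda>n. indicator {0..2 * pi} s *\<^sub>R (d s * f n s)) \<longlonglongrightarrow>
        indicator {0..2 * pi} s *\<^sub>R (d s * indicator {0<..<x} s)"
    proof (intro AE_I2)
      fix s show "(\<lambda>n. indicator {0..2 * pi} s *\<^sub>R (d s * f n s)) \<longlonglongrightarrow>
        indicator {0..2 * pi} s *\<^sub>R (d s * indicator {0<..<x} s)"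
        using lim[of s] by (cases "s \<in> {0..2 * pi}") (simp_all add: tendsto_mult_left)
    qed
    show "AE s in lborel. norm (indicator {0..2 * pi} s *\<^sub>R (d s * f n s)) \<le> indicator {0..2 * pi} s * B" for n
    proof (intro AE_I2)
      fix s
      have "\<bar>d s * f n s\<bar> \<le> B * 1"
        unfolding abs_mult by (intro mult_mono B f(3)) (auto simp: B0)
      then show "norm (indicator {0..2 * pi} s *\<^sub>R (d s * f n s)) \<le> indicator {0..2 * pi} s * B"
        by (auto simp: indicator_def)
    qed
  qed simp_all
  then have "(LINT s:{0..2 * pi}|lborel. d s * indicator {0<..<x} s) = 0"
    unfolding z using LIMSEQ_unique tendsto_const by blast
  also have "(LINT s:{0..2 * pi}|lborel. d s * indicator {0<..<x} s) = (LINT s:{0..x}|lborel. d s)"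
    unfolding set_lebesgue_integral_def
  proof (intro integral_cong_AE)
    show "AE s in lborel. indicator {0..2 * pi} s *\<^sub>R (d s * indicator {0<..<x} s) = indicator {0..x} s *\<^sub>R d s"
      using AE_lborel_singleton[of 0] AE_lborel_singleton[of x]
      by eventually_elim (use x in \<open>auto simp: indicator_def\<close>)
  qed auto
  finally show "(LINT s:{0..x}|lborel. d s) = 0" .
qed

subsection \<open>Distributions on trigonometric polynomials\<close>

lemma distribution_add:
  "distribution L \<Longrightarrow> \<phi> \<in> torus_test \<Longrightarrow> \<psi> \<in> torus_test \<Longrightarrow> L (\<lambda>x. \<phi> x + \<psi> x) = L \<phi> + L \<psi>"
  by (simp add: distribution_def)

lemma distribution_cmult:
  "distribution L \<Longrightarrow> \<phi> \<in> torus_test \<Longrightarrow> L (\<lambda>x. c * \<phi> x) = c * L \<phi>"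
  by (simp add: distribution_def)

lemma torus_test_cmult: "\<phi> \<in> torus_test \<Longrightarrow> (\<lambda>x. c * \<phi> x) \<in> torus_test"
  by (simp add: torus_test_def smooth_cmult)

lemma distribution_diff:
  assumes "distribution L" "\<phi> \<in> torus_test" "\<psi> \<in> torus_test"
  shows "L (\<lambda>x. \<phi> x - \<psi> x) = L \<phi> - L \<psi>"
  using distribution_add[OF assms(1,2) torus_test_cmult[OF assms(3), of "- 1"]]
    distribution_cmult[OF assms(1,3), of "- 1"] by simp

text \<open>The continuity estimate without suprema. The constant \<open>C\<close> has no prescribed
  sign, so \<open>K\<close> is its absolute value times the number of derivatives involved.\<close>

lemma distribution_bound:
  assumes "distribution L"
  obtains K N where "0 \<le> K"
    "\<And>\<phi> \<epsilon>. \<phi> \<in> torus_test \<Longrightarrow> (\<And>k x. k \<le> N \<Longrightarrow> \<bar>(deriv ^^ k) \<phi> x\<bar> \<le> \<epsilon>) \<Longrightarrow> \<bar>L \<phi>\<bar> \<le> K * \<epsilon>"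
proof -
  obtain C N where C: "\<And>\<phi>. \<phi> \<in> torus_test \<Longrightarrow> \<bar>L \<phi>\<bar> \<le> C * (\<Sum>k\<le>N. SUP x. \<bar>(deriv ^^ k) \<phi> x\<bar>)"
    using assms unfolding distribution_def by blast
  show ?thesis
  proof
    show "0 \<le> \<bar>C\<bar> * real (Suc N)" by simp
    fix \<phi> \<epsilon> assume \<phi>: "\<phi> \<in> torus_test" and b: "\<And>k x. k \<le> N \<Longrightarrow> \<bar>(deriv ^^ k) \<phi> x\<bar> \<le> \<epsilon>"
    have up: "(SUP x. \<bar>(deriv ^^ k) \<phi> x\<bar>) \<le> \<epsilon>" if "k \<le> N" for k
      by (rule cSUP_least) (use b that in auto)
    have lo: "0 \<le> (SUP x. \<bar>(deriv ^^ k) \<phi> x\<bar>)" if "k \<le> N" for k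
      by (rule cSUP_upper2[of _ _ 0]) (use b that in \<open>auto simp: bdd_above_def\<close>)
    have "\<bar>L \<phi>\<bar> \<le> C * (\<Sum>k\<le>N. SUP x. \<bar>(deriv ^^ k) \<phi> x\<bar>)" by (rule C[OF \<phi>])
    also have "\<dots> \<le> \<bar>C\<bar> * (\<Sum>k\<le>N. SUP x. \<bar>(deriv ^^ k) \<phi> x\<bar>)"
      by (intro mult_right_mono sum_nonneg) (use lo in auto)
    also have "\<dots> \<le> \<bar>C\<bar> * (\<Sum>k\<le>N. \<epsilon>)"
      by (intro mult_left_mono sum_mono) (use up in auto)
    finally show "\<bar>L \<phi>\<bar> \<le> \<bar>C\<bar> * real (Suc N) * \<epsilon>" by (simp add: mult.assoc)
  qed
qed

text \<open>At one fixed time both distributions have finite order, so approximating finitely many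
  derivatives of \<phi> controls the pairing.\<close>

lemma state_g_trig_dense:
  assumes f: "distribution f0" "distribution f1" and \<phi>: "\<phi> \<in> torus_test" and \<epsilon>: "\<epsilon> > 0"
  shows "\<exists>p. trig_poly p \<and> \<bar>state_g f0 f1 \<phi> - state_g f0 f1 p\<bar> \<le> \<epsilon> \<and> (\<forall>x. \<bar>\<phi> x - p x\<bar> \<le> \<epsilon>)"
proof -
  obtain K0 N0 where K0: "0 \<le> K0"
    "\<And>\<phi> \<epsilon>. \<phi> \<in> torus_test \<Longrightarrow> (\<And>k x. k \<le> N0 \<Longrightarrow> \<bar>(deriv ^^ k) \<phi> x\<bar> \<le> \<epsilon>) \<Longrightarrow> \<bar>f0 \<phi>\<bar> \<le> K0 * \<epsilon>"
    using distribution_bound[OF f(1)] by metis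
  obtain K1 N1 where K1: "0 \<le> K1"
    "\<And>\<phi> \<epsilon>. \<phi> \<in> torus_test \<Longrightarrow> (\<And>k x. k \<le> N1 \<Longrightarrow> \<bar>(deriv ^^ k) \<phi> x\<bar> \<le> \<epsilon>) \<Longrightarrow> \<bar>f1 \<phi>\<bar> \<le> K1 * \<epsilon>"
    using distribution_bound[OF f(2)] by metis
  define \<delta> where "\<delta> = \<epsilon> / (K0 + K1 + 1)"
  have \<delta>0: "0 < \<delta>" using \<epsilon> K0(1) K1(1) by (simp add: \<delta>_def)
  have "(K0 + K1 + 1) * \<delta> = \<epsilon>" using K0(1) K1(1) by (simp add: \<delta>_def)
  then have \<delta>_eq: "K0 * \<delta> + K1 * \<delta> + \<delta> = \<epsilon>" by (simp add: distrib_right)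
  have "0 \<le> K0 * \<delta>" "0 \<le> K1 * \<delta>" using \<delta>0 K0(1) K1(1) by simp_all
  with \<delta>0 \<delta>_eq have \<delta>: "0 < \<delta>" "\<delta> \<le> \<epsilon>" "K0 * \<delta> + K1 * \<delta> \<le> \<epsilon>" by linarith+
  \<comment> \<open>\<open>f0\<close> is paired with the derivative of the test function, hence one
    order more than \<open>N0\<close>.\<close>
  obtain p where p: "trig_poly p"
    "\<And>k x. k \<le> max (Suc N0) N1 \<Longrightarrow> \<bar>(deriv ^^ k) (\<lambda>x. \<phi> x - p x) x\<bar> \<le> \<delta>"
    using trig_poly_dense[OF \<phi> \<delta>(1)] by blast
  have pt: "p \<in> torus_test" by (rule trig_poly_torus_test[OF p(1)])
  have \<psi>: "(\<lambda>x. \<phi> x - p x) \<in> torus_test" by (rule torus_test_diff[OF \<phi> pt])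
  have "((\<lambda>x. \<phi> x - p x) has_real_derivative deriv \<phi> x - deriv p x) (at x)" for x
    using \<phi> pt by (intro DERIV_diff smooth_DERIV) (auto simp: torus_test_def)
  then have d: "deriv (\<lambda>x. \<phi> x - p x) = (\<lambda>x. deriv \<phi> x - deriv p x)"
    by (intro ext DERIV_imp_deriv)
  have "\<bar>f0 (deriv (\<lambda>x. \<phi> x - p x))\<bar> \<le> K0 * \<delta>"
  proof (rule K0(2)[OF torus_test_deriv[OF \<psi>]])
    fix k x assume "k \<le> N0"
    then show "\<bar>(deriv ^^ k) (deriv (\<lambda>x. \<phi> x - p x)) x\<bar> \<le> \<delta>"
      using p(2)[of "Suc k" x] by (simp add: funpow_Suc_right del: funpow.simps)
  qed
  moreover have "\<bar>f1 (\<lambda>x. \<phi> x - p x)\<bar> \<le> K1 * \<delta>"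
    by (rule K1(2)[OF \<psi>]) (use p(2) in simp)
  moreover have "state_g f0 f1 \<phi> - state_g f0 f1 p =
      - f0 (deriv (\<lambda>x. \<phi> x - p x)) + f1 (\<lambda>x. \<phi> x - p x)"
    unfolding d
    by (simp add: state_g_def distr_deriv_def distribution_diff f \<phi> pt torus_test_deriv)
  ultimately have "\<bar>state_g f0 f1 \<phi> - state_g f0 f1 p\<bar> \<le> \<epsilon>" using \<delta>(3) by linarith
  moreover have "\<bar>\<phi> x - p x\<bar> \<le> \<epsilon>" for x using p(2)[of 0 x] \<delta>(2) by simp
  ultimately show ?thesis using p(1) by blast
qed

lemma continuous_translated_pairing:
  assumes L: "\<And>t. 0 \<le> t \<Longrightarrow> distribution (L t)"
    and cont: "\<And>\<phi>. \<phi> \<in> torus_test \<Longrightarrow> continuous_on {0..} (\<lambda>t::real. L t \<phi>)"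
    and p: "trig_poly p"
  shows "continuous_on {0..} (\<lambda>t. L t (\<lambda>x. p (x + t)))"
  using p
proof induction
  case (trig_poly_cos n)
  let ?c = "\<lambda>x. cos (of_int n * x)" and ?s = "\<lambda>x. sin (of_int n * x)"
  have tt: "?c \<in> torus_test" "?s \<in> torus_test"
    by (intro trig_poly_torus_test trig_poly.intros)+
  have "continuous_on {0..} (\<lambda>t. cos (of_int n * t) * L t ?c - sin (of_int n * t) * L t ?s)"
    by (intro continuous_intros cont tt)
  moreover have "cos (of_int n * t) * L t ?c - sin (of_int n * t) * L t ?s = L t (\<lambda>x. cos (of_int n * (x + t)))"
    if "t \<in> {0..}" for t
  proof -
    have "(\<lambda>x. cos (of_int n * (x + t))) =
        (\<lambda>x. cos (of_int n * t) * ?c x - sin (of_int n * t) * ?s x)"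
      by (simp add: distrib_left cos_add mult.commute)
    then show ?thesis
      using that distribution_diff[OF L torus_test_cmult[OF tt(1)] torus_test_cmult[OF tt(2)],
          of t "cos (of_int n * t)" "sin (of_int n * t)"]
        distribution_cmult[OF L tt(1), of t "cos (of_int n * t)"]
        distribution_cmult[OF L tt(2), of t "sin (of_int n * t)"]
      by simp
  qed
  ultimately show ?case by (rule continuous_on_eq)
next
  case (trig_poly_sin n)
  let ?c = "\<lambda>x. cos (of_int n * x)" and ?s = "\<lambda>x. sin (of_int n * x)"
  have tt: "?c \<in> torus_test" "?s \<in> torus_test"
    by (intro trig_poly_torus_test trig_poly.intros)+
  have "continuous_on {0..} (\<lambda>t. cos (of_int n * t) * L t ?s + sin (of_int n * t) * L t ?c)"
    by (intro continuous_intros cont tt)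
  moreover have "cos (of_int n * t) * L t ?s + sin (of_int n * t) * L t ?c = L t (\<lambda>x. sin (of_int n * (x + t)))"
    if "t \<in> {0..}" for t
  proof -
    have "(\<lambda>x. sin (of_int n * (x + t))) =
        (\<lambda>x. cos (of_int n * t) * ?s x + sin (of_int n * t) * ?c x)"
      by (simp add: distrib_left sin_add mult.commute)
    then show ?thesis
      using that distribution_add[OF L torus_test_cmult[OF tt(2)] torus_test_cmult[OF tt(1)],
          of t "cos (of_int n * t)" "sin (of_int n * t)"]
        distribution_cmult[OF L tt(2), of t "cos (of_int n * t)"]
        distribution_cmult[OF L tt(1), of t "sin (of_int n * t)"]
      by simp
  qed
  ultimately show ?case by (rule continuous_on_eq)
next
  case (trig_poly_cmult p c)
  have "continuous_on {0..} (\<lambda>t. c * L t (\<lambda>x. p (x + t)))"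
    by (intro continuous_intros trig_poly_cmult)
  moreover have "c * L t (\<lambda>x. p (x + t)) = L t (\<lambda>x. c * p (x + t))" if "t \<in> {0..}" for t
    using that distribution_cmult[OF L
        trig_poly_torus_test[OF trig_poly_translate[OF trig_poly_cmult(1), of t]], of t c] by simp
  ultimately show ?case by (rule continuous_on_eq)
next
  case (trig_poly_add p q)
  have "continuous_on {0..} (\<lambda>t. L t (\<lambda>x. p (x + t)) + L t (\<lambda>x. q (x + t)))"
    by (intro continuous_intros trig_poly_add)
  moreover have "L t (\<lambda>x. p (x + t)) + L t (\<lambda>x. q (x + t)) = L t (\<lambda>x. p (x + t) + q (x + t))"
    if "t \<in> {0..}" for t
    using that distribution_add[OF L
        trig_poly_torus_test[OF trig_poly_translate[OF trig_poly_add(1), of t]]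
        trig_poly_torus_test[OF trig_poly_translate[OF trig_poly_add(2), of t]], of t] by simp
  ultimately show ?case by (rule continuous_on_eq)
qed

subsection \<open>The transport equation tested along characteristics\<close>

definition char_test :: "(real \<Rightarrow> real) \<Rightarrow> (real \<Rightarrow> real) \<Rightarrow> real \<times> real \<Rightarrow> real" where
  "char_test p \<eta> z = p (fst z + snd z) * \<eta> (snd z)"

lemma char_test_inner:
  "char_test p \<eta> = (\<lambda>z. p (0 + z \<bullet> (1, 1)) * \<eta> (0 + z \<bullet> (0, 1)))"
  by (auto simp: char_test_def inner_prod_def)

lemma smooth_char_test: "smooth p \<Longrightarrow> smooth \<eta> \<Longrightarrow> smooth (char_test p \<eta>)"
  unfolding char_test_inner by (intro smooth_mult smooth_affine)

lemma partial_x_char_test: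
  assumes "smooth p" "smooth \<eta>"
  shows "partial_x (char_test p \<eta>) = char_test (deriv p) \<eta>"
proof -
  have b: "(1, 0) \<in> (Basis :: (real \<times> real) set)" by (simp add: Basis_prod_def)
  show ?thesis
    unfolding char_test_inner
      partial_mult[OF smooth_affine[OF assms(1)] smooth_affine[OF assms(2)] b]
      partial_affine[OF assms(1)] partial_affine[OF assms(2)]
    by (simp add: inner_prod_def)
qed

lemma partial_t_char_test:
  assumes "smooth p" "smooth \<eta>"
  shows "partial_t (char_test p \<eta>) = (\<lambda>z. char_test (deriv p) \<eta> z + char_test p (deriv \<eta>) z)"
proof -
  have b: "(0, 1) \<in> (Basis :: (real \<times> real) set)" by (simp add: Basis_prod_def)
  show ?thesis
    unfolding char_test_inner
      partial_mult[OF smooth_affine[OF assms(1)] smooth_affine[OF assms(2)] b]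
      partial_affine[OF assms(1)] partial_affine[OF assms(2)]
    by (simp add: inner_prod_def)
qed

lemma smooth_support_deriv:
  fixes \<eta> :: "real \<Rightarrow> real"
  assumes sm: "smooth \<eta>" and supp: "\<And>t. t \<notin> {a..b} \<Longrightarrow> \<eta> t = 0" and t: "t \<notin> {a..b}"
  shows "deriv \<eta> t = 0"
proof -
  have "(\<eta> has_real_derivative 0) (at t)"
    by (rule has_field_derivative_transform_within_open[of "\<lambda>_. 0" _ _ "- {a..b}"])
      (use supp t in auto)
  then show ?thesis by (rule DERIV_imp_deriv)
qed

lemma char_test_spacetime_test:
  assumes "trig_poly p" "smooth \<eta>" "\<And>t. t \<notin> {a..b} \<Longrightarrow> \<eta> t = 0" "0 < a" "a < b"
  shows "char_test p \<eta> \<in> spacetime_test"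
proof -
  have "p (x + 2 * pi + t) = p (x + t)" for x t
    using trig_poly_periodic[OF assms(1), of "x + t"] by (simp add: algebra_simps)
  moreover have "\<exists>a b. 0 < a \<and> a < b \<and> (\<forall>x t. t \<notin> {a..b} \<longrightarrow> char_test p \<eta> (x, t) = 0)"
    using assms(3-5) unfolding char_test_def by (intro exI[of _ a] exI[of _ b]) simp
  ultimately show ?thesis
    using assms(1,2) by (simp add: spacetime_test_def smooth_char_test trig_poly_smooth char_test_def)
qed

text \<open>For \<psi> = p(x + t) \<eta>(t) the wave operator leaves 2 p' \<eta>' + p \<eta>''.
  Writing <F, .> for the space-time pairing, the second-order equation gives 2 <f0, p' \<eta>'> +
  <f0, p \<eta>''>, and the relation between \<open>f0\<close> and \<open>f1\<close>, tested with p
  \<eta>', turns <f0, p \<eta>''> into - <f1, p \<eta>'> - <f0, p' \<eta>'>. What remains is the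
  pairing of the state function g with p \<eta>'.\<close>

lemma string_evolution_transport:
  assumes ev: "string_evolution u f0 f1" and p: "trig_poly p" and sm: "smooth \<eta>"
    and supp: "\<And>t. t \<notin> {a..b} \<Longrightarrow> \<eta> t = 0" and ab: "0 < a" "a < b"
  shows "(LINT t:{0..}|lebesgue. deriv \<eta> t * state_g (f0 t) (f1 t) (\<lambda>x. p (x + t))) =
    - (LINT t:{0..}|lebesgue. u t * (p t * \<eta> t))"
proof -
  have dist: "distribution (f0 t)" "distribution (f1 t)" if "0 \<le> t" for t
    using ev that by (auto simp: string_evolution_def even_distribution_def)
  have cont: "continuous_on {0..} (\<lambda>t. f0 t \<phi>)" "continuous_on {0..} (\<lambda>t. f1 t \<phi>)"
    if "\<phi> \<in> torus_test" for \<phi>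
    using ev that by (auto simp: string_evolution_def)
  define I where "I F q \<zeta> = (LINT t:{a..b}|lebesgue. \<zeta> t * F t (\<lambda>x. q (x + t)))"
    for F :: "real \<Rightarrow> (real \<Rightarrow> real) \<Rightarrow> real" and q \<zeta> :: "real \<Rightarrow> real"
  \<comment> \<open>Continuity yields integrability on a compact interval, so the half-line is cut
    down to the support of the cutoff.\<close>
  have restrict: "(LINT t:{0..}|lebesgue. g t) = (LINT t:{a..b}|lebesgue. g t)"
    if "\<And>t. t \<notin> {a..b} \<Longrightarrow> 0 \<le> t \<Longrightarrow> g t = 0" for g :: "real \<Rightarrow> real"
    unfolding set_lebesgue_integral_def
    by (intro Bochner_Integration.integral_cong) (use that ab in \<open>auto simp: indicator_def\<close>)
  have integrable: "set_integrable lebesgue {a..b} (\<lambda>t. \<zeta> t * F t (\<lambda>x. q (x + t)))"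
    if "F = f0 \<or> F = f1" "trig_poly q" "smooth \<zeta>" for F q \<zeta>
  proof (rule absolutely_integrable_continuous_real)
    have "continuous_on {0..} (\<lambda>t. F t (\<lambda>x. q (x + t)))"
      using that(1) continuous_translated_pairing[OF dist(1) cont(1) that(2)]
        continuous_translated_pairing[OF dist(2) cont(2) that(2)] by blast
    then have "continuous_on {a..b} (\<lambda>t. F t (\<lambda>x. q (x + t)))"
      by (rule continuous_on_subset) (use ab in auto)
    then show "continuous_on {a..b} (\<lambda>t. \<zeta> t * F t (\<lambda>x. q (x + t)))"
      by (rule continuous_on_mult[OF smooth_continuous_on[OF that(3)]])
  qed
  have tt: "(\<lambda>x. q (x + t)) \<in> torus_test" if "trig_poly q" for q t
    by (rule trig_poly_torus_test[OF trig_poly_translate[OF that]])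
  have ct: "(\<lambda>x. char_test q \<zeta> (x, t)) \<in> torus_test" if "trig_poly q" for q \<zeta> t
    using torus_test_cmult[OF tt[OF that], of "\<zeta> t"] by (simp add: char_test_def mult.commute)
  have val: "F t (\<lambda>x. char_test q \<zeta> (x, t)) = \<zeta> t * F t (\<lambda>x. q (x + t))"
    if "F = f0 \<or> F = f1" "trig_poly q" "0 \<le> t" for F q \<zeta> t
    using distribution_cmult[of "F t" "\<lambda>x. q (x + t)" "\<zeta> t"] tt[OF that(2)] dist that
    by (auto simp: char_test_def mult.commute)
  have ct_add: "(\<lambda>x. A x + B x) \<in> torus_test" if "A \<in> torus_test" "B \<in> torus_test" for A B
    using that by (simp add: torus_test_def smooth_add)
  have pair1: "st_pair F (char_test q \<zeta>) = I F q \<zeta>"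
    if "F = f0 \<or> F = f1" "trig_poly q" "\<And>t. t \<notin> {a..b} \<Longrightarrow> \<zeta> t = 0" for F q \<zeta>
  proof -
    have "st_pair F (char_test q \<zeta>) = (LINT t:{0..}|lebesgue. \<zeta> t * F t (\<lambda>x. q (x + t)))"
      unfolding st_pair_def set_lebesgue_integral_def
      by (intro Bochner_Integration.integral_cong) (auto simp: val that indicator_def)
    also have "\<dots> = I F q \<zeta>" unfolding I_def by (rule restrict) (use that in auto)
    finally show ?thesis .
  qed
  have pair2: "st_pair F (\<lambda>z. char_test q1 \<zeta>1 z + char_test q2 \<zeta>2 z) = I F q1 \<zeta>1 + I F q2 \<zeta>2"
    if "F = f0 \<or> F = f1" "trig_poly q1" "trig_poly q2" "smooth \<zeta>1" "smooth \<zeta>2"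
      "\<And>t. t \<notin> {a..b} \<Longrightarrow> \<zeta>1 t = 0" "\<And>t. t \<notin> {a..b} \<Longrightarrow> \<zeta>2 t = 0" for F q1 q2 \<zeta>1 \<zeta>2
  proof -
    have dF: "distribution (F t)" if "0 \<le> t" for t using dist[OF that] \<open>F = f0 \<or> F = f1\<close> by auto
    have *: "F t (\<lambda>x. char_test q1 \<zeta>1 (x, t) + char_test q2 \<zeta>2 (x, t)) =
        \<zeta>1 t * F t (\<lambda>x. q1 (x + t)) + \<zeta>2 t * F t (\<lambda>x. q2 (x + t))" if "0 \<le> t" for t
      using distribution_add[OF dF[OF that] ct[OF \<open>trig_poly q1\<close>] ct[OF \<open>trig_poly q2\<close>]]
      by (simp add: val \<open>F = f0 \<or> F = f1\<close> \<open>trig_poly q1\<close> \<open>trig_poly q2\<close> that)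
    have "st_pair F (\<lambda>z. char_test q1 \<zeta>1 z + char_test q2 \<zeta>2 z) =
       (LINT t:{0..}|lebesgue. \<zeta>1 t * F t (\<lambda>x. q1 (x + t)) + \<zeta>2 t * F t (\<lambda>x. q2 (x + t)))"
      unfolding st_pair_def set_lebesgue_integral_def
      by (intro Bochner_Integration.integral_cong)
        (auto simp: * indicator_def)
    also have "\<dots> = (LINT t:{a..b}|lebesgue. \<zeta>1 t * F t (\<lambda>x. q1 (x + t)) + \<zeta>2 t * F t (\<lambda>x. q2 (x + t)))"
      by (rule restrict) (use that in auto)
    also have "\<dots> = I F q1 \<zeta>1 + I F q2 \<zeta>2"
      unfolding I_def by (intro set_integral_add(2) integrable that)
    finally show ?thesis .
  qed
  \<comment> \<open>Four terms, as produced by the product rule applied twice; in the application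
    the two middle ones coincide and give the factor 2 in \<open>e1\<close>.\<close>
  have pair4: "st_pair F (\<lambda>z. (char_test q1 \<zeta>1 z + char_test q2 \<zeta>2 z) + (char_test q3 \<zeta>3 z + char_test q4 \<zeta>4 z)) =
      I F q1 \<zeta>1 + I F q2 \<zeta>2 + (I F q3 \<zeta>3 + I F q4 \<zeta>4)"
    if "F = f0 \<or> F = f1" "trig_poly q1" "trig_poly q2" "smooth \<zeta>1" "smooth \<zeta>2"
      "trig_poly q3" "trig_poly q4" "smooth \<zeta>3" "smooth \<zeta>4"
      "\<And>t. t \<notin> {a..b} \<Longrightarrow> \<zeta>1 t = 0" "\<And>t. t \<notin> {a..b} \<Longrightarrow> \<zeta>2 t = 0"
      "\<And>t. t \<notin> {a..b} \<Longrightarrow> \<zeta>3 t = 0" "\<And>t. t \<notin> {a..b} \<Longrightarrow> \<zeta>4 t = 0"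
    for F q1 q2 \<zeta>1 \<zeta>2 q3 q4 \<zeta>3 \<zeta>4
  proof -
    have dF: "distribution (F t)" if "0 \<le> t" for t using dist[OF that] \<open>F = f0 \<or> F = f1\<close> by auto
    have *: "F t (\<lambda>x. (char_test q1 \<zeta>1 (x, t) + char_test q2 \<zeta>2 (x, t)) +
          (char_test q3 \<zeta>3 (x, t) + char_test q4 \<zeta>4 (x, t))) =
        (\<zeta>1 t * F t (\<lambda>x. q1 (x + t)) + \<zeta>2 t * F t (\<lambda>x. q2 (x + t))) +
        (\<zeta>3 t * F t (\<lambda>x. q3 (x + t)) + \<zeta>4 t * F t (\<lambda>x. q4 (x + t)))" if "0 \<le> t" for t
    proof -
      note c = ct[OF \<open>trig_poly q1\<close>] ct[OF \<open>trig_poly q2\<close>] ct[OF \<open>trig_poly q3\<close>] ct[OF \<open>trig_poly q4\<close>]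
      note v = val[OF \<open>F = f0 \<or> F = f1\<close> _ that]
      show ?thesis
        unfolding distribution_add[OF dF[OF that] ct_add[OF c(1,2)] ct_add[OF c(3,4)]]
          distribution_add[OF dF[OF that] c(1,2)] distribution_add[OF dF[OF that] c(3,4)]
          v[OF \<open>trig_poly q1\<close>] v[OF \<open>trig_poly q2\<close>] v[OF \<open>trig_poly q3\<close>] v[OF \<open>trig_poly q4\<close>] ..
    qed
    have "st_pair F (\<lambda>z. (char_test q1 \<zeta>1 z + char_test q2 \<zeta>2 z) + (char_test q3 \<zeta>3 z + char_test q4 \<zeta>4 z)) =
       (LINT t:{0..}|lebesgue. (\<zeta>1 t * F t (\<lambda>x. q1 (x + t)) + \<zeta>2 t * F t (\<lambda>x. q2 (x + t))) +
        (\<zeta>3 t * F t (\<lambda>x. q3 (x + t)) + \<zeta>4 t * F t (\<lambda>x. q4 (x + t))))"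
      unfolding st_pair_def set_lebesgue_integral_def
      by (intro Bochner_Integration.integral_cong)
        (auto simp: * indicator_def)
    also have "\<dots> = (LINT t:{a..b}|lebesgue. (\<zeta>1 t * F t (\<lambda>x. q1 (x + t)) + \<zeta>2 t * F t (\<lambda>x. q2 (x + t))) +
        (\<zeta>3 t * F t (\<lambda>x. q3 (x + t)) + \<zeta>4 t * F t (\<lambda>x. q4 (x + t))))"
      by (rule restrict) (use that in auto)
    also have "\<dots> = I F q1 \<zeta>1 + I F q2 \<zeta>2 + (I F q3 \<zeta>3 + I F q4 \<zeta>4)"
      unfolding I_def by (simp add: set_integral_add integrable that)
    finally show ?thesis .
  qed
  note p' = trig_poly_deriv[OF p] and p'' = trig_poly_deriv[OF trig_poly_deriv[OF p]]
  note sm' = smooth_deriv[OF sm] and sm'' = smooth_deriv[OF smooth_deriv[OF sm]]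
  have supp': "deriv \<eta> t = 0" if "t \<notin> {a..b}" for t
    by (rule smooth_support_deriv[OF sm _ that]) (rule supp)
  have supp'': "deriv (deriv \<eta>) t = 0" if "t \<notin> {a..b}" for t
    by (rule smooth_support_deriv[OF sm' _ that]) (rule supp')
  note ps = trig_poly_smooth[OF p] trig_poly_smooth[OF p'] trig_poly_smooth[OF p'']
  have st: "char_test p \<eta> \<in> spacetime_test" "char_test p (deriv \<eta>) \<in> spacetime_test"
    using char_test_spacetime_test[OF p sm supp ab] char_test_spacetime_test[OF p sm' supp' ab] by simp_all
  have tt_eq: "partial_t (partial_t (char_test p \<eta>)) = (\<lambda>z.
      (char_test (deriv (deriv p)) \<eta> z + char_test (deriv p) (deriv \<eta>) z) +
      (char_test (deriv p) (deriv \<eta>) z + char_test p (deriv (deriv \<eta>)) z))"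
    unfolding partial_t_char_test[OF ps(1) sm]
    by (subst partial_add) (simp_all add: smooth_char_test partial_t_char_test ps sm sm' Basis_prod_def)
  have xx_eq: "partial_x (partial_x (char_test p \<eta>)) = char_test (deriv (deriv p)) \<eta>"
    by (simp add: partial_x_char_test ps sm)
  have q4: "st_pair f0 (\<lambda>z.
      (char_test (deriv (deriv p)) \<eta> z + char_test (deriv p) (deriv \<eta>) z) +
      (char_test (deriv p) (deriv \<eta>) z + char_test p (deriv (deriv \<eta>)) z)) =
      I f0 (deriv (deriv p)) \<eta> + I f0 (deriv p) (deriv \<eta>) +
      (I f0 (deriv p) (deriv \<eta>) + I f0 p (deriv (deriv \<eta>)))"
    by (rule pair4) (simp_all add: p p' p'' sm sm' sm'' supp supp' supp'')
  have q2: "st_pair f0 (\<lambda>z. char_test (deriv p) (deriv \<eta>) z + char_test p (deriv (deriv \<eta>)) z) =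
      I f0 (deriv p) (deriv \<eta>) + I f0 p (deriv (deriv \<eta>))"
    by (rule pair2) (simp_all add: p p' sm' sm'' supp' supp'')
  have q1: "st_pair f0 (char_test (deriv (deriv p)) \<eta>) = I f0 (deriv (deriv p)) \<eta>"
    and q3: "st_pair f1 (char_test p (deriv \<eta>)) = I f1 p (deriv \<eta>)"
    by (rule pair1; simp add: p p'' supp supp')+
  have "st_pair f0 (partial_t (partial_t (char_test p \<eta>))) =
      st_pair f0 (partial_x (partial_x (char_test p \<eta>))) + (LINT t:{0..}|lebesgue. u t * char_test p \<eta> (0, t))"
    using ev st(1) by (simp add: string_evolution_def)
  \<comment> \<open>The terms with the second derivative of \<open>p\<close> cancel, because p(x +
    t) solves the free wave equation.\<close>
  then have e1: "2 * I f0 (deriv p) (deriv \<eta>) + I f0 p (deriv (deriv \<eta>)) =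
      (LINT t:{0..}|lebesgue. u t * (p t * \<eta> t))"
    unfolding tt_eq xx_eq
      q4 q1
    by (simp add: char_test_def)
  have "- st_pair f0 (partial_t (char_test p (deriv \<eta>))) = st_pair f1 (char_test p (deriv \<eta>))"
    using ev st(2) by (simp add: string_evolution_def)
  then have e2: "- (I f0 (deriv p) (deriv \<eta>) + I f0 p (deriv (deriv \<eta>))) = I f1 p (deriv \<eta>)"
    unfolding partial_t_char_test[OF ps(1) sm']
      q2 q3 .
  note dp = deriv_translate[OF ps(1)]
  have "(LINT t:{0..}|lebesgue. deriv \<eta> t * state_g (f0 t) (f1 t) (\<lambda>x. p (x + t))) =
    (LINT t:{a..b}|lebesgue. deriv \<eta> t * f1 t (\<lambda>x. p (x + t)) - deriv \<eta> t * f0 t (\<lambda>x. deriv p (x + t)))"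
    unfolding state_g_def distr_deriv_def dp
    by (subst restrict) (auto simp: supp' algebra_simps)
  also have "\<dots> = I f1 p (deriv \<eta>) - I f0 (deriv p) (deriv \<eta>)"
    unfolding I_def by (intro set_integral_diff(2) integrable p p' sm') auto
  finally show ?thesis using e1 e2 by linarith
qed

section \<open>Integrating an equation that holds weakly in time\<close>

lemma integrable_continuous_support:
  fixes g :: "real \<Rightarrow> real"
  assumes "continuous_on {a..b} g" "\<And>x. x \<notin> {a..b} \<Longrightarrow> g x = 0"
  shows "integrable lborel g"
proof -
  have "(\<lambda>x. indicator {a..b} x *\<^sub>R g x) = g"
    using assms(2) by (auto simp: indicator_def fun_eq_iff)
  then show ?thesis
    using borel_integrable_atLeastAtMost'[OF assms(1)] by (simp add: set_integrable_def)
qed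

text \<open>The substitution y = (n + 1) (t - a) moves \<open>n\<close> into the argument of
  \<open>P\<close>, where dominated convergence applies; only values of \<open>P\<close> on
  [a, a + 1] enter.\<close>

lemma mollifier_tendsto:
  fixes P \<theta> :: "real \<Rightarrow> real"
  assumes P: "continuous_on UNIV P" and \<theta>: "continuous_on UNIV \<theta>"
    and supp: "\<And>x. x \<notin> {0..1} \<Longrightarrow> \<theta> x = 0"
  shows "(\<lambda>n. \<integral>t. P t * (real (Suc n) * \<theta> (real (Suc n) * (t - a))) \<partial>lborel)
    \<longlonglongrightarrow> P a * (\<integral>y. \<theta> y \<partial>lborel)"
proof -
  have [measurable]: "P \<in> borel_measurable borel" "\<theta> \<in> borel_measurable borel"
    using P \<theta> by (auto intro: borel_measurable_continuous_onI)
  have eq: "(\<integral>t. P t * (real (Suc n) * \<theta> (real (Suc n) * (t - a))) \<partial>lborel) =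
      (\<integral>y. P (a + y / real (Suc n)) * \<theta> y \<partial>lborel)" for n
  proof -
    let ?r = "real (Suc n)"
    have "(\<integral>t. P t * (?r * \<theta> (?r * (t - a))) \<partial>lborel) =
      \<bar>1 / ?r\<bar> *\<^sub>R (\<integral>y. P (a + 1 / ?r * y) * (?r * \<theta> (?r * (a + 1 / ?r * y - a))) \<partial>lborel)"
      by (rule lborel_integral_real_affine) simp
    also have "\<dots> = \<bar>1 / ?r\<bar> *\<^sub>R (\<integral>y. ?r * (P (a + y / ?r) * \<theta> y) \<partial>lborel)"
      by (simp add: mult_ac)
    also have "\<dots> = (\<integral>y. P (a + y / ?r) * \<theta> y \<partial>lborel)" by simp
    finally show ?thesis .
  qed
  have "bounded (P ` {a..a + 1})"
    by (intro compact_imp_bounded compact_continuous_image continuous_on_subset[OF P]) auto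
  then obtain M where "\<forall>y\<in>P ` {a..a + 1}. norm y \<le> M"
    unfolding bounded_iff by blast
  then have M: "\<bar>P x\<bar> \<le> M" if "x \<in> {a..a + 1}" for x using that by simp
  have "(\<lambda>n. \<integral>y. P (a + y / real (Suc n)) * \<theta> y \<partial>lborel) \<longlonglongrightarrow> (\<integral>y. P a * \<theta> y \<partial>lborel)"
  proof (rule integral_dominated_convergence[where w = "\<lambda>y. M * \<bar>\<theta> y\<bar>"])
    show "integrable lborel (\<lambda>y. M * \<bar>\<theta> y\<bar>)"
      by (rule integrable_continuous_support[of 0 1])
        (auto intro!: continuous_intros continuous_on_subset[OF \<theta>] simp: supp)
    show "AE y in lborel. (\<lambda>n. P (a + y / real (Suc n)) * \<theta> y) \<longlonglongrightarrow> P a * \<theta> y"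
    proof (intro AE_I2 tendsto_mult tendsto_const)
      fix y
      have "(\<lambda>n. a + y / real (Suc n)) \<longlonglongrightarrow> a"
        using tendsto_add[OF tendsto_const LIMSEQ_Suc[OF lim_const_over_n[of y]], of a] by simp
      then show "(\<lambda>n. P (a + y / real (Suc n))) \<longlonglongrightarrow> P a"
        using P by (auto simp: continuous_on_eq_continuous_at intro: isCont_tendsto_compose)
    qed
    show "AE y in lborel. norm (P (a + y / real (Suc n)) * \<theta> y) \<le> M * \<bar>\<theta> y\<bar>" for n
    proof (intro AE_I2)
      fix y
      show "norm (P (a + y / real (Suc n)) * \<theta> y) \<le> M * \<bar>\<theta> y\<bar>"
      proof (cases "y \<in> {0..1}")
        case True
        then have "y / real (Suc n) \<le> 1 / 1" by (intro frac_le) auto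
        then have "a + y / real (Suc n) \<in> {a..a + 1}" using True by auto
        then show ?thesis using M by (simp add: abs_mult mult_right_mono)
      qed (simp add: supp)
    qed
  qed auto
  then show ?thesis unfolding eq by simp
qed

text \<open>Testing with smooth approximations of an interval indicator: their derivatives are
  mollifiers at \<open>a\<close> and \<open>b\<close> with opposite signs, so the left side tends to
  P a - P b.\<close>

lemma weak_derivative_interior:
  fixes P v :: "real \<Rightarrow> real"
  assumes P: "continuous_on UNIV P" and v[measurable]: "v \<in> borel_measurable borel"
    and B: "\<And>t. \<bar>v t\<bar> \<le> B"
    and weak: "\<And>\<eta> a b. smooth \<eta> \<Longrightarrow> (\<And>t. t \<notin> {a..b} \<Longrightarrow> \<eta> t = 0) \<Longrightarrow> 0 < a \<Longrightarrow> a < b \<Longrightarrow>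
      (\<integral>t. P t * deriv \<eta> t \<partial>lborel) = - (\<integral>t. v t * \<eta> t \<partial>lborel)"
    and ab: "0 < a" "a < b"
  shows "P b = P a + (LINT t:{a..b}|lborel. v t)"
proof -
  have B0: "0 \<le> B" using order.trans[OF abs_ge_zero B] .
  obtain \<Theta> :: "real \<Rightarrow> real" where \<Theta>: "smooth \<Theta>" "\<And>x. x \<le> 0 \<Longrightarrow> \<Theta> x = 0" "\<And>x. x \<ge> 1 \<Longrightarrow> \<Theta> x = 1" 
    "\<And>x. 0 \<le> \<Theta> x" "\<And>x. \<Theta> x \<le> 1" "\<And>x. x \<notin> {0..1} \<Longrightarrow> deriv \<Theta> x = 0"
    using smooth_step_exists by metis
  have c\<Theta>: "continuous_on A (deriv \<Theta>)" for A
    by (rule smooth_continuous_on[OF smooth_deriv[OF \<Theta>(1)]])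
  have one: "(\<integral>y. deriv \<Theta> y \<partial>lborel) = 1"
  proof -
    have "(\<integral>y. indicator {0..1} y *\<^sub>R deriv \<Theta> y \<partial>lborel) = \<Theta> 1 - \<Theta> 0"
      by (rule integral_FTC_Icc)
        (auto intro: c\<Theta> has_field_derivative_at_within smooth_DERIV[OF \<Theta>(1)]
          simp: has_real_derivative_iff_has_vector_derivative[symmetric])
    moreover have "(\<lambda>y. indicator {0..1} y *\<^sub>R deriv \<Theta> y) = deriv \<Theta>"
      using \<Theta>(6) by (auto simp: indicator_def fun_eq_iff)
    ultimately show ?thesis using \<Theta>(2)[of 0] \<Theta>(3)[of 1] by simp
  qed
  \<comment> \<open>Rises after \<open>a\<close> and falls after \<open>b\<close>, so for every
    \<open>n\<close> the support lies in [a, b + 1], inside the positive times where testing is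
    allowed.\<close>
  define \<eta> where "\<eta> n t = \<Theta> (real (Suc n) * (t - a)) - \<Theta> (real (Suc n) * (t - b))" for n t
  have sm1: "smooth (\<lambda>t. \<Theta> (real (Suc n) * (t - c)))" for n c
    using smooth_affine[OF \<Theta>(1), of "- real (Suc n) * c" "real (Suc n)"]
    by (simp add: inner_real_def algebra_simps)
  have sm: "smooth (\<eta> n)" for n
    unfolding \<eta>_def by (intro smooth_diff sm1)
  have [measurable]: "\<eta> n \<in> borel_measurable borel" for n
    by (rule borel_measurable_continuous_onI[OF smooth_continuous_on[OF sm]])
  have supp: "\<eta> n t = 0" if t: "t \<notin> {a..b + 1}" for n t
  proof -
    consider "t < a" | "t > b + 1" using t by (cases "t < a") auto
    then show ?thesis
    proof cases
      case 1
      then show ?thesis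
        using ab unfolding \<eta>_def by (simp add: \<Theta>(2) mult_nonneg_nonpos)
    next
      case 2
      have "1 \<le> real (Suc n) * (t - c)" if "c \<le> b" for c
        using mult_mono[of 1 "real (Suc n)" 1 "t - c"] 2 that by simp
      then show ?thesis using ab unfolding \<eta>_def by (simp add: \<Theta>(3))
    qed
  qed
  have d\<eta>: "deriv (\<eta> n) t = real (Suc n) * deriv \<Theta> (real (Suc n) * (t - a)) -
      real (Suc n) * deriv \<Theta> (real (Suc n) * (t - b))" for n t
  proof (rule DERIV_imp_deriv)
    have "((\<lambda>t. \<Theta> (real (Suc n) * (t - c))) has_real_derivative
        deriv \<Theta> (real (Suc n) * (t - c)) * real (Suc n)) (at t)" for c
      by (rule DERIV_chain2[OF smooth_DERIV[OF \<Theta>(1)]]) (auto intro!: derivative_eq_intros)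
    from DERIV_diff[OF this[of a] this[of b]]
    show "(\<eta> n has_real_derivative real (Suc n) * deriv \<Theta> (real (Suc n) * (t - a)) -
      real (Suc n) * deriv \<Theta> (real (Suc n) * (t - b))) (at t)"
      unfolding \<eta>_def by (simp only: mult.commute)
  qed
  have integ: "integrable lborel (\<lambda>t. P t * (real (Suc n) * deriv \<Theta> (real (Suc n) * (t - c))))" for n c
  proof (rule integrable_continuous_support[of c "c + 1"])
    show "continuous_on {c..c + 1} (\<lambda>t. P t * (real (Suc n) * deriv \<Theta> (real (Suc n) * (t - c))))"
      by (intro continuous_intros continuous_on_subset[OF P] continuous_on_compose2[OF c\<Theta>[of UNIV]]) auto
    fix t assume "t \<notin> {c..c + 1}"
    then consider "t < c" | "t > c + 1" by fastforce
    then have "real (Suc n) * (t - c) \<notin> {0..1}"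
    proof cases
      case 1
      then show ?thesis by (simp add: mult_less_0_iff not_le)
    next
      case 2
      have "1 * 1 < real (Suc n) * (t - c)"
        by (rule mult_le_less_imp_less) (use 2 in auto)
      then show ?thesis by simp
    qed
    then show "P t * (real (Suc n) * deriv \<Theta> (real (Suc n) * (t - c))) = 0"
      using \<Theta>(6) by simp
  qed
  have eq: "(\<integral>t. P t * (real (Suc n) * deriv \<Theta> (real (Suc n) * (t - a))) \<partial>lborel) -
      (\<integral>t. P t * (real (Suc n) * deriv \<Theta> (real (Suc n) * (t - b))) \<partial>lborel) =
      - (\<integral>t. v t * \<eta> n t \<partial>lborel)" for n
  proof -
    have "(\<integral>t. P t * deriv (\<eta> n) t \<partial>lborel) = - (\<integral>t. v t * \<eta> n t \<partial>lborel)"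
      by (rule weak[of "\<eta> n" a "b + 1"]) (use sm supp ab in auto)
    then show ?thesis
      unfolding d\<eta> right_diff_distrib[of "P t" for t] Bochner_Integration.integral_diff[OF integ integ] .
  qed
  have "(\<lambda>n. - (\<integral>t. v t * \<eta> n t \<partial>lborel)) \<longlonglongrightarrow> P a * 1 - P b * 1"
    unfolding eq[symmetric] one[symmetric]
    by (intro tendsto_diff mollifier_tendsto P c\<Theta> \<Theta>(6))
  \<comment> \<open>The limit is half-open because \<Theta> vanishes at 0: the first step is still 0
    at t = a and the second still 0 at t = b.\<close>
  moreover have "(\<lambda>n. - (\<integral>t. v t * \<eta> n t \<partial>lborel)) \<longlonglongrightarrow> - (\<integral>t. v t * indicator {a<..b} t \<partial>lborel)"
  proof (intro tendsto_minus integral_dominated_convergence[where w = "\<lambda>t. indicator {a..b + 1} t * B"])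
    show "integrable lborel (\<lambda>t. indicator {a..b + 1} t * B)"
      using borel_integrable_atLeastAtMost'[of a "b + 1" "\<lambda>_. B"] by (simp add: set_integrable_def)
    show "AE t in lborel. norm (v t * \<eta> n t) \<le> indicator {a..b + 1} t * B" for n
    proof (intro AE_I2)
      fix t
      have "\<bar>\<eta> n t\<bar> \<le> 1"
        using \<Theta>(4,5)[of "real (Suc n) * (t - a)"] \<Theta>(4,5)[of "real (Suc n) * (t - b)"]
        unfolding \<eta>_def by linarith
      then have "\<bar>v t * \<eta> n t\<bar> \<le> B * 1"
        unfolding abs_mult by (intro mult_mono B B0) auto
      then show "norm (v t * \<eta> n t) \<le> indicator {a..b + 1} t * B"
        using supp[of t n] by (auto simp: indicator_def)
    qed
    show "AE t in lborel. (\<lambda>n. v t * \<eta> n t) \<longlonglongrightarrow> v t * indicator {a<..b} t"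
    proof (intro AE_I2 tendsto_mult tendsto_const)
      fix t
      have to1: "(\<lambda>n. \<Theta> (real (Suc n) * (t - c))) \<longlonglongrightarrow> 1" if "c < t" for c
      proof -
        obtain N :: nat where "1 / (t - c) < real N" using reals_Archimedean2 by blast
        then have N: "1 \<le> real N * (t - c)" using that by (simp add: field_simps)
        have "\<Theta> (real (Suc n) * (t - c)) = 1" if "N \<le> n" for n
        proof -
          have "real N * (t - c) \<le> real (Suc n) * (t - c)"
            using that \<open>c < t\<close> by (intro mult_right_mono) auto
          then show ?thesis using N by (intro \<Theta>(3)) linarith
        qed
        then have "eventually (\<lambda>n. \<Theta> (real (Suc n) * (t - c)) = 1) sequentially"
          by (auto simp: eventually_sequentially)
        then show ?thesis by (rule tendsto_eventually)
      qed
      have to0: "(\<lambda>n. \<Theta> (real (Suc n) * (t - c))) \<longlonglongrightarrow> 0" if "t \<le> c" for c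
        using that by (simp add: \<Theta>(2) mult_nonneg_nonpos)
      consider "t \<le> a" | "a < t" "t \<le> b" | "b < t" by linarith
      then show "(\<lambda>n. \<eta> n t) \<longlonglongrightarrow> indicator {a<..b} t"
      proof cases
        case 1
        then show ?thesis unfolding \<eta>_def
          using tendsto_diff[OF to0[of a] to0[of b]] ab by simp
      next
        case 2
        then show ?thesis unfolding \<eta>_def
          using tendsto_diff[OF to1[of a] to0[of b]] by simp
      next
        case 3
        then show ?thesis unfolding \<eta>_def
          using tendsto_diff[OF to1[of a] to1[of b]] ab by simp
      qed
    qed
  qed simp_all
  ultimately have "P a * 1 - P b * 1 = - (\<integral>t. v t * indicator {a<..b} t \<partial>lborel)"
    by (rule LIMSEQ_unique)
  moreover have "(\<integral>t. v t * indicator {a<..b} t \<partial>lborel) = (LINT t:{a..b}|lborel. v t)"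
    unfolding set_lebesgue_integral_def
    by (intro integral_cong_AE, simp, simp, use AE_lborel_singleton[of a] in eventually_elim)
      (auto simp: indicator_def)
  ultimately show ?thesis by simp
qed

text \<open>Test functions vanish near time 0, so the interior statement starts only from positive
  times; continuity of \<open>P\<close> carries it down to 0.\<close>

lemma weak_derivative:
  fixes P v :: "real \<Rightarrow> real"
  assumes P: "continuous_on {0..} P" and v: "v \<in> borel_measurable borel"
    and B: "\<And>t. \<bar>v t\<bar> \<le> B"
    and weak: "\<And>\<eta> a b. smooth \<eta> \<Longrightarrow> (\<And>t. t \<notin> {a..b} \<Longrightarrow> \<eta> t = 0) \<Longrightarrow> 0 < a \<Longrightarrow> a < b \<Longrightarrow>
      (LINT t:{0..}|lebesgue. deriv \<eta> t * P t) = - (LINT t:{0..}|lebesgue. v t * \<eta> t)"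
    and t: "0 \<le> t"
  shows "P t = P 0 + (LINT s:{0..t}|lborel. v s)"
proof -
  \<comment> \<open>Constant continuation to negative times, giving a function continuous on the
    whole line.\<close>
  define Q where "Q t = P (max 0 t)" for t
  have Q: "continuous_on UNIV Q"
    unfolding Q_def
    by (rule continuous_on_compose2[OF P]) (auto intro: continuous_on_max continuous_on_const continuous_on_id)
  have QP: "Q t = P t" if "0 \<le> t" for t using that by (simp add: Q_def)
  have [measurable]: "Q \<in> borel_measurable borel" by (rule borel_measurable_continuous_onI[OF Q])
  note v[measurable]
  have weakQ: "(\<integral>t. Q t * deriv \<eta> t \<partial>lborel) = - (\<integral>t. v t * \<eta> t \<partial>lborel)"
    if sm: "smooth \<eta>" and supp: "\<And>t. t \<notin> {a..b} \<Longrightarrow> \<eta> t = 0" and ab: "0 < a" "a < b" for \<eta> a b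
  proof -
    have [measurable]: "\<eta> \<in> borel_measurable borel" "deriv \<eta> \<in> borel_measurable borel"
      using sm smooth_deriv[OF sm] by (auto intro!: borel_measurable_continuous_onI smooth_continuous_on)
    have "(\<integral>t. Q t * deriv \<eta> t \<partial>lborel) = (\<integral>t. Q t * deriv \<eta> t \<partial>lebesgue)"
      by (rule integral_completion[symmetric]) simp
    also have "\<dots> = (LINT t:{0..}|lebesgue. deriv \<eta> t * P t)"
      unfolding set_lebesgue_integral_def
    proof (intro Bochner_Integration.integral_cong refl)
      fix t
      have "deriv \<eta> t = 0" if "t < 0"
        by (rule smooth_support_deriv[OF sm, of a b]) (use supp ab that in auto)
      then show "Q t * deriv \<eta> t = indicator {0..} t *\<^sub>R (deriv \<eta> t * P t)"
        by (cases "0 \<le> t") (simp_all add: QP)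
    qed
    also have "\<dots> = - (LINT t:{0..}|lebesgue. v t * \<eta> t)"
      by (rule weak[OF sm supp ab])
    also have "(LINT t:{0..}|lebesgue. v t * \<eta> t) = (\<integral>t. v t * \<eta> t \<partial>lebesgue)"
      unfolding set_lebesgue_integral_def
    proof (intro Bochner_Integration.integral_cong refl)
      fix t show "indicator {0..} t *\<^sub>R (v t * \<eta> t) = v t * \<eta> t"
        using supp[of t] ab by (cases "0 \<le> t") simp_all
    qed
    also have "(\<integral>t. v t * \<eta> t \<partial>lebesgue) = (\<integral>t. v t * \<eta> t \<partial>lborel)"
      by (rule integral_completion) simp
    finally show ?thesis .
  qed
  show ?thesis
  proof (cases "t = 0")
    case True
    have "\<bar>LINT s:{0..0::real}|lborel. v s\<bar> \<le> B * (0 - 0)"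
      by (rule set_integral_abs_le[OF v B]) simp
    then show ?thesis using True by simp
  next
    case False
    then have t0: "0 < t" using t by simp
    \<comment> \<open>The denominator starts at 2 so that \<open>a n < t\<close> is strict already
      for n = 0.\<close>
    define a where "a n = t / real (Suc (Suc n))" for n
    have a: "0 < a n" "a n < t" for n
      using t0 by (auto simp: a_def divide_less_eq)
    have a0: "a \<longlonglongrightarrow> 0"
      unfolding a_def using LIMSEQ_Suc[OF LIMSEQ_Suc[OF lim_const_over_n[of t]]] by simp
    have eq: "Q t = Q (a n) + ((LINT s:{0..t}|lborel. v s) - (LINT s:{0..a n}|lborel. v s))" for n
    proof -
      have "(LINT s:{0..t}|lborel. v s) = (LINT s:{0..a n}|lborel. v s) + (LINT s:{a n..t}|lborel. v s)"
        by (rule set_integral_combine[OF bounded_borel_set_integrable[OF v B]])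
          (use a[of n] in auto)
      moreover have "Q t = Q (a n) + (LINT s:{a n..t}|lborel. v s)"
        by (rule weak_derivative_interior[OF Q v B weakQ a])
      ultimately show ?thesis by simp
    qed
    have "(\<lambda>n. Q (a n) + ((LINT s:{0..t}|lborel. v s) - (LINT s:{0..a n}|lborel. v s)))
        \<longlonglongrightarrow> Q 0 + ((LINT s:{0..t}|lborel. v s) - 0)"
    proof (intro tendsto_intros)
      show "(\<lambda>n. Q (a n)) \<longlonglongrightarrow> Q 0"
        using Q a0 by (auto simp: continuous_on_eq_continuous_at intro: isCont_tendsto_compose)
      show "(\<lambda>n. LINT s:{0..a n}|lborel. v s) \<longlonglongrightarrow> 0"
      proof (rule Lim_null_comparison)
        show "(\<lambda>n. B * (a n - 0)) \<longlonglongrightarrow> 0"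
          using tendsto_mult_right_zero[OF a0, of B] by simp
        show "\<forall>\<^sub>F n in sequentially. norm (LINT s:{0..a n}|lborel. v s) \<le> B * (a n - 0)"
          using a unfolding real_norm_def
          by (intro always_eventually allI set_integral_abs_le[OF v B]) (simp add: less_imp_le)
      qed
    qed
    then have "Q t = Q 0 + ((LINT s:{0..t}|lborel. v s) - 0)"
      unfolding eq[symmetric] LIMSEQ_const_iff .
    then show ?thesis using t by (simp add: QP)
  qed
qed

subsection \<open>The profile carried along characteristics\<close>

text \<open>The value of \<open>g\<close> on the characteristic that reaches \<open>x = 0\<close> at time \<open>s\<close>, just before it
  gets there; it has crossed \<open>0\<close> at the times \<open>s - 2\<pi>\<close>, \<open>s - 4\<pi>\<close>, ..., and \<open>w\<close> is meant to
  vanish on negative times.\<close>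

definition char_profile :: "(real \<Rightarrow> real) \<Rightarrow> (real \<Rightarrow> real) \<Rightarrow> real \<Rightarrow> real" where
  "char_profile h w s = h (frac_pi s) + (\<Sum>k. w (s - 2 * pi * real (Suc k)))"

lemma frac_pi_measurable[measurable]: "frac_pi \<in> borel_measurable borel"
  unfolding frac_pi_def by measurable

lemma char_profile_measurable:
  assumes [measurable]: "h \<in> borel_measurable borel" "w \<in> borel_measurable borel"
  shows "char_profile h w \<in> borel_measurable borel"
  unfolding char_profile_def by measurable

text \<open>As \<open>w\<close> vanishes on negative times, the series has finitely many nonzero
  terms; after a shift by one period its head is \<open>w s\<close>.\<close>

lemma char_profile_step:
  assumes w: "\<And>s. s < 0 \<Longrightarrow> w s = 0"
  shows "char_profile h w (s + 2 * pi) = char_profile h w s + w s"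
proof -
  let ?f = "\<lambda>k. w (s + 2 * pi - 2 * pi * real (Suc k))"
  obtain N :: nat where N: "s / (2 * pi) < real N" using reals_Archimedean2 by blast
  have "summable ?f"
  proof (rule summable_finite)
    fix k assume "k \<notin> {..<N}"
    then have "s < 2 * pi * real k" using N by (auto simp: field_simps intro: less_le_trans)
    then show "?f k = 0" by (intro w) (simp add: algebra_simps)
  qed simp
  from suminf_split_head[OF this]
  have "(\<Sum>k. w (s - 2 * pi * real (Suc k))) = suminf ?f - w s"
    by (simp add: algebra_simps)
  then show ?thesis by (simp add: char_profile_def frac_pi_periodic)
qed

lemma char_profile_base:
  assumes w: "\<And>s. s < 0 \<Longrightarrow> w s = 0" and s: "s < 2 * pi"
  shows "char_profile h w s = h (frac_pi s)"
proof -
  have "w (s - 2 * pi * real (Suc k)) = 0" for k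
  proof (rule w)
    have "2 * pi * 1 \<le> 2 * pi * real (Suc k)" by (intro mult_left_mono) auto
    then show "s - 2 * pi * real (Suc k) < 0" using s by linarith
  qed
  then show ?thesis by (simp add: char_profile_def)
qed

lemma char_profile_bound:
  assumes w: "\<And>s. s < 0 \<Longrightarrow> w s = 0" "\<And>s. \<bar>w s\<bar> \<le> 1" and h: "\<And>s. \<bar>h s\<bar> \<le> B"
    and s: "s < 2 * pi * real (Suc n)"
  shows "\<bar>char_profile h w s\<bar> \<le> B + real n"
  using s
proof (induction n arbitrary: s)
  case 0
  then show ?case using h by (simp add: char_profile_base[OF w(1)])
next
  case (Suc n)
  have "s - 2 * pi < 2 * pi * real (Suc n)" using Suc.prems by (simp add: algebra_simps)
  then have "\<bar>char_profile h w (s - 2 * pi)\<bar> \<le> B + real n" by (rule Suc.IH)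
  moreover have "char_profile h w s = char_profile h w (s - 2 * pi) + w (s - 2 * pi)"
    using char_profile_step[of w h "s - 2 * pi"] w(1) by simp
  ultimately show ?case using w(2)[of "s - 2 * pi"] by simp
qed

lemma char_profile_locally_bounded:
  assumes w: "\<And>s. s < 0 \<Longrightarrow> w s = 0" "\<And>s. \<bar>w s\<bar> \<le> 1" and h: "\<And>s. \<bar>h s\<bar> \<le> B"
  shows "\<exists>C. \<forall>s\<le>R. \<bar>char_profile h w s\<bar> \<le> C"
proof -
  obtain n :: nat where n: "R / (2 * pi) < real n" using reals_Archimedean2 by blast
  have "\<bar>char_profile h w s\<bar> \<le> B + real n" if "s \<le> R" for s
  proof (rule char_profile_bound[OF w h])
    have "R < 2 * pi * real n" using n by (simp add: field_simps)
    also have "\<dots> \<le> 2 * pi * real (Suc n)" by (intro mult_left_mono) auto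
    finally show "s < 2 * pi * real (Suc n)" using that by linarith
  qed
  then show ?thesis by blast
qed

text \<open>The window [t, t + 2 pi] arises from [0, 2 pi] by exchanging [0, t] for
  [2 pi, t + 2 pi], and these two pieces differ by the jump \<open>w\<close> after a shift by one
  period. The result matches the formula for the solution in
  \<open>state_g_along_characteristics\<close>.\<close>

lemma char_profile_period_integral:
  assumes w: "\<And>s. s < 0 \<Longrightarrow> w s = 0" "\<And>s. \<bar>w s\<bar> \<le> 1" and h: "\<And>s. \<bar>h s\<bar> \<le> B"
    and [measurable]: "h \<in> borel_measurable borel" "w \<in> borel_measurable borel" "p \<in> borel_measurable borel"
    and p: "\<And>s. p (s + 2 * pi) = p s" "\<And>s. \<bar>p s\<bar> \<le> M" and t: "0 \<le> t"
  shows "(LINT x:{0..2 * pi}|lborel. char_profile h w (x + t) * p (x + t)) =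
    (LINT x:{0..2 * pi}|lborel. h x * p x) + (LINT s:{0..t}|lborel. w s * p s)"
proof -
  let ?H = "char_profile h w"
  have [measurable]: "?H \<in> borel_measurable borel" by (rule char_profile_measurable) measurable
  obtain C where C: "\<And>s. s \<le> t + 4 * pi \<Longrightarrow> \<bar>?H s\<bar> \<le> C"
    using char_profile_locally_bounded[of w h B "t + 4 * pi"] w h by blast
  have M0: "0 \<le> M" using order.trans[OF abs_ge_zero p(2)] .
  have "\<bar>?H 0\<bar> \<le> C" by (rule C) (use t pi_gt_zero in linarith)
  then have C0: "0 \<le> C" by linarith
  have int: "set_integrable lborel {a..b} (\<lambda>s. ?H s * p s)" if "b \<le> t + 4 * pi" for a b
  proof (rule bounded_borel_set_integrable[where B = "C * M"])
    fix x assume "x \<in> {a..b}"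
    then show "\<bar>?H x * p x\<bar> \<le> C * M"
      unfolding abs_mult using that by (intro mult_mono C p C0) auto
  qed simp
  have intw: "set_integrable lborel {a..b} (\<lambda>s. w s * p s)" for a b
  proof (rule bounded_borel_set_integrable[where B = "1 * M"])
    fix x
    show "\<bar>w x * p x\<bar> \<le> 1 * M" unfolding abs_mult by (intro mult_mono w p) auto
  qed simp
  have "(LINT x:{0..2 * pi}|lborel. ?H (x + t) * p (x + t)) = (LINT s:{t..t + 2 * pi}|lborel. ?H s * p s)"
    using set_integral_translate[of 0 "2 * pi" "\<lambda>s. ?H s * p s" t] by (simp add: add.commute)
  also have "\<dots> = (LINT s:{0..t + 2 * pi}|lborel. ?H s * p s) - (LINT s:{0..t}|lborel. ?H s * p s)"
    using set_integral_combine[OF int[of "t + 2 * pi" 0], of t] t by simp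
  also have "(LINT s:{0..t + 2 * pi}|lborel. ?H s * p s) =
      (LINT s:{0..2 * pi}|lborel. ?H s * p s) + (LINT s:{2 * pi..t + 2 * pi}|lborel. ?H s * p s)"
    by (rule set_integral_combine[OF int]) (use t in auto)
  also have "(LINT s:{2 * pi..t + 2 * pi}|lborel. ?H s * p s) =
      (LINT s:{0..t}|lborel. ?H (s + 2 * pi) * p (s + 2 * pi))"
    using set_integral_translate[of 0 t "\<lambda>s. ?H s * p s" "2 * pi"] by simp
  also have "\<dots> = (LINT s:{0..t}|lborel. ?H s * p s + w s * p s)"
    by (simp add: char_profile_step w p distrib_right)
  also have "\<dots> = (LINT s:{0..t}|lborel. ?H s * p s) + (LINT s:{0..t}|lborel. w s * p s)"
    by (intro set_integral_add int intw) (use t in auto)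
  \<comment> \<open>The profile agrees with \<open>h\<close> only before 2 pi; the endpoint is a
    null set.\<close>
  also have "(LINT s:{0..2 * pi}|lborel. ?H s * p s) = (LINT s:{0..2 * pi}|lborel. h s * p s)"
  proof (rule set_lebesgue_integral_cong_AE)
    show "AE s\<in>{0..2 * pi} in lborel. ?H s * p s = h s * p s"
      using AE_lborel_singleton[of "2 * pi"]
    proof eventually_elim
      case (elim s)
      show ?case
      proof
        assume "s \<in> {0..2 * pi}"
        then have "s < 2 * pi" "0 \<le> s" using elim by auto
        then show "?H s * p s = h s * p s"
          using char_profile_base[of w s h] w(1) frac_pi_eq[of s] by simp
      qed
    qed
  qed auto
  finally show ?thesis by simp
qed

lemma trig_poly_bounded: "trig_poly p \<Longrightarrow> \<exists>M. \<forall>x. \<bar>p x\<bar> \<le> M"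
proof (induction rule: trig_poly.induct)
  case (trig_poly_cmult p c)
  then obtain M where "\<And>x. \<bar>p x\<bar> \<le> M" by blast
  then show ?case by (intro exI[of _ "\<bar>c\<bar> * M"]) (simp add: abs_mult mult_left_mono)
next
  case (trig_poly_add p q)
  then obtain M N where "\<And>x. \<bar>p x\<bar> \<le> M" "\<And>x. \<bar>q x\<bar> \<le> N" by blast
  then have "\<bar>p x + q x\<bar> \<le> M + N" for x
    by (rule order.trans[OF abs_triangle_ineq add_mono])
  then show ?case by blast
qed (auto intro: exI[of _ 1])

section \<open>The solution of the transport equation\<close>

text \<open>\<open>string_evolution_transport\<close> says that the pairing on the left, as a
  function of \<open>t\<close>, has the weak derivative u(t) p(t); \<open>weak_derivative\<close>
  integrates it from time 0.\<close>

lemma state_g_along_characteristics: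
  assumes ev: "string_evolution u f0 f1" and p: "trig_poly p"
    and w: "w \<in> borel_measurable borel" "\<And>s. \<bar>w s\<bar> \<le> 1"
    and uw: "AE t in lebesgue. 0 \<le> t \<longrightarrow> u t = w t" and t: "0 \<le> t"
  shows "state_g (f0 t) (f1 t) (\<lambda>x. p (x + t)) =
    state_g (f0 0) (f1 0) p + (LINT s:{0..t}|lborel. w s * p s)"
proof -
  have dist: "distribution (f0 t)" "distribution (f1 t)" if "0 \<le> t" for t
    using ev that by (auto simp: string_evolution_def even_distribution_def)
  have cont: "continuous_on {0..} (\<lambda>t. f0 t \<phi>)" "continuous_on {0..} (\<lambda>t. f1 t \<phi>)"
    if "\<phi> \<in> torus_test" for \<phi>
    using ev that by (auto simp: string_evolution_def)
  have [measurable]: "w \<in> borel_measurable borel" "p \<in> borel_measurable borel"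
    using w(1) smooth_continuous_on[OF trig_poly_smooth[OF p]]
    by (auto intro: borel_measurable_continuous_onI)
  note dp = deriv_translate[OF trig_poly_smooth[OF p]]
  obtain M where M: "\<And>x. \<bar>p x\<bar> \<le> M" using trig_poly_bounded[OF p] by blast
  have "state_g (f0 t) (f1 t) (\<lambda>x. p (x + t)) =
    state_g (f0 0) (f1 0) (\<lambda>x. p (x + 0)) + (LINT s:{0..t}|lborel. w s * p s)"
  proof (rule weak_derivative[OF _ _ _ _ t])
    show "continuous_on {0..} (\<lambda>t. state_g (f0 t) (f1 t) (\<lambda>x. p (x + t)))"
      unfolding state_g_def distr_deriv_def dp
      by (intro continuous_on_add continuous_on_minus
          continuous_translated_pairing[OF dist(1) cont(1) trig_poly_deriv[OF p]]
          continuous_translated_pairing[OF dist(2) cont(2) p])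
    show "\<bar>w s * p s\<bar> \<le> 1 * M" for s
      unfolding abs_mult by (intro mult_mono w M) auto
    fix \<eta> :: "real \<Rightarrow> real" and a b :: real
    assume \<eta>: "smooth \<eta>" "\<And>t. t \<notin> {a..b} \<Longrightarrow> \<eta> t = 0" "0 < a" "a < b"
    have [measurable]: "\<eta> \<in> borel_measurable borel"
      using \<eta>(1) by (intro borel_measurable_continuous_onI smooth_continuous_on)
    have "(LINT t:{0..}|lebesgue. deriv \<eta> t * state_g (f0 t) (f1 t) (\<lambda>x. p (x + t))) =
        - (LINT t:{0..}|lebesgue. u t * (p t * \<eta> t))"
      by (rule string_evolution_transport[OF ev p \<eta>])
    \<comment> \<open>\<open>u\<close> gives way to its Borel version; measurability of the
      integrand containing \<open>u\<close> is inherited through equality almost everywhere.\<close>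
    also have "(LINT t:{0..}|lebesgue. u t * (p t * \<eta> t)) = (LINT t:{0..}|lebesgue. w t * p t * \<eta> t)"
      unfolding set_lebesgue_integral_def
    proof (rule integral_cong_AE)
      have m: "(\<lambda>t. indicator {0..} t *\<^sub>R (w t * p t * \<eta> t)) \<in> borel_measurable lborel"
        by measurable
      then show m': "(\<lambda>t. indicator {0..} t *\<^sub>R (w t * p t * \<eta> t)) \<in> borel_measurable lebesgue"
        by (rule measurable_completion)
      show AE: "AE t in lebesgue. indicator {0..} t *\<^sub>R (u t * (p t * \<eta> t)) =
          indicator {0..} t *\<^sub>R (w t * p t * \<eta> t)"
        using uw by eventually_elim (auto simp: indicator_def)
      show "(\<lambda>t. indicator {0..} t *\<^sub>R (u t * (p t * \<eta> t))) \<in> borel_measurable lebesgue"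
        using AE by (intro borel_measurable_AE[OF m']) (simp only: eq_commute)
    qed
    finally show "(LINT t:{0..}|lebesgue. deriv \<eta> t * state_g (f0 t) (f1 t) (\<lambda>x. p (x + t))) =
        - (LINT t:{0..}|lebesgue. w t * p t * \<eta> t)" .
  qed measurable
  then show ?thesis by simp
qed

text \<open>Trigonometric moments agree because state and profile obey the same evolution formula.
  Density then covers all test functions at the fixed time \<open>t\<close>: the state has finite
  order there and the profile is bounded. \<open>frac_pi\<close> makes the representative periodic,
  as \<open>is_Linfty\<close> demands.\<close>

lemma state_g_is_char_profile:
  assumes ev: "string_evolution u f0 f1"
    and w: "\<And>s. s < 0 \<Longrightarrow> w s = 0" "\<And>s. \<bar>w s\<bar> \<le> 1" "w \<in> borel_measurable borel"
    and h: "\<And>s. \<bar>h s\<bar> \<le> B" "h \<in> borel_measurable borel"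
    and uw: "AE t in lebesgue. 0 \<le> t \<longrightarrow> u t = w t"
    and init: "\<And>\<phi>. \<phi> \<in> torus_test \<Longrightarrow> state_g (f0 0) (f1 0) \<phi> = (LINT x:{0..2 * pi}|lborel. h x * \<phi> x)"
    and t: "0 \<le> t"
  shows "is_Linfty (state_g (f0 t) (f1 t)) (\<lambda>x. char_profile h w (frac_pi x + t))"
proof -
  let ?H = "char_profile h w"
  note [measurable] = w(3) h(2)
  have [measurable]: "?H \<in> borel_measurable borel" by (rule char_profile_measurable) measurable
  have dist: "distribution (f0 t)" "distribution (f1 t)"
    using ev t by (auto simp: string_evolution_def even_distribution_def)
  obtain C where C: "\<And>s. s \<le> t + 2 * pi \<Longrightarrow> \<bar>?H s\<bar> \<le> C"
    using char_profile_locally_bounded[of w h B "t + 2 * pi"] w(1,2) h(1) by blast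
  have "\<bar>?H 0\<bar> \<le> C" by (rule C) (use t pi_gt_zero in linarith)
  then have C0: "0 \<le> C" by linarith
  have trig: "state_g (f0 t) (f1 t) p = (LINT x:{0..2 * pi}|lborel. ?H (x + t) * p x)"
    if p: "trig_poly p" for p
  proof -
    \<comment> \<open>Translated back by \<open>t\<close>, so that the characteristics carry it to
      \<open>p\<close> at time \<open>t\<close>.\<close>
    let ?q = "\<lambda>x. p (x + - t)"
    have q: "trig_poly ?q" by (rule trig_poly_translate[OF p])
    have [measurable]: "p \<in> borel_measurable borel"
      using smooth_continuous_on[OF trig_poly_smooth[OF p]] by (auto intro: borel_measurable_continuous_onI)
    obtain M where M: "\<And>x. \<bar>?q x\<bar> \<le> M" using trig_poly_bounded[OF q] by blast
    have "state_g (f0 t) (f1 t) p = state_g (f0 t) (f1 t) (\<lambda>x. ?q (x + t))" by simp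
    also have "\<dots> = (LINT x:{0..2 * pi}|lborel. h x * ?q x) + (LINT s:{0..t}|lborel. w s * ?q s)"
      unfolding state_g_along_characteristics[OF ev q w(3,2) uw t] init[OF trig_poly_torus_test[OF q]] ..
    also have "\<dots> = (LINT x:{0..2 * pi}|lborel. ?H (x + t) * ?q (x + t))"
      by (rule char_profile_period_integral[symmetric, OF w(1,2) h(1)])
        (use h w trig_poly_periodic[OF q] M t in auto)
    finally show ?thesis by simp
  qed
  have all: "state_g (f0 t) (f1 t) \<phi> = (LINT x:{0..2 * pi}|lborel. ?H (x + t) * \<phi> x)"
    if \<phi>: "\<phi> \<in> torus_test" for \<phi>
  proof -
    have sm: "smooth \<phi>" and per: "\<And>x. \<phi> (x + 2 * pi) = \<phi> x" using \<phi> by (auto simp: torus_test_def)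
    have [measurable]: "\<phi> \<in> borel_measurable borel"
      using smooth_continuous_on[OF sm] by (auto intro: borel_measurable_continuous_onI)
    have "\<bar>state_g (f0 t) (f1 t) \<phi> - (LINT x:{0..2 * pi}|lborel. ?H (x + t) * \<phi> x)\<bar> \<le> e"
      if e: "e > 0" for e
    proof -
      define \<epsilon> where "\<epsilon> = e / (1 + C * (2 * pi))"
      have den: "0 < 1 + C * (2 * pi)" using C0 by (simp add: add_pos_nonneg)
      have \<epsilon>: "\<epsilon> > 0" using den e by (simp add: \<epsilon>_def)
      obtain p where p: "trig_poly p" "\<bar>state_g (f0 t) (f1 t) \<phi> - state_g (f0 t) (f1 t) p\<bar> \<le> \<epsilon>"
        "\<And>x. \<bar>\<phi> x - p x\<bar> \<le> \<epsilon>"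
        using state_g_trig_dense[OF dist \<phi> \<epsilon>] by blast
      obtain M where M: "\<And>x. \<bar>p x\<bar> \<le> M" using trig_poly_bounded[OF p(1)] by blast
      have [measurable]: "p \<in> borel_measurable borel"
        using smooth_continuous_on[OF trig_poly_smooth[OF p(1)]] by (auto intro: borel_measurable_continuous_onI)
      have b1: "\<bar>?H (x + t) * (\<phi> x - p x)\<bar> \<le> C * \<epsilon>" if "x \<in> {0..2 * pi}" for x
        unfolding abs_mult by (intro mult_mono C C0 p) (use that in auto)
      have b2: "\<bar>?H (x + t) * p x\<bar> \<le> C * M" if "x \<in> {0..2 * pi}" for x
        unfolding abs_mult by (intro mult_mono C C0 M) (use that in auto)
      have "(LINT x:{0..2 * pi}|lborel. ?H (x + t) * \<phi> x) =
          (LINT x:{0..2 * pi}|lborel. ?H (x + t) * (\<phi> x - p x) + ?H (x + t) * p x)"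
        by (simp add: right_diff_distrib)
      also have "\<dots> = (LINT x:{0..2 * pi}|lborel. ?H (x + t) * (\<phi> x - p x)) + state_g (f0 t) (f1 t) p"
        unfolding trig[OF p(1)]
        by (intro set_integral_add bounded_borel_set_integrable[OF _ b1] bounded_borel_set_integrable[OF _ b2]) auto
      finally have "\<bar>state_g (f0 t) (f1 t) \<phi> - (LINT x:{0..2 * pi}|lborel. ?H (x + t) * \<phi> x)\<bar> \<le>
          \<epsilon> + \<bar>LINT x:{0..2 * pi}|lborel. ?H (x + t) * (\<phi> x - p x)\<bar>"
        using p(2) by linarith
      also have "\<bar>LINT x:{0..2 * pi}|lborel. ?H (x + t) * (\<phi> x - p x)\<bar> \<le> C * \<epsilon> * (2 * pi - 0)"
        by (rule set_integral_abs_le[OF _ b1]) auto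
      also have "\<epsilon> + C * \<epsilon> * (2 * pi - 0) = (1 + C * (2 * pi)) * \<epsilon>" by (simp add: algebra_simps)
      also have "\<dots> = e" using den by (simp add: \<epsilon>_def)
      finally show ?thesis by simp
    qed
    then have "\<bar>state_g (f0 t) (f1 t) \<phi> - (LINT x:{0..2 * pi}|lborel. ?H (x + t) * \<phi> x)\<bar> \<le> 0"
      by (rule field_le_epsilon) simp
    then show ?thesis by simp
  qed
  show ?thesis
    unfolding is_Linfty_def
  proof (intro conjI ballI allI)
    have "(\<lambda>x. ?H (frac_pi x + t)) \<in> borel_measurable lborel" by measurable
    then show "(\<lambda>x. ?H (frac_pi x + t)) \<in> borel_measurable lebesgue" by (rule measurable_completion)
    show "?H (frac_pi (x + 2 * pi) + t) = ?H (frac_pi x + t)" for x by (simp add: frac_pi_periodic)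
    show "\<exists>B. AE x in lebesgue. \<bar>?H (frac_pi x + t)\<bar> \<le> B"
    proof (intro exI AE_I2)
      fix x show "\<bar>?H (frac_pi x + t)\<bar> \<le> C"
        using frac_pi_bounds[of x] by (intro C) simp
    qed
    fix \<phi> assume \<phi>: "\<phi> \<in> torus_test"
    then have [measurable]: "\<phi> \<in> borel_measurable borel"
      by (auto simp: torus_test_def intro!: borel_measurable_continuous_onI smooth_continuous_on)
    have "state_g (f0 t) (f1 t) \<phi> = (LINT x:{0..2 * pi}|lborel. ?H (frac_pi x + t) * \<phi> x)"
      unfolding all[OF \<phi>]
    proof (rule set_lebesgue_integral_cong_AE)
      show "AE x\<in>{0..2 * pi} in lborel. ?H (x + t) * \<phi> x = ?H (frac_pi x + t) * \<phi> x"
        using AE_lborel_singleton[of "2 * pi"]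
        by eventually_elim (auto simp: frac_pi_eq)
    qed auto
    also have "\<dots> = (LINT x:{0..2 * pi}|lebesgue. ?H (frac_pi x + t) * \<phi> x)"
      by (rule set_integral_lebesgue_lborel[symmetric]) auto
    finally show "state_g (f0 t) (f1 t) \<phi> = (LINT x:{0..2 * pi}|lebesgue. ?H (frac_pi x + t) * \<phi> x)" .
  qed
qed

subsection \<open>The representative of a bounded state and its essential supremum\<close>

lemma is_Linfty_borel_representative:
  assumes "is_Linfty L h"
  shows "\<exists>h' B. h' \<in> borel_measurable borel \<and> (\<forall>x. \<bar>h' x\<bar> \<le> B) \<and> (AE x in lebesgue. h x = h' x) \<and>
    (\<forall>\<phi>\<in>torus_test. L \<phi> = (LINT x:{0..2 * pi}|lborel. h' x * \<phi> x))"
proof -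
  obtain B where h: "h \<in> borel_measurable lebesgue" and B: "AE x in lebesgue. \<bar>h x\<bar> \<le> B"
    and L: "\<And>\<phi>. \<phi> \<in> torus_test \<Longrightarrow> L \<phi> = (LINT x:{0..2 * pi}|lebesgue. h x * \<phi> x)"
    using assms by (auto simp: is_Linfty_def)
  have "AE x in lebesgue. \<bar>h x\<bar> \<le> max B 0" using B by eventually_elim auto
  then obtain h' where h'[measurable]: "h' \<in> borel_measurable borel" and h'B: "\<And>x. \<bar>h' x\<bar> \<le> max B 0"
    and eq: "AE x in lebesgue. h x = h' x"
    using bounded_borel_representative[OF h _ max.cobounded2, of B] by blast
  show ?thesis
  proof (intro exI conjI allI ballI)
    fix \<phi> assume \<phi>: "\<phi> \<in> torus_test"
    then have [measurable]: "\<phi> \<in> borel_measurable borel"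
      by (auto simp: torus_test_def intro!: borel_measurable_continuous_onI smooth_continuous_on)
    have m: "\<phi> \<in> borel_measurable lebesgue" "h' \<in> borel_measurable lebesgue"
      by (auto intro: measurable_completion)
    have "L \<phi> = (LINT x:{0..2 * pi}|lebesgue. h' x * \<phi> x)"
      unfolding L[OF \<phi>]
    proof (rule set_lebesgue_integral_cong_AE)
      show "AE x\<in>{0..2 * pi} in lebesgue. h x * \<phi> x = h' x * \<phi> x"
        using eq by eventually_elim simp
    qed (use h m in \<open>auto intro!: borel_measurable_times\<close>)
    then show "L \<phi> = (LINT x:{0..2 * pi}|lborel. h' x * \<phi> x)"
      by (simp add: set_integral_lebesgue_lborel)
  qed (use h' h'B eq in auto)
qed

lemma is_Linfty_unique:
  assumes "is_Linfty L h" "is_Linfty L k"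
  shows "AE x in lebesgue. x \<in> {0..2 * pi} \<longrightarrow> h x = k x"
proof -
  obtain h' B where h': "h' \<in> borel_measurable borel" "\<And>x. \<bar>h' x\<bar> \<le> B" "AE x in lebesgue. h x = h' x"
    "\<And>\<phi>. \<phi> \<in> torus_test \<Longrightarrow> L \<phi> = (LINT x:{0..2 * pi}|lborel. h' x * \<phi> x)"
    using is_Linfty_borel_representative[OF assms(1)] by blast
  obtain k' C where k': "k' \<in> borel_measurable borel" "\<And>x. \<bar>k' x\<bar> \<le> C" "AE x in lebesgue. k x = k' x"
    "\<And>\<phi>. \<phi> \<in> torus_test \<Longrightarrow> L \<phi> = (LINT x:{0..2 * pi}|lborel. k' x * \<phi> x)"
    using is_Linfty_borel_representative[OF assms(2)] by blast
  note [measurable] = h'(1) k'(1)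
  have "AE x in lborel. x \<in> {0..2 * pi} \<longrightarrow> h' x - k' x = 0"
  proof (rule AE_zero_of_trig_moments)
    show "\<bar>h' x - k' x\<bar> \<le> B + C" for x using h'(2)[of x] k'(2)[of x] by linarith
    fix p assume p: "trig_poly p"
    then have [measurable]: "p \<in> borel_measurable borel"
      by (auto intro!: borel_measurable_continuous_onI smooth_continuous_on trig_poly_smooth)
    obtain M where M: "\<And>x. \<bar>p x\<bar> \<le> M" using trig_poly_bounded[OF p] by blast
    have B0: "0 \<le> B" "0 \<le> C" using order.trans[OF abs_ge_zero h'(2)] order.trans[OF abs_ge_zero k'(2)] .
    have b1: "\<bar>h' x * p x\<bar> \<le> B * M" for x unfolding abs_mult by (intro mult_mono h'(2) M B0) auto
    have b2: "\<bar>k' x * p x\<bar> \<le> C * M" for x unfolding abs_mult by (intro mult_mono k'(2) M B0) auto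
    have "(LINT x:{0..2 * pi}|lborel. (h' x - k' x) * p x) =
        (LINT x:{0..2 * pi}|lborel. h' x * p x) - (LINT x:{0..2 * pi}|lborel. k' x * p x)"
      unfolding left_diff_distrib
      by (intro set_integral_diff(2) bounded_borel_set_integrable[OF _ b1] bounded_borel_set_integrable[OF _ b2]) auto
    also have "\<dots> = 0"
      using h'(4)[OF trig_poly_torus_test[OF p]] k'(4)[OF trig_poly_torus_test[OF p]] by simp
    finally show "(LINT x:{0..2 * pi}|lborel. (h' x - k' x) * p x) = 0" .
  qed measurable
  then show ?thesis
    unfolding AE_lborel_iff using h'(3) k'(3) by eventually_elim auto
qed

lemma rho_eq_esssup:
  assumes "is_Linfty (state_g f0 f1) h"
  shows "rho f0 f1 = ereal (2 * pi) * esssup (lebesgue_on {0..2 * pi}) (\<lambda>x. ereal \<bar>h x\<bar>)"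
  unfolding rho_def
proof (rule INF_eq_const)
  fix k assume "k \<in> {h. is_Linfty (state_g f0 f1) h}"
  then have k: "is_Linfty (state_g f0 f1) k" by simp
  have meas: "(\<lambda>x. ereal \<bar>j x\<bar>) \<in> borel_measurable (lebesgue_on {0..2 * pi})"
    if "is_Linfty (state_g f0 f1) j" for j
  proof -
    have "j \<in> borel_measurable (lebesgue_on {0..2 * pi})"
      using that by (auto simp: is_Linfty_def intro: measurable_restrict_space1)
    then show ?thesis by measurable
  qed
  have "AE x in lebesgue_on {0..2 * pi}. ereal \<bar>k x\<bar> = ereal \<bar>h x\<bar>"
    using is_Linfty_unique[OF k assms] by (auto simp: AE_restrict_space_iff elim: eventually_mono)
  then show "ereal (2 * pi) * esssup (lebesgue_on {0..2 * pi}) (\<lambda>x. ereal \<bar>k x\<bar>) =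
      ereal (2 * pi) * esssup (lebesgue_on {0..2 * pi}) (\<lambda>x. ereal \<bar>h x\<bar>)"
    using esssup_AE_cong[OF meas[OF k] meas[OF assms]] by simp
qed (use assms in auto)

text \<open>Replaces \<open>rho\<close> by a real number characterised as a least almost-everywhere
  bound, so that the estimates avoid extended reals and essential suprema.\<close>

lemma rho_least_bound:
  assumes L: "is_Linfty (state_g f0 f1) h"
  obtains r where "0 \<le> r" "rho f0 f1 = ereal (2 * pi * r)"
    "AE x in lebesgue. x \<in> {0..2 * pi} \<longrightarrow> \<bar>h x\<bar> \<le> r"
    "\<And>c. AE x in lebesgue. x \<in> {0..2 * pi} \<longrightarrow> \<bar>h x\<bar> \<le> c \<Longrightarrow> r \<le> c"
proof -
  let ?M = "lebesgue_on {0..2 * pi}"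
  define E where "E = esssup ?M (\<lambda>x. ereal \<bar>h x\<bar>)"
  have "h \<in> borel_measurable ?M"
    using L by (auto simp: is_Linfty_def intro: measurable_restrict_space1)
  then have [measurable]: "(\<lambda>x. ereal \<bar>h x\<bar>) \<in> borel_measurable ?M" by measurable
  have up: "E \<le> ereal c" if "AE x in lebesgue. x \<in> {0..2 * pi} \<longrightarrow> \<bar>h x\<bar> \<le> c" for c
    unfolding E_def using that by (intro esssup_I) (auto simp: AE_restrict_space_iff)
  obtain B where "AE x in lebesgue. \<bar>h x\<bar> \<le> B" using L by (auto simp: is_Linfty_def)
  then have "E \<le> ereal B" by (intro up) (auto elim: eventually_mono)
  moreover have "0 \<le> E"
  proof -
    \<comment> \<open>Nonnegativity rests on positive measure: over a null space the essential
      supremum would be -\<infinity>.\<close>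
    have "emeasure ?M (space ?M) \<noteq> 0" by (simp add: emeasure_restrict_space)
    then have "0 = esssup ?M (\<lambda>x. 0 :: ereal)" by (rule esssup_const[symmetric])
    also have "\<dots> \<le> E" unfolding E_def by (rule esssup_mono) auto
    finally show ?thesis .
  qed
  ultimately obtain r where r: "E = ereal r" "0 \<le> r" by (cases E) auto
  show ?thesis
  proof
    show "rho f0 f1 = ereal (2 * pi * r)"
      unfolding rho_eq_esssup[OF L] E_def[symmetric] r by simp
    have "AE x in ?M. ereal \<bar>h x\<bar> \<le> ereal r" using esssup_AE[of "\<lambda>x. ereal \<bar>h x\<bar>" ?M] r by (simp add: E_def)
    then show "AE x in lebesgue. x \<in> {0..2 * pi} \<longrightarrow> \<bar>h x\<bar> \<le> r"
      by (simp add: AE_restrict_space_iff)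
    show "r \<le> c" if "AE x in lebesgue. x \<in> {0..2 * pi} \<longrightarrow> \<bar>h x\<bar> \<le> c" for c
      using up[OF that] r by simp
  qed (rule r)
qed

subsection \<open>Crossing the origin\<close>

text \<open>\<open>w\<close> and \<open>h\<close> are everywhere bounded Borel versions of the
  control and the initial state, tied to the given data by \<open>uw\<close> and
  \<open>init\<close>. With \<open>w\<close> zero at negative times, a characteristic has no jumps
  before time 0.\<close>

locale string_profile =
  fixes u w h :: "real \<Rightarrow> real" and f0 f1 :: "real \<Rightarrow> (real \<Rightarrow> real) \<Rightarrow> real" and B :: real
  assumes ev: "string_evolution u f0 f1"
    and w_neg: "s < 0 \<Longrightarrow> w s = 0" and w_le: "\<bar>w s\<bar> \<le> 1" and w_borel[measurable]: "w \<in> borel_measurable borel"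
    and h_le: "\<bar>h s\<bar> \<le> B" and h_borel[measurable]: "h \<in> borel_measurable borel"
    and uw: "AE t in lebesgue. 0 \<le> t \<longrightarrow> u t = w t"
    and init: "\<phi> \<in> torus_test \<Longrightarrow> state_g (f0 0) (f1 0) \<phi> = (LINT x:{0..2 * pi}|lborel. h x * \<phi> x)"
begin

definition H :: "real \<Rightarrow> real" where "H = char_profile h w"

lemma H_borel[measurable]: "H \<in> borel_measurable borel"
  unfolding H_def by (rule char_profile_measurable) measurable

lemma H_step: "H (s + 2 * pi) = H s + w s"
  unfolding H_def by (rule char_profile_step) (rule w_neg)

lemma H_bounded: "\<exists>C. \<forall>s\<le>R. \<bar>H s\<bar> \<le> C"
  unfolding H_def by (rule char_profile_locally_bounded) (rule w_neg w_le h_le, assumption?)+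

lemma H_represents: "0 \<le> t \<Longrightarrow> is_Linfty (state_g (f0 t) (f1 t)) (\<lambda>x. H (frac_pi x + t))"
  unfolding H_def
  by (rule state_g_is_char_profile[OF ev]) (use w_neg w_le w_borel h_le h_borel uw init in auto)

lemma H_ge: "\<bar>H s\<bar> \<le> \<bar>H (s + 2 * pi * real n)\<bar> + real n"
proof (induction n)
  case (Suc n)
  have "H (s + 2 * pi * real (Suc n)) = H (s + 2 * pi * real n) + w (s + 2 * pi * real n)"
    using H_step[of "s + 2 * pi * real n"] by (simp add: algebra_simps)
  then show ?case using Suc w_le[of "s + 2 * pi * real n"] by simp
qed simp

text \<open>The characteristic starting at \<open>y\<close> enters the window [T, T + 2 pi) after
  fewer than T/(2 pi) + 1 passages, each of which lowers the absolute value by at most 1.\<close>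

lemma sup_lower_bound:
  assumes T: "0 \<le> T"
    and r0: "\<And>c. AE x in lebesgue. x \<in> {0..2 * pi} \<longrightarrow> \<bar>H (frac_pi x + 0)\<bar> \<le> c \<Longrightarrow> r0 \<le> c"
    and rT: "AE x in lebesgue. x \<in> {0..2 * pi} \<longrightarrow> \<bar>H (frac_pi x + T)\<bar> \<le> rT"
  shows "r0 \<le> rT + T / (2 * pi) + 1"
proof (rule r0)
  have "AE y in lebesgue. y + (2 * pi * real n - T) \<in> {0..2 * pi} \<longrightarrow>
      \<bar>H (frac_pi (y + (2 * pi * real n - T)) + T)\<bar> \<le> rT" for n
    by (rule AE_lebesgue_translate[OF rT])
  \<comment> \<open>The number of passages depends on \<open>y\<close>, so the exceptional sets of
    all \<open>n\<close> are united beforehand.\<close>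
  then have "AE y in lebesgue. \<forall>n. y + (2 * pi * real n - T) \<in> {0..2 * pi} \<longrightarrow>
      \<bar>H (frac_pi (y + (2 * pi * real n - T)) + T)\<bar> \<le> rT"
    by (simp add: AE_all_countable)
  moreover have "AE y in lebesgue. y \<noteq> 2 * pi"
    using AE_lborel_singleton[of "2 * pi"] by (simp add: AE_lborel_iff)
  ultimately show "AE y in lebesgue. y \<in> {0..2 * pi} \<longrightarrow> \<bar>H (frac_pi y + 0)\<bar> \<le> rT + T / (2 * pi) + 1"
  proof eventually_elim
    case (elim y)
    show ?case
    proof
      assume "y \<in> {0..2 * pi}"
      then have y: "0 \<le> y" "y < 2 * pi" using elim(2) by auto
      define n where "n = nat \<lceil>(T - y) / (2 * pi)\<rceil>"
      \<comment> \<open>This makes the ceiling nonnegative, so \<open>nat\<close> loses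
        nothing.\<close>
      have "(T - y) / (2 * pi) > - 1" using T y by (simp add: field_simps)
      then have "real n = of_int \<lceil>(T - y) / (2 * pi)\<rceil>" by (simp add: n_def)
      then have n: "(T - y) / (2 * pi) \<le> real n" "real n < (T - y) / (2 * pi) + 1" by linarith+
      have n': "T - y \<le> 2 * pi * real n" "2 * pi * real n < T - y + 2 * pi"
        using n by (simp_all add: field_simps)
      have "\<bar>H y\<bar> \<le> \<bar>H (y + 2 * pi * real n)\<bar> + real n" by (rule H_ge)
      also have "y + 2 * pi * real n = frac_pi (y + (2 * pi * real n - T)) + T"
        using n' by (subst frac_pi_eq) auto
      also have "\<bar>H \<dots>\<bar> \<le> rT" using elim(1) n' by simp
      also have "real n \<le> T / (2 * pi) + 1" using n(2) y by (simp add: diff_divide_distrib, smt (verit) divide_nonneg_pos pi_gt_zero)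
      finally show "\<bar>H (frac_pi y + 0)\<bar> \<le> rT + T / (2 * pi) + 1"
        using y by (simp add: frac_pi_eq)
    qed
  qed
qed

text \<open>Here characteristics are followed back from the window at time \<open>T\<close> to the
  first period, across more than T/(2 pi) - 1 passages. The alternative 1/2 is stable under
  iteration of \<open>fric\<close>.\<close>

lemma sup_upper_bound:
  assumes T: "0 \<le> T"
    and fric: "AE t in lebesgue. t \<in> {0..T} \<longrightarrow> \<bar>H (t + 2 * pi)\<bar> \<le> max (\<bar>H t\<bar> - 1) (1 / 2)"
    and r0: "AE x in lebesgue. x \<in> {0..2 * pi} \<longrightarrow> \<bar>H (frac_pi x + 0)\<bar> \<le> r0"
    and rT: "\<And>c. AE x in lebesgue. x \<in> {0..2 * pi} \<longrightarrow> \<bar>H (frac_pi x + T)\<bar> \<le> c \<Longrightarrow> rT \<le> c"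
  shows "rT \<le> max (r0 - T / (2 * pi) + 1) (1 / 2)"
proof (rule rT)
  have "AE x in lebesgue. \<forall>n. x + 2 * pi * real n \<in> {0..T} \<longrightarrow>
      \<bar>H (x + 2 * pi * real n + 2 * pi)\<bar> \<le> max (\<bar>H (x + 2 * pi * real n)\<bar> - 1) (1 / 2)"
    using AE_lebesgue_translate[OF fric] by (simp add: AE_all_countable)
  with r0 have "AE x in lebesgue. (x \<in> {0..2 * pi} \<longrightarrow> \<bar>H (frac_pi x + 0)\<bar> \<le> r0) \<and>
      (\<forall>n. x + 2 * pi * real n \<in> {0..T} \<longrightarrow>
      \<bar>H (x + 2 * pi * real n + 2 * pi)\<bar> \<le> max (\<bar>H (x + 2 * pi * real n)\<bar> - 1) (1 / 2))"
    by eventually_elim blast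
  \<comment> \<open>A position of at most T + 2 pi after \<open>n\<close> passages means that the
    last passage happened no later than \<open>T\<close>, where \<open>fric\<close> applies.\<close>
  then have "AE x in lebesgue. x \<in> {0..<2 * pi} \<longrightarrow> (\<forall>n. x + 2 * pi * real n \<le> T + 2 * pi \<longrightarrow>
      \<bar>H (x + 2 * pi * real n)\<bar> \<le> max (r0 - real n) (1 / 2))"
  proof eventually_elim
    case (elim x)
    show ?case
    proof (intro impI allI)
      fix n assume x: "x \<in> {0..<2 * pi}" and n: "x + 2 * pi * real n \<le> T + 2 * pi"
      then show "\<bar>H (x + 2 * pi * real n)\<bar> \<le> max (r0 - real n) (1 / 2)"
      proof (induction n)
        case 0
        then show ?case using elim frac_pi_eq[of x] by auto
      next
        case (Suc n)
        have eq: "x + 2 * pi * real (Suc n) = x + 2 * pi * real n + 2 * pi" by (simp add: algebra_simps)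
        have "x + 2 * pi * real n \<in> {0..T}" using Suc.prems unfolding eq by auto
        then have "\<bar>H (x + 2 * pi * real (Suc n))\<bar> \<le> max (\<bar>H (x + 2 * pi * real n)\<bar> - 1) (1 / 2)"
          unfolding eq using elim by blast
        moreover have "\<bar>H (x + 2 * pi * real n)\<bar> \<le> max (r0 - real n) (1 / 2)"
          using Suc eq pi_gt_zero by simp
        ultimately show ?case by auto
      qed
    qed
  qed
  then have "AE y in lebesgue. y + (T - 2 * pi * real n) \<in> {0..<2 * pi} \<longrightarrow>
      (\<forall>m. y + (T - 2 * pi * real n) + 2 * pi * real m \<le> T + 2 * pi \<longrightarrow>
      \<bar>H (y + (T - 2 * pi * real n) + 2 * pi * real m)\<bar> \<le> max (r0 - real m) (1 / 2))" for n
    by (rule AE_lebesgue_translate)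
  then have "AE y in lebesgue. \<forall>n. y + (T - 2 * pi * real n) \<in> {0..<2 * pi} \<longrightarrow>
      (\<forall>m. y + (T - 2 * pi * real n) + 2 * pi * real m \<le> T + 2 * pi \<longrightarrow>
      \<bar>H (y + (T - 2 * pi * real n) + 2 * pi * real m)\<bar> \<le> max (r0 - real m) (1 / 2))"
    by (simp only: AE_all_countable) blast
  moreover have "AE y in lebesgue. y \<noteq> 2 * pi"
    using AE_lborel_singleton[of "2 * pi"] by (simp add: AE_lborel_iff)
  ultimately show "AE y in lebesgue. y \<in> {0..2 * pi} \<longrightarrow>
      \<bar>H (frac_pi y + T)\<bar> \<le> max (r0 - T / (2 * pi) + 1) (1 / 2)"
  proof eventually_elim
    case (elim y)
    show ?case
    proof
      assume "y \<in> {0..2 * pi}"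
      then have y: "0 \<le> y" "y < 2 * pi" using elim(2) by auto
      define n where "n = nat \<lfloor>(y + T) / (2 * pi)\<rfloor>"
      have "0 \<le> (y + T) / (2 * pi)" using T y by simp
      then have "real n = of_int \<lfloor>(y + T) / (2 * pi)\<rfloor>" by (simp add: n_def)
      then have n: "real n \<le> (y + T) / (2 * pi)" "(y + T) / (2 * pi) < real n + 1" by linarith+
      have n': "2 * pi * real n \<le> y + T" "y + T < 2 * pi * real n + 2 * pi"
        using n by (simp_all add: field_simps)
      have "y + (T - 2 * pi * real n) \<in> {0..<2 * pi}" using n' by auto
      moreover have "y + (T - 2 * pi * real n) + 2 * pi * real n \<le> T + 2 * pi" using y by simp
      ultimately have "\<bar>H (y + (T - 2 * pi * real n) + 2 * pi * real n)\<bar> \<le> max (r0 - real n) (1 / 2)"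
        using elim(1) by blast
      moreover have "y + (T - 2 * pi * real n) + 2 * pi * real n = frac_pi y + T"
        using y by (simp add: frac_pi_eq)
      moreover have "T / (2 * pi) \<le> (y + T) / (2 * pi)" using y by (simp add: divide_right_mono)
      then have "r0 - real n \<le> r0 - T / (2 * pi) + 1" using n(2) by linarith
      ultimately show "\<bar>H (frac_pi y + T)\<bar> \<le> max (r0 - T / (2 * pi) + 1) (1 / 2)" by auto
    qed
  qed
qed

end

subsection \<open>Dry friction\<close>

lemma Sign_subset: "Sign y \<subseteq> {- 1..1}"
  by (auto simp: Sign_def)

text \<open>If the half-sum a + w/2 is positive, then w = -1 and a > 1/2, so b = a - 1 either has
  absolute value \<bar>a\<bar> - 1 or lies between -1/2 and 0; the negative case is symmetric. If
  the half-sum is 0, then b = -a, and \<bar>w\<bar> \<le> 1 forces \<bar>a\<bar> \<le> 1/2.\<close>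

lemma friction_jump:
  assumes "- w \<in> Sign ((a + b) / 2)" "b = a + w"
  shows "\<bar>b\<bar> \<le> max (\<bar>a\<bar> - 1) (1 / 2)"
  using assms by (auto simp: Sign_def abs_if split: if_splits)

text \<open>Passes from the arbitrary representative \<open>k\<close> in the definition of a trace
  to the Borel function \<open>K\<close>: the mean of \<open>K\<close> deviates from
  \<open>p\<close> by at most the mean of \<bar>k - p\<bar>.\<close>

lemma average_tendsto_of_trace:
  fixes k K :: "real \<Rightarrow> real" and \<alpha> \<beta> :: "nat \<Rightarrow> real"
  assumes trace: "(\<lambda>n. (LINT x:{\<alpha> n..\<beta> n}|lebesgue. \<bar>k x - p\<bar>) * real (Suc n)) \<longlonglongrightarrow> 0"
    and len: "\<And>n. \<beta> n - \<alpha> n = 1 / real (Suc n)"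
    and eq: "\<And>n. AE x in lebesgue. x \<in> {\<alpha> n..\<beta> n} \<longrightarrow> k x = K x"
    and k: "k \<in> borel_measurable lebesgue" and K[measurable]: "K \<in> borel_measurable borel"
    and C: "\<And>n x. x \<in> {\<alpha> n..\<beta> n} \<Longrightarrow> \<bar>K x\<bar> \<le> C"
  shows "(\<lambda>n. real (Suc n) * (LINT x:{\<alpha> n..\<beta> n}|lborel. K x)) \<longlonglongrightarrow> p"
proof -
  have "(\<lambda>n. real (Suc n) * (LINT x:{\<alpha> n..\<beta> n}|lborel. K x) - p) \<longlonglongrightarrow> 0"
  proof (rule Lim_null_comparison[OF _ trace], intro always_eventually allI)
    fix n
    let ?A = "{\<alpha> n..\<beta> n}"
    have le: "\<alpha> n \<le> \<beta> n" using len[of n] by (smt (verit) divide_nonneg_nonneg of_nat_0_le_iff)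
    have int: "set_integrable lborel ?A K"
      by (rule bounded_borel_set_integrable[OF K C])
    have intp: "set_integrable lborel ?A (\<lambda>x. p)"
      by (rule borel_integrable_atLeastAtMost') simp
    have "(LINT x:?A|lborel. K x - p) = (LINT x:?A|lborel. K x) - p * (\<beta> n - \<alpha> n)"
      using le by (simp add: set_integral_diff(2)[OF int intp] set_integral_const)
    then have "real (Suc n) * (LINT x:?A|lborel. K x) - p = real (Suc n) * (LINT x:?A|lborel. K x - p)"
      unfolding len by (simp add: right_diff_distrib)
    also have "norm \<dots> \<le> real (Suc n) * (LINT x:?A|lborel. \<bar>K x - p\<bar>)"
      unfolding set_lebesgue_integral_def real_norm_def abs_mult abs_of_nat
      by (intro mult_left_mono order.trans[OF integral_abs_bound]) (simp_all add: abs_mult)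
    also have "(LINT x:?A|lborel. \<bar>K x - p\<bar>) = (LINT x:?A|lebesgue. \<bar>K x - p\<bar>)"
      by (rule set_integral_lebesgue_lborel[symmetric]) auto
    also have "\<dots> = (LINT x:?A|lebesgue. \<bar>k x - p\<bar>)"
    proof (rule set_lebesgue_integral_cong_AE)
      have "(\<lambda>x. \<bar>K x - p\<bar>) \<in> borel_measurable lborel" by measurable
      then show "(\<lambda>x. \<bar>K x - p\<bar>) \<in> borel_measurable lebesgue" by (rule measurable_completion)
      show "(\<lambda>x. \<bar>k x - p\<bar>) \<in> borel_measurable lebesgue" using k by measurable
      show "AE x\<in>?A in lebesgue. \<bar>K x - p\<bar> = \<bar>k x - p\<bar>" using eq[of n] by eventually_elim auto
    qed simp
    finally show "norm (real (Suc n) * (LINT x:?A|lborel. K x) - p) \<le>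
        (LINT x:?A|lebesgue. \<bar>k x - p\<bar>) * real (Suc n)"
      by (simp add: mult.commute)
  qed
  then show ?thesis by (rule LIM_zero_cancel)
qed

lemma reciprocal_at_right_0: "filterlim (\<lambda>n. 1 / real (Suc n)) (at_right 0) sequentially"
  unfolding filterlim_at
  using LIMSEQ_Suc[OF lim_const_over_n[of 1]] by (auto simp: eventually_sequentially)

context string_profile
begin

text \<open>Characteristics run to the left, so points just right of the origin have yet to cross
  it: the right trace at time \<open>t\<close> sees the profile at \<open>t\<close>, before the
  jump.\<close>

lemma right_trace_average:
  assumes t: "0 \<le> t" and tr: "right_trace (state_g (f0 t) (f1 t)) p"
  shows "(\<lambda>n. real (Suc n) * (LINT s:{t..t + 1 / real (Suc n)}|lborel. H s)) \<longlonglongrightarrow> p"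
proof -
  obtain k where k: "is_Linfty (state_g (f0 t) (f1 t)) k"
    and lim: "((\<lambda>\<epsilon>. (LINT x:{0..\<epsilon>}|lebesgue. \<bar>k x - p\<bar>) / \<epsilon>) \<longlongrightarrow> 0) (at_right 0)"
    using tr by (auto simp: right_trace_def)
  obtain C where C: "\<And>s. s \<le> t + 2 * pi \<Longrightarrow> \<bar>H s\<bar> \<le> C" using H_bounded by blast
  have small: "1 / real (Suc n) < 2 * pi" for n
  proof -
    have "1 / real (Suc n) \<le> 1 / 1" by (intro divide_left_mono) auto
    then show ?thesis using pi_gt3 by linarith
  qed
  have "(\<lambda>n. real (Suc n) * (LINT x:{0..1 / real (Suc n)}|lborel. H (x + t))) \<longlonglongrightarrow> p"
  proof (rule average_tendsto_of_trace[where k = k])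
    show "(\<lambda>n. (LINT x:{0..1 / real (Suc n)}|lebesgue. \<bar>k x - p\<bar>) * real (Suc n)) \<longlonglongrightarrow> 0"
      using filterlim_compose[OF lim reciprocal_at_right_0] by simp
    show "AE x in lebesgue. x \<in> {0..1 / real (Suc n)} \<longrightarrow> k x = H (x + t)" for n
      using is_Linfty_unique[OF k H_represents[OF t]]
    proof eventually_elim
      case (elim x)
      then show ?case using small[of n] by (auto simp: frac_pi_eq)
    qed
    show "k \<in> borel_measurable lebesgue" using k by (simp add: is_Linfty_def)
    show "\<bar>H (x + t)\<bar> \<le> C" if "x \<in> {0..1 / real (Suc n)}" for n x
      using that small[of n] by (intro C) auto
  qed auto
  then show ?thesis by (simp add: set_integral_translate add.commute)
qed

text \<open>By periodicity, just left of the origin is just left of 2 pi: the left trace sees the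
  profile at t + 2 pi, after the jump.\<close>

lemma left_trace_average:
  assumes t: "0 \<le> t" and tr: "left_trace (state_g (f0 t) (f1 t)) m"
  shows "(\<lambda>n. real (Suc n) * (LINT s:{t - 1 / real (Suc n)..t}|lborel. H (s + 2 * pi))) \<longlonglongrightarrow> m"
proof -
  obtain k where k: "is_Linfty (state_g (f0 t) (f1 t)) k"
    and lim: "((\<lambda>\<epsilon>. (LINT x:{- \<epsilon>..0}|lebesgue. \<bar>k x - m\<bar>) / \<epsilon>) \<longlongrightarrow> 0) (at_right 0)"
    using tr by (auto simp: left_trace_def)
  obtain C where C: "\<And>s. s \<le> t + 2 * pi \<Longrightarrow> \<bar>H s\<bar> \<le> C" using H_bounded by blast
  have small: "1 / real (Suc n) < 2 * pi" for n
  proof -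
    have "1 / real (Suc n) \<le> 1 / 1" by (intro divide_left_mono) auto
    then show ?thesis using pi_gt3 by linarith
  qed
  have per: "k (x + 2 * pi) = k x" for x using k by (simp add: is_Linfty_def)
  have "(\<lambda>n. real (Suc n) * (LINT x:{- (1 / real (Suc n))..0}|lborel. H (x + t + 2 * pi))) \<longlonglongrightarrow> m"
  proof (rule average_tendsto_of_trace[where k = k])
    show "(\<lambda>n. (LINT x:{- (1 / real (Suc n))..0}|lebesgue. \<bar>k x - m\<bar>) * real (Suc n)) \<longlonglongrightarrow> 0"
      using filterlim_compose[OF lim reciprocal_at_right_0] by simp
    have "AE x in lebesgue. x \<noteq> (0::real)"
      using AE_lborel_singleton[of "0::real"] by (simp add: AE_lborel_iff)
    with AE_lebesgue_translate[OF is_Linfty_unique[OF k H_represents[OF t]], of "2 * pi"]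
    show "AE x in lebesgue. x \<in> {- (1 / real (Suc n))..0} \<longrightarrow> k x = H (x + t + 2 * pi)" for n
    proof eventually_elim
      case (elim x)
      show ?case
      proof
        assume "x \<in> {- (1 / real (Suc n))..0}"
        then have "0 \<le> x + 2 * pi" "x + 2 * pi < 2 * pi" using elim(2) small[of n] by auto
        then show "k x = H (x + t + 2 * pi)"
          using elim(1) by (simp add: per frac_pi_eq[of "x + 2 * pi"] add_ac)
      qed
    qed
    show "k \<in> borel_measurable lebesgue" using k by (simp add: is_Linfty_def)
    show "\<bar>H (x + t + 2 * pi)\<bar> \<le> C" if "x \<in> {- (1 / real (Suc n))..0}" for n x
      using that by (intro C) auto
  qed auto
  moreover have "(LINT x:{- (1 / real (Suc n))..0}|lborel. H (x + t + 2 * pi)) =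
      (LINT s:{t - 1 / real (Suc n)..t}|lborel. H (s + 2 * pi))" for n
    using set_integral_translate[of "- (1 / real (Suc n))" 0 "\<lambda>s. H (s + 2 * pi)" t] by (simp add: add.commute)
  ultimately show ?thesis by simp
qed

text \<open>\<open>average_limit_AE\<close> asks for a globally bounded function, while the profile
  is bounded on half-lines to the left. Truncation changes nothing up to T + 1, which covers all
  windows because c \<le> 0.\<close>

lemma trace_AE_eq:
  assumes lim: "AE t in lebesgue. t \<in> {0..T} \<longrightarrow>
      (\<lambda>n. real (Suc n) * (LINT s:{t + c / real (Suc n)..t + (c + 1) / real (Suc n)}|lborel. H (s + d))) \<longlonglongrightarrow> q t"
    and c: "c \<le> 0"
  shows "AE t in lebesgue. t \<in> {0..T} \<longrightarrow> q t = H (t + d)"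
proof -
  obtain C' where C': "\<And>s. s \<le> T + 1 + d \<Longrightarrow> \<bar>H s\<bar> \<le> C'" using H_bounded by blast
  define C where "C = max C' 0"
  have C: "\<bar>H s\<bar> \<le> C" if "s \<le> T + 1 + d" for s using C'[OF that] by (simp add: C_def)
  define f where "f s = max (- C) (min C (H (s + d)))" for s
  have f: "f s = H (s + d)" if "s \<le> T + 1" for s using C[of "s + d"] that by (auto simp: f_def)
  have [measurable]: "f \<in> borel_measurable borel" unfolding f_def by measurable
  have "AE t in lborel. t \<in> {0..T} \<longrightarrow> q t = f t"
  proof (rule average_limit_AE[where c = c and B = C])
    show "\<bar>f s\<bar> \<le> C" for s by (auto simp: f_def C_def)
    show "AE t in lborel. t \<in> {0..T} \<longrightarrow>
      (\<lambda>n. real (Suc n) * (LINT s:{t + c / real (Suc n)..t + (c + 1) / real (Suc n)}|lborel. f s)) \<longlonglongrightarrow> q t"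
      unfolding AE_lborel_iff using lim
    proof eventually_elim
      case (elim t)
      show ?case
      proof
        assume t: "t \<in> {0..T}"
        have "(LINT s:{t + c / real (Suc n)..t + (c + 1) / real (Suc n)}|lborel. f s) =
          (LINT s:{t + c / real (Suc n)..t + (c + 1) / real (Suc n)}|lborel. H (s + d))" for n
        proof (rule set_lebesgue_integral_cong)
          have "(c + 1) / real (Suc n) \<le> 1 / 1" by (rule frac_le) (use c in auto)
          then have "s \<le> T + 1" if "s \<in> {t + c / real (Suc n)..t + (c + 1) / real (Suc n)}" for s
            using that t unfolding atLeastAtMost_iff by linarith
          then show "\<forall>s. s \<in> {t + c / real (Suc n)..t + (c + 1) / real (Suc n)} \<longrightarrow> f s = H (s + d)"
            using f by blast
        qed simp
        then show "(\<lambda>n. real (Suc n) * (LINT s:{t + c / real (Suc n)..t + (c + 1) / real (Suc n)}|lborel. f s)) \<longlonglongrightarrow> q t"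
          using elim t by simp
      qed
    qed
  qed measurable
  then show ?thesis unfolding AE_lborel_iff by eventually_elim (use f in auto)
qed

text \<open>Once the traces are identified with the values before and after the jump, the feedback
  law is the implicit relation of \<open>friction_jump\<close>.\<close>

lemma dry_friction_decay:
  assumes fric: "dry_friction u f0 f1"
  shows "AE t in lebesgue. t \<in> {0..T} \<longrightarrow> \<bar>H (t + 2 * pi)\<bar> \<le> max (\<bar>H t\<bar> - 1) (1 / 2)"
proof -
  define P where "P t z \<longleftrightarrow> right_trace (state_g (f0 t) (f1 t)) (fst z) \<and>
    left_trace (state_g (f0 t) (f1 t)) (snd z) \<and> - u t \<in> Sign ((fst z + snd z) / 2)" for t z
  \<comment> \<open>An arbitrary choice of traces is enough, since \<open>average_limit_AE\<close>
    constructs a measurable limit itself.\<close>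
  define z where "z t = (SOME z. P t z)" for t
  have "AE t in lebesgue. 0 \<le> t \<longrightarrow> (\<exists>z. P t z)"
    using fric by (auto simp: dry_friction_def AE_restrict_space_iff P_def)
  then have z: "AE t in lebesgue. 0 \<le> t \<longrightarrow> P t (z t)"
    by eventually_elim (auto simp: z_def intro: someI_ex)
  \<comment> \<open>Averaging windows to the right of \<open>t\<close> have c = 0; those to the
    left, used for the second trace, have c = -1.\<close>
  have "AE t in lebesgue. t \<in> {0..T} \<longrightarrow> fst (z t) = H (t + 0)"
  proof (rule trace_AE_eq[where c = 0])
    show "AE t in lebesgue. t \<in> {0..T} \<longrightarrow> (\<lambda>n. real (Suc n) *
        (LINT s:{t + 0 / real (Suc n)..t + (0 + 1) / real (Suc n)}|lborel. H (s + 0))) \<longlonglongrightarrow> fst (z t)"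
      using z by eventually_elim (use right_trace_average in \<open>auto simp: P_def\<close>)
  qed simp
  moreover have "AE t in lebesgue. t \<in> {0..T} \<longrightarrow> snd (z t) = H (t + 2 * pi)"
  proof (rule trace_AE_eq[where c = "- 1"])
    show "AE t in lebesgue. t \<in> {0..T} \<longrightarrow> (\<lambda>n. real (Suc n) *
        (LINT s:{t + - 1 / real (Suc n)..t + (- 1 + 1) / real (Suc n)}|lborel. H (s + 2 * pi))) \<longlonglongrightarrow> snd (z t)"
      using z by eventually_elim (use left_trace_average in \<open>auto simp: P_def\<close>)
  qed simp
  ultimately show ?thesis using z uw
  proof eventually_elim
    case (elim t)
    show ?case
    proof
      assume t: "t \<in> {0..T}"
      then have "- w t \<in> Sign ((H t + H (t + 2 * pi)) / 2)"
        using elim by (auto simp: P_def)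
      then show "\<bar>H (t + 2 * pi)\<bar> \<le> max (\<bar>H t\<bar> - 1) (1 / 2)"
        by (rule friction_jump) (rule H_step)
    qed
  qed
qed

end

section \<open>From the profile to the two estimates\<close>

lemma string_profile_exists:
  assumes ev: "string_evolution u f0 f1" and fin: "rho (f0 0) (f1 0) < \<infinity>"
    and u: "u \<in> borel_measurable (lebesgue_on {0..})" "AE t in lebesgue. 0 \<le> t \<longrightarrow> \<bar>u t\<bar> \<le> 1"
  shows "\<exists>w h B. string_profile u w h f0 f1 B"
proof -
  obtain k where k: "is_Linfty (state_g (f0 0) (f1 0)) k"
  proof (rule ccontr)
    assume "\<not> thesis"
    then have "{h. is_Linfty (state_g (f0 0) (f1 0)) h} = {}" using that by blast
    then show False using fin by (simp add: rho_def top_ereal_def)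
  qed
  obtain h B where h: "h \<in> borel_measurable borel" "\<And>x. \<bar>h x\<bar> \<le> B"
    "\<And>\<phi>. \<phi> \<in> torus_test \<Longrightarrow> state_g (f0 0) (f1 0) \<phi> = (LINT x:{0..2 * pi}|lborel. h x * \<phi> x)"
    using is_Linfty_borel_representative[OF k] by blast
  \<comment> \<open>Extension by 0 gives a Lebesgue measurable function on the whole line, which has
    a bounded Borel version.\<close>
  let ?u = "\<lambda>t. if t \<in> {0..} then u t else 0"
  have "?u \<in> borel_measurable lebesgue"
    by (rule borel_measurable_if_I[OF u(1)]) simp
  moreover have "AE t in lebesgue. \<bar>?u t\<bar> \<le> 1" using u(2) by eventually_elim auto
  ultimately obtain v where v[measurable]: "v \<in> borel_measurable borel" and v1: "\<And>t. \<bar>v t\<bar> \<le> 1"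
    and eq: "AE t in lebesgue. ?u t = v t"
    using bounded_borel_representative[of ?u 1] by auto
  have "string_profile u (\<lambda>t. if t < 0 then 0 else v t) h f0 f1 B"
  proof
    show "AE t in lebesgue. 0 \<le> t \<longrightarrow> u t = (if t < 0 then 0 else v t)"
      using eq by eventually_elim auto
  qed (use ev h v1 in auto)
  then show ?thesis by blast
qed

text \<open>Serves both claims: the control is bounded almost everywhere, which friction provides as
  well, and friction is a premise of the lower estimate alone. The error 2 pi is one passage more or
  less, times the factor 2 pi in \<open>rho\<close>.\<close>

lemma admissible_decrease_le:
  assumes ev: "string_evolution u f0 f1" and fin: "rho (f0 0) (f1 0) < \<infinity>" and T: "0 < T"
    and u: "u \<in> borel_measurable (lebesgue_on {0..})" "AE t in lebesgue. 0 \<le> t \<longrightarrow> \<bar>u t\<bar> \<le> 1"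
  shows "\<exists>a b. rho (f0 0) (f1 0) = ereal a \<and> rho (f0 T) (f1 T) = ereal b \<and> a - b \<le> T + 2 * pi \<and>
    (dry_friction u f0 f1 \<longrightarrow> 2 * pi \<le> b \<longrightarrow> T - 2 * pi \<le> a - b)"
proof -
  obtain w h B where "string_profile u w h f0 f1 B"
    using string_profile_exists[OF ev fin u] by blast
  then interpret string_profile u w h f0 f1 B .
  obtain r0 where r0: "0 \<le> r0" "rho (f0 0) (f1 0) = ereal (2 * pi * r0)"
    "AE x in lebesgue. x \<in> {0..2 * pi} \<longrightarrow> \<bar>H (frac_pi x + 0)\<bar> \<le> r0"
    "\<And>c. AE x in lebesgue. x \<in> {0..2 * pi} \<longrightarrow> \<bar>H (frac_pi x + 0)\<bar> \<le> c \<Longrightarrow> r0 \<le> c"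
    by (rule rho_least_bound[OF H_represents[of 0]]) simp_all
  obtain rT where rT: "0 \<le> rT" "rho (f0 T) (f1 T) = ereal (2 * pi * rT)"
    "AE x in lebesgue. x \<in> {0..2 * pi} \<longrightarrow> \<bar>H (frac_pi x + T)\<bar> \<le> rT"
    "\<And>c. AE x in lebesgue. x \<in> {0..2 * pi} \<longrightarrow> \<bar>H (frac_pi x + T)\<bar> \<le> c \<Longrightarrow> rT \<le> c"
    by (rule rho_least_bound[OF H_represents[of T]]) (use T in simp_all)
  show ?thesis
  proof (intro exI conjI impI)
    show "rho (f0 0) (f1 0) = ereal (2 * pi * r0)" "rho (f0 T) (f1 T) = ereal (2 * pi * rT)"
      by fact+
    have "r0 \<le> rT + T / (2 * pi) + 1"
      by (rule sup_lower_bound[OF _ r0(4) rT(3)]) (use T in simp)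
    then have "2 * pi * r0 \<le> 2 * pi * (rT + T / (2 * pi) + 1)" by (rule mult_left_mono) simp
    then show "2 * pi * r0 - 2 * pi * rT \<le> T + 2 * pi" by (simp add: distrib_left)
  next
    assume fric: "dry_friction u f0 f1" and M: "2 * pi \<le> 2 * pi * rT"
    \<comment> \<open>A supremum of at least 1 at time \<open>T\<close> rules out the alternative
      1/2 of \<open>sup_upper_bound\<close>.\<close>
    have "1 \<le> rT" using M by simp
    moreover have "rT \<le> max (r0 - T / (2 * pi) + 1) (1 / 2)"
      by (rule sup_upper_bound[OF _ dry_friction_decay[OF fric] r0(3) rT(4)]) (use T in simp)
    ultimately have "rT \<le> r0 - T / (2 * pi) + 1" by simp
    then have "2 * pi * rT \<le> 2 * pi * (r0 - T / (2 * pi) + 1)" by (rule mult_left_mono) simp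
    then show "T - 2 * pi \<le> 2 * pi * r0 - 2 * pi * rT" by (simp add: distrib_left right_diff_distrib)
  qed
qed

lemma dry_friction_le_1:
  assumes "dry_friction u f0 f1"
  shows "AE t in lebesgue. 0 \<le> t \<longrightarrow> \<bar>u t\<bar> \<le> 1"
proof -
  have "AE t in lebesgue. 0 \<le> t \<longrightarrow> (\<exists>y. - u t \<in> Sign y)"
    using assms by (auto simp: dry_friction_def AE_restrict_space_iff elim!: eventually_mono)
  then show ?thesis
  proof eventually_elim
    case (elim t)
    show ?case
    proof
      assume "0 \<le> t"
      then obtain y where "- u t \<in> Sign y" using elim by blast
      then have "- u t \<in> {- 1..1}" using Sign_subset by blast
      then show "\<bar>u t\<bar> \<le> 1" by auto
    qed
  qed
qed

theorem theorem6:
  shows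
    "(\<exists>C M0 T0 :: real. \<forall>u f0 f1. \<forall>T::real.
        string_evolution u f0 f1 \<longrightarrow> dry_friction u f0 f1 \<longrightarrow> rho (f0 0) (f1 0) < \<infinity> \<longrightarrow>
        (let \<rho> = (\<lambda>t. rho (f0 t) (f1 t)); M = min (\<rho> 0) (\<rho> T) in
          0 < T \<longrightarrow> T0 \<le> T \<longrightarrow> 0 < M \<longrightarrow> ereal M0 \<le> M \<longrightarrow>
          \<bar>(\<rho> 0 - \<rho> T) / ereal T - 1\<bar> \<le> ereal C * (1 / ereal T + 1 / M)))
     \<and>
     (\<exists>C M0 T0 :: real. \<forall>u f0 f1. \<forall>T::real.
        string_evolution u f0 f1 \<longrightarrow> admissible_control u \<longrightarrow> rho (f0 0) (f1 0) < \<infinity> \<longrightarrow>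
        (let \<rho> = (\<lambda>t. rho (f0 t) (f1 t)); M = min (\<rho> 0) (\<rho> T) in
          0 < T \<longrightarrow> T0 \<le> T \<longrightarrow> 0 < M \<longrightarrow> ereal M0 \<le> M \<longrightarrow>
          (\<rho> 0 - \<rho> T) / ereal T \<le> 1 + ereal C * (1 / ereal T + 1 / M)))"
proof (intro conjI)
  \<comment> \<open>The quotient has error 2 pi / T; adding the positive term in 1/M brings it to
    the form of the theorem.\<close>
  have bound: "2 * pi / T \<le> 2 * pi * (1 / T + 1 / M)" if "0 < M" for T M :: real
    using that by (simp add: distrib_left)
  show "\<exists>C M0 T0 :: real. \<forall>u f0 f1. \<forall>T::real.
        string_evolution u f0 f1 \<longrightarrow> dry_friction u f0 f1 \<longrightarrow> rho (f0 0) (f1 0) < \<infinity> \<longrightarrow>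
        (let \<rho> = (\<lambda>t. rho (f0 t) (f1 t)); M = min (\<rho> 0) (\<rho> T) in
          0 < T \<longrightarrow> T0 \<le> T \<longrightarrow> 0 < M \<longrightarrow> ereal M0 \<le> M \<longrightarrow>
          \<bar>(\<rho> 0 - \<rho> T) / ereal T - 1\<bar> \<le> ereal C * (1 / ereal T + 1 / M))"
  \<comment> \<open>The constant is the error of one passage, and M0 = 2 pi says that the supremum
    of \<bar>g\<bar> at time \<open>T\<close> is at least 1, beyond the threshold 1/2.\<close>
  proof (rule exI[of _ "2 * pi"], rule exI[of _ "2 * pi"], rule exI[of _ 1], unfold Let_def, intro allI impI)
    fix u f0 f1 and T :: real
    assume ev: "string_evolution u f0 f1" and fric: "dry_friction u f0 f1"
      and fin: "rho (f0 0) (f1 0) < \<infinity>" and T: "0 < T"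
      and M: "0 < min (rho (f0 0) (f1 0)) (rho (f0 T) (f1 T))"
        "ereal (2 * pi) \<le> min (rho (f0 0) (f1 0)) (rho (f0 T) (f1 T))"
    have um: "u \<in> borel_measurable (lebesgue_on {0..})" using fric by (simp add: dry_friction_def)
    obtain a b where ab: "rho (f0 0) (f1 0) = ereal a" "rho (f0 T) (f1 T) = ereal b"
      "a - b \<le> T + 2 * pi" "dry_friction u f0 f1 \<Longrightarrow> 2 * pi \<le> b \<Longrightarrow> T - 2 * pi \<le> a - b"
      using admissible_decrease_le[OF ev fin T um dry_friction_le_1[OF fric]] by blast
    have pos: "0 < min a b" and b: "2 * pi \<le> b" using M by (simp_all add: ab)
    have "\<bar>(a - b) / T - 1\<bar> \<le> 2 * pi / T"
    proof -
      have "(a - b) / T - 1 = (a - b - T) / T" using T by (simp add: diff_divide_distrib)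
      then have "\<bar>(a - b) / T - 1\<bar> = \<bar>a - b - T\<bar> / T" using T by (simp add: abs_divide)
      also have "\<dots> \<le> 2 * pi / T" using T ab(3) ab(4)[OF fric b] by (intro divide_right_mono) auto
      finally show ?thesis .
    qed
    also have "\<dots> \<le> 2 * pi * (1 / T + 1 / min a b)" by (rule bound[OF pos])
    finally have "\<bar>(a - b) / T - 1\<bar> \<le> 2 * pi * (1 / T + 1 / min a b)" .
    then show "\<bar>(rho (f0 0) (f1 0) - rho (f0 T) (f1 T)) / ereal T - 1\<bar>
        \<le> ereal (2 * pi) * (1 / ereal T + 1 / min (rho (f0 0) (f1 0)) (rho (f0 T) (f1 T)))"
      using T pos unfolding ab by (simp add: one_ereal_def ereal_min[symmetric] del: ereal_min)
  qed
  show "\<exists>C M0 T0 :: real. \<forall>u f0 f1. \<forall>T::real.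
        string_evolution u f0 f1 \<longrightarrow> admissible_control u \<longrightarrow> rho (f0 0) (f1 0) < \<infinity> \<longrightarrow>
        (let \<rho> = (\<lambda>t. rho (f0 t) (f1 t)); M = min (\<rho> 0) (\<rho> T) in
          0 < T \<longrightarrow> T0 \<le> T \<longrightarrow> 0 < M \<longrightarrow> ereal M0 \<le> M \<longrightarrow>
          (\<rho> 0 - \<rho> T) / ereal T \<le> 1 + ereal C * (1 / ereal T + 1 / M))"
  proof (rule exI[of _ "2 * pi"], rule exI[of _ "2 * pi"], rule exI[of _ 1], unfold Let_def, intro allI impI)
    fix u f0 f1 and T :: real
    assume ev: "string_evolution u f0 f1" and adm: "admissible_control u"
      and fin: "rho (f0 0) (f1 0) < \<infinity>" and T: "0 < T"
      and M: "0 < min (rho (f0 0) (f1 0)) (rho (f0 T) (f1 T))"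
    have um: "u \<in> borel_measurable (lebesgue_on {0..})" "AE t in lebesgue. 0 \<le> t \<longrightarrow> \<bar>u t\<bar> \<le> 1"
      using adm by (auto simp: admissible_control_def)
    obtain a b where ab: "rho (f0 0) (f1 0) = ereal a" "rho (f0 T) (f1 T) = ereal b"
      "a - b \<le> T + 2 * pi"
      using admissible_decrease_le[OF ev fin T um] by blast
    have pos: "0 < min a b" using M by (simp add: ab)
    have "(a - b) / T \<le> (T + 2 * pi) / T" using T ab(3) by (intro divide_right_mono) auto
    also have "\<dots> = 1 + 2 * pi / T" using T by (simp add: add_divide_distrib)
    also have "\<dots> \<le> 1 + 2 * pi * (1 / T + 1 / min a b)" using bound[OF pos] by simp
    finally have "(a - b) / T \<le> 1 + 2 * pi * (1 / T + 1 / min a b)" .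
    then show "(rho (f0 0) (f1 0) - rho (f0 T) (f1 T)) / ereal T
        \<le> 1 + ereal (2 * pi) * (1 / ereal T + 1 / min (rho (f0 0) (f1 0)) (rho (f0 T) (f1 T)))"
      using T pos unfolding ab by (simp add: one_ereal_def ereal_min[symmetric] del: ereal_min)
  qed
qed

end
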